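(* (1) Suppose that $\mathbf{k}_n\in\mathbb{N}^r$ (which may depend on $n$) satisfies $a(s_n\mathbf{k}_n)=o(1)$ as $n\to\infty$. Then for every $x\in[0,\infty)$, $$\lim_{n\to\infty}P_n\!\left(a(s_n\mathbf{k}_n)X_{\mathbf{k}_n}\le x\right)=1-e^{-x}.$$ (2) Let $\boldsymbol{\kappa}_n=(\kappa_{n,1},\dots,\kappa_{n,r})\in\mathbb{N}^r$ be a sequence of vectors whose components are nondecreasing in $n$ (that is, $n\mapsto\kappa_{n,j}$ is nondecreasing for each $j$) and such that $a(s_n\boldsymbol{\kappa}_n)=o\big(s_n^{\frac{r(r+1)}{r+3}}\big)$ as $n\to\infty$. Then for any choice of numbers $x_{\mathbf{k}}\in[0,\infty)$ indexed by the integer vectors $\mathbf{k}\in\prod_{j=1}^r[1,\sup_n\kappa_{n,j}]$, $$\lim_{n\to\infty}P_n\!\left(a(s_n\mathbf{k})X_{\mathbf{k}}\le x_{\mathbf{k}}\text{ for all }\mathbf{k}\in\prod_{j=1}^r[1,\kappa_{n,j}]\cap\mathbb{N}^r\right)=\lim_{n\to\infty}\prod_{k_1=1}^{\kappa_{n,1}}\cdots\prod_{k_r=1}^{\kappa_{n,r}}\left(1-e^{-x_{\mathbf{k}}}\right).$$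
   Context: Throughout $r\ge 2$ is a fixed integer and $\mathbb{N}=\{1,2,\dots\}$, $\mathbb{N}_0=\mathbb{N}\cup\{0\}$. For $\mathbf{y}\in\mathbb{R}^r_{\ge0}$ put $$a(\mathbf{y}):=\frac{1}{c_r}\prod_{1\le\ell\le j\le r}(y_\ell+\dots+y_j),\qquad c_r:=r!\,(r-1)!\cdots1!,$$ a homogeneous polynomial of degree $\frac{r(r+1)}{2}$. Finite-dimensional irreducible representations $\rho_{\mathbf{k}}$ of $\mathfrak{sl}_{r+1}(\mathbb{C})$ are indexed (up to isomorphism) by $\mathbf{k}\in\mathbb{N}^r$, with $\dim\rho_{\mathbf{k}}=a(\mathbf{k})$. A finite-dimensional representation $\rho$ (up to isomorphism, the zero representation included) is $\rho=\bigoplus_{\mathbf{k}\in\mathbb{N}^r}\rho_{\mathbf{k}}^{X_{\mathbf{k}}(\rho)}$ with multiplicities $X_{\mathbf{k}}(\rho)\in\mathbb{N}_0$, all but finitely many zero, and $\dim\rho=\sum_{\mathbf{k}}a(\mathbf{k})X_{\mathbf{k}}(\rho)$. $P_n$ is the uniform probability measure on the (finite) set of $n$-dimensional representations up to isomorphism. The $X_{\mathbf{k}}$ are regarded as random variables. For $n\in\mathbb{N}$, $q_n\in(0,1)$ is the unique solution $q$ of $\sum_{\mathbf{k}\in\mathbb{N}^r}\frac{a(\mathbf{k})q^{a(\mathbf{k})}}{1-q^{a(\mathbf{k})}}=n$, and $s_n>0$ is defined by $q_n=\exp\big(-s_n^{r(r+1)/2}\big)$. *)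

theory Defs
  imports "HOL-Probability.Probability" "HOL-Library.Landau_Symbols"
begin

text \<open>Vectors of length \<open>r\<close> are functions on \<open>{1..r}\<close>. Elements of \<open>\<nat>\<^sup>r\<close> (with
  \<open>\<nat> = {1, 2, \<dots>}\<close>) are taken extensional, so that equality of functions is equality of vectors.\<close>

definition pos_vecs :: "nat \<Rightarrow> (nat \<Rightarrow> nat) set" where
  "pos_vecs r = {1..r} \<rightarrow>\<^sub>E {1..}"

text \<open>Weyl's dimension polynomial; \<open>weyl_dim r k\<close> for \<open>k \<in> \<nat>\<^sup>r\<close> is the dimension of the
  irreducible representation \<open>\<rho>\<^sub>k\<close> of \<open>\<ss>\<ll>\<^bsub>r+1\<^esub>(\<complex>)\<close>.\<close>

definition weyl_dim :: "nat \<Rightarrow> (nat \<Rightarrow> real) \<Rightarrow> real" where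
  "weyl_dim r y = (\<Prod>j=1..r. \<Prod>l=1..j. \<Sum>i=l..j. y i) / (\<Prod>i=1..r. fact i)"

text \<open>An isomorphism class of finite-dimensional representations of \<open>\<ss>\<ll>\<^bsub>r+1\<^esub>(\<complex>)\<close> is encoded
  by its family of multiplicities \<open>X\<close>: it stands for the direct sum over \<open>k \<in> \<nat>\<^sup>r\<close> of \<open>X k\<close> copies
  of \<open>\<rho>\<^sub>k\<close>. By complete reducibility and the classification of the irreducible representations
  this is a bijection. The zero family is the zero representation.\<close>

definition is_rep :: "nat \<Rightarrow> ((nat \<Rightarrow> nat) \<Rightarrow> nat) \<Rightarrow> bool" where
  "is_rep r X \<longleftrightarrow> finite {k. X k \<noteq> 0} \<and> {k. X k \<noteq> 0} \<subseteq> pos_vecs r"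

definition rep_dim :: "nat \<Rightarrow> ((nat \<Rightarrow> nat) \<Rightarrow> nat) \<Rightarrow> real" where
  "rep_dim r X = (\<Sum>k | X k \<noteq> 0. weyl_dim r (\<lambda>i. real (k i)) * real (X k))"

definition reps_of_dim :: "nat \<Rightarrow> nat \<Rightarrow> ((nat \<Rightarrow> nat) \<Rightarrow> nat) set" where
  "reps_of_dim r n = {X. is_rep r X \<and> rep_dim r X = real n}"

definition rep_prob :: "nat \<Rightarrow> nat \<Rightarrow> (((nat \<Rightarrow> nat) \<Rightarrow> nat) \<Rightarrow> bool) \<Rightarrow> real" where
  "rep_prob r n E = measure_pmf.prob (pmf_of_set (reps_of_dim r n)) {X. E X}"

definition q_param :: "nat \<Rightarrow> nat \<Rightarrow> real" where
  "q_param r n = (THE q. 0 < q \<and> q < 1 \<and>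
     ((\<lambda>k. let d = weyl_dim r (\<lambda>i. real (k i)) in d * q powr d / (1 - q powr d))
        has_sum real n) (pos_vecs r))"

definition s_param :: "nat \<Rightarrow> nat \<Rightarrow> real" where
  "s_param r n = (THE s. 0 < s \<and> q_param r n = exp (- (s powr (real (r * (r + 1)) / 2))))"

definition scaled_dim :: "nat \<Rightarrow> nat \<Rightarrow> (nat \<Rightarrow> nat) \<Rightarrow> real" where
  "scaled_dim r n k = weyl_dim r (\<lambda>i. s_param r n * real (k i))"

definition int_box :: "nat \<Rightarrow> (nat \<Rightarrow> nat) \<Rightarrow> (nat \<Rightarrow> nat) set" where
  "int_box r K = (\<Pi>\<^sub>E j\<in>{1..r}. {1..K j})"

end

theory Submission
  imports Defs "HOL-Real_Asymp.Real_Asymp"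
begin

text \<open>
  Only two facts about the numbers \<open>p n\<close> of \<open>n\<close>-dimensional representations are needed. Write
  \<open>B = 1 / (- ln q\<^sub>n)\<close> for the scale at which \<open>scaled_dim\<close> equals dimension divided by \<open>B\<close>. Then
  \<open>p (n - t) / p n\<close> tends to \<open>exp (- x)\<close> whenever \<open>t / B\<close> tends to \<open>x\<close>, and
  \<open>p (n - t) / p n \<le> C * exp (- t / B)\<close> for all \<open>t \<le> n\<close> and all large \<open>n\<close>
  (\<open>num_parts_ratio_limit\<close>, \<open>num_parts_ratio_bound\<close>).

  Removing \<open>m\<close> copies of \<open>\<rho>\<^sub>k\<close> shows that \<open>P\<^sub>n(X\<^sub>k \<ge> m) = p (n - m * a(k)) / p n\<close>. With
  \<open>m\<close> about \<open>x / a(s\<^sub>n k)\<close> the first fact gives part (1), and, splitting off one \<open>k\<close> after the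
  other, the joint law over a fixed finite set of vectors. For growing boxes the probability
  is at most that of any fixed earlier box, so its upper limit is at most the limit \<open>L\<close> of the
  products. If \<open>L > 0\<close>, then \<open>exp (- x\<^sub>k)\<close> is summable over the union of the boxes, and by the
  second fact the vectors outside a large fixed box spoil the event with probability at most
  \<open>C\<close> times a small tail of this sum. Hence the lower limit is at least \<open>L\<close>.

  The two facts follow from a local limit theorem. Tilting by \<open>q\<^sub>n\<close> makes the multiplicities
  independent geometric variables whose weighted sum has mean \<open>n\<close>, up to a negligible error from
  the parts larger than \<open>n\<close>. Then \<open>p m * q\<^sub>n ^ m\<close> is, up to a factor independent of \<open>m\<close>, the \<open>m\<close>-th
  Fourier coefficient of the characteristic function \<open>psi\<close> (\<open>integral_psi\<close>). After rescaling
  by the standard deviation, \<open>psi\<close> converges to a Gaussian (\<open>clt_pointwise\<close>). It is dominated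
  by a Gaussian near 0 (\<open>psi_near\<close>) and negligible elsewhere (\<open>psi_rest\<close>). So the
  coefficients at \<open>n\<close> and at \<open>n - t\<close> agree asymptotically for \<open>t = O(B)\<close>, because \<open>B\<close> is of
  smaller order than the standard deviation, and the coefficients are all bounded by a multiple of
  the one at \<open>n\<close>.

  The argument uses little about the dimensions, and this is collected in the locale
  \<open>partition_weights\<close>: they are positive integers, a power of their inverses is summable, their
  counting function grows at least like a power, and they are not concentrated near the multiples
  of any number. For Weyl's dimension polynomial the integrality comes from a divisibility
  property of Vandermonde products (\<open>superfactorial_dvd_vdm\<close>), and the growth and the
  aperiodicity from the vectors \<open>(t, 1, \<dots>, 1)\<close>, whose dimensions are binomial coefficients.
\<close>

section \<open>Counting coloured partitions\<close>

text \<open>Partitions whose parts are the elements of a set, a part \<open>k\<close> having size \<open>a k\<close>: they are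
  given by their multiplicity functions.\<close>

definition weight :: "('a \<Rightarrow> nat) \<Rightarrow> ('a \<Rightarrow> nat) \<Rightarrow> nat" where
  "weight a X = (\<Sum>k | X k \<noteq> 0. a k * X k)"

definition parts :: "('a \<Rightarrow> nat) \<Rightarrow> 'a set \<Rightarrow> nat \<Rightarrow> ('a \<Rightarrow> nat) set" where
  "parts a S m = {X. finite {k. X k \<noteq> 0} \<and> {k. X k \<noteq> 0} \<subseteq> S \<and> weight a X = m}"

definition num_parts :: "('a \<Rightarrow> nat) \<Rightarrow> 'a set \<Rightarrow> nat \<Rightarrow> nat" where
  "num_parts a S m = card (parts a S m)"

lemma weight_superset:
  assumes "finite T" "{k. X k \<noteq> 0} \<subseteq> T"
  shows "weight a X = (\<Sum>k\<in>T. a k * X k)"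
  unfolding weight_def using assms by (intro sum.mono_neutral_left) auto

lemma supp_upd_subset: "{k. (X(j := v)) k \<noteq> 0} \<subseteq> insert j {k. X k \<noteq> (0::nat)}"
  by auto

lemma weight_upd:
  assumes "finite {k. X k \<noteq> 0}"
  shows "weight a (X(j := v)) + a j * X j = weight a X + a j * v"
proof -
  let ?T = "insert j {k. X k \<noteq> 0}"
  have fin: "finite ?T" using assms by simp
  have 1: "weight a (X(j := v)) = (\<Sum>k\<in>?T. a k * (X(j := v)) k)"
    by (rule weight_superset[OF fin supp_upd_subset])
  have 2: "weight a X = (\<Sum>k\<in>?T. a k * X k)"
    by (rule weight_superset[OF fin]) auto
  have 3: "(\<Sum>k\<in>?T - {j}. a k * (X(j := v)) k) = (\<Sum>k\<in>?T - {j}. a k * X k)"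
    by (intro sum.cong) auto
  show ?thesis unfolding 1 2 sum.remove[OF fin insertI1] 3 by simp
qed

lemma weight_ge: "finite {k. X k \<noteq> 0} \<Longrightarrow> a j * X j \<le> weight a X"
  using weight_upd[of X a j 0] by simp

lemma finite_parts:
  assumes "\<And>k. k \<in> S \<Longrightarrow> a k \<ge> 1" "finite {k \<in> S. a k \<le> m}"
  shows "finite (parts a S m)"
proof -
  let ?A = "{k \<in> S. a k \<le> m}"
  have "parts a S m \<subseteq> {f. \<forall>x. (x \<in> ?A \<longrightarrow> f x \<in> {..m}) \<and> (x \<notin> ?A \<longrightarrow> f x = 0)}"
  proof (clarify, intro conjI impI)
    fix X k assume X: "X \<in> parts a S m"
    have le: "a k * X k \<le> m" using X weight_ge[of X a k] by (auto simp: parts_def)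
    show "X k \<in> {..m}" if "k \<in> ?A"
    proof -
      have "1 * X k \<le> a k * X k" using that assms(1)[of k] by (intro mult_right_mono) auto
      hence "X k \<le> m" using le by linarith
      thus ?thesis by simp
    qed
    show "X k = 0" if "k \<notin> ?A"
    proof (rule ccontr)
      assume "X k \<noteq> 0"
      hence "k \<in> S" "a k * 1 \<le> a k * X k" using X by (auto simp: parts_def)
      hence "a k \<le> m" using le by linarith
      thus False using that \<open>k \<in> S\<close> by simp
    qed
  qed
  thus ?thesis by (rule finite_subset) (intro finite_set_of_finite_funs assms finite_atMost)
qed

lemma parts_restrict:
  assumes "m \<le> n"
  shows "parts a {k \<in> S. a k \<le> n} m = parts a S m"
proof -
  have "a k \<le> n" if "X \<in> parts a S m" "X k \<noteq> 0" for X k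
  proof -
    have "a k * 1 \<le> a k * X k" using that by simp
    also have "\<dots> \<le> m" using that weight_ge[of X a k] by (auto simp: parts_def)
    finally show ?thesis using assms by simp
  qed
  thus ?thesis unfolding parts_def by blast
qed

text \<open>Removing \<open>j\<close> copies of a part \<open>k\<close> is a bijection; this is the only combinatorial fact about
  partitions that the limit laws rest on.\<close>

lemma card_parts_shift:
  assumes "k \<in> S" and "\<And>X v. P (X(k := v)) = P X"
  shows "card {X \<in> parts a S (m + a k * j). j \<le> X k \<and> P X} = card {X \<in> parts a S m. P X}"
proof (rule bij_betw_same_card[OF bij_betw_byWitness[where f = "\<lambda>X. X(k := X k - j)" and f' = "\<lambda>X. X(k := X k + j)"]])
  show "(\<lambda>X. X(k := X k - j)) ` {X \<in> parts a S (m + a k * j). j \<le> X k \<and> P X} \<subseteq> {X \<in> parts a S m. P X}"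
  proof safe
    fix X assume X: "X \<in> parts a S (m + a k * j)" "j \<le> X k" "P X"
    have fin: "finite {i. X i \<noteq> 0}" using X by (simp add: parts_def)
    have "weight a (X(k := X k - j)) + a k * X k = m + a k * j + a k * (X k - j)"
      using weight_upd[OF fin, of a k "X k - j"] X by (simp add: parts_def)
    also have "\<dots> = m + a k * X k" using X(2) by (simp add: diff_mult_distrib2)
    finally have "weight a (X(k := X k - j)) = m" by simp
    moreover have "finite {i. (X(k := X k - j)) i \<noteq> 0}"
      by (rule finite_subset[OF supp_upd_subset]) (use fin in simp)
    moreover have "{i. (X(k := X k - j)) i \<noteq> 0} \<subseteq> S"
      using supp_upd_subset[of X k "X k - j"] X(1) assms(1) unfolding parts_def by blast
    ultimately show "X(k := X k - j) \<in> parts a S m" unfolding parts_def by blast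
    show "P (X(k := X k - j))" using X assms(2) by simp
  qed
  show "(\<lambda>X. X(k := X k + j)) ` {X \<in> parts a S m. P X} \<subseteq> {X \<in> parts a S (m + a k * j). j \<le> X k \<and> P X}"
  proof safe
    fix X assume X: "X \<in> parts a S m" "P X"
    have fin: "finite {i. X i \<noteq> 0}" using X by (simp add: parts_def)
    have "weight a (X(k := X k + j)) + a k * X k = m + a k * j + a k * X k"
      using weight_upd[OF fin, of a k "X k + j"] X by (simp add: parts_def algebra_simps)
    hence "weight a (X(k := X k + j)) = m + a k * j" by simp
    moreover have "finite {i. (X(k := X k + j)) i \<noteq> 0}"
      by (rule finite_subset[OF supp_upd_subset]) (use fin in simp)
    moreover have "{i. (X(k := X k + j)) i \<noteq> 0} \<subseteq> S"
      using supp_upd_subset[of X k "X k + j"] X(1) assms(1) unfolding parts_def by blast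
    ultimately show "X(k := X k + j) \<in> parts a S (m + a k * j)" unfolding parts_def by blast
    show "P (X(k := X k + j))" using X assms(2) by simp
  qed auto
qed auto

lemma num_parts_empty: "num_parts a {} m = (if m = 0 then 1 else 0)"
proof -
  have "parts a {} m = (if m = 0 then {\<lambda>_. 0} else {})"
    by (auto simp: parts_def weight_def)
  thus ?thesis by (simp add: num_parts_def)
qed

lemma num_parts_insert:
  assumes "finite S" "k \<notin> S" "\<And>i. i \<in> insert k S \<Longrightarrow> a i \<ge> 1"
  shows "num_parts a (insert k S) m =
           num_parts a S m + (if a k \<le> m then num_parts a (insert k S) (m - a k) else 0)"
proof -
  let ?W = "parts a (insert k S) m"
  have fin: "finite ?W" using assms by (intro finite_parts) auto
  have "?W = parts a S m \<union> {X \<in> ?W. 1 \<le> X k}"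
    by (auto simp: parts_def)
  moreover have "parts a S m \<inter> {X \<in> ?W. 1 \<le> X k} = {}"
    using assms(2) by (force simp: parts_def)
  moreover have "finite (parts a S m)" by (rule finite_subset[OF _ fin]) (auto simp: parts_def)
  ultimately have "card ?W = card (parts a S m) + card {X \<in> ?W. 1 \<le> X k}"
    using fin by (metis (no_types, lifting) card_Un_disjoint finite_Un)
  moreover have "card {X \<in> ?W. 1 \<le> X k} = (if a k \<le> m then num_parts a (insert k S) (m - a k) else 0)"
  proof (cases "a k \<le> m")
    case True
    thus ?thesis using card_parts_shift[of k "insert k S" "\<lambda>_. True" a "m - a k" 1]
      by (simp add: num_parts_def)
  next
    case False
    have "X k = 0" if "X \<in> ?W" for X
    proof (rule ccontr)
      assume "X k \<noteq> 0"
      hence "a k * 1 \<le> a k * X k" by simp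
      also have "\<dots> \<le> m" using that weight_ge[of X a k] by (auto simp: parts_def)
      finally show False using False by simp
    qed
    hence "{X \<in> ?W. 1 \<le> X k} = {}" by force
    thus ?thesis using False by (metis card.empty)
  qed
  ultimately show ?thesis by (simp add: num_parts_def)
qed

section \<open>Partition numbers as Fourier coefficients\<close>

definition genfun :: "('a \<Rightarrow> nat) \<Rightarrow> real \<Rightarrow> 'a set \<Rightarrow> real \<Rightarrow> complex" where
  "genfun a q S \<theta> = (\<Prod>k\<in>S. 1 / (1 - of_real (q ^ a k) * cis (real (a k) * \<theta>)))"

lemma one_minus_cis_nz:
  assumes "0 < q" "q < 1" "a \<ge> (1::nat)"
  shows "1 - complex_of_real (q ^ a) * cis t \<noteq> 0"
proof
  assume "1 - complex_of_real (q ^ a) * cis t = 0"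
  hence "norm (complex_of_real (q ^ a) * cis t) = 1" by (metis eq_iff_diff_eq_0 norm_one)
  hence "q ^ a = 1" using assms by (simp add: norm_mult norm_power)
  moreover have "q ^ a < 1" using assms by (intro power_less_one_iff[THEN iffD2]) auto
  ultimately show False by simp
qed

lemma continuous_on_genfun [continuous_intros]:
  assumes "0 < q" "q < 1" "\<And>k. k \<in> S \<Longrightarrow> a k \<ge> 1"
  shows "continuous_on T (genfun a q S)"
  unfolding genfun_def
  by (intro continuous_intros) (use assms one_minus_cis_nz[of q] in auto)

lemma integral_cis_int:
  "integral {-pi..pi} (\<lambda>\<theta>. cis (of_int m * \<theta>)) = (if m = 0 then 2 * pi else 0)"
proof (cases "m = 0")
  case False
  have "((\<lambda>\<theta>. cis (of_int m * \<theta>)) has_integral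
       (cis (of_int m * pi) / (\<i> * of_int m) - cis (of_int m * (-pi)) / (\<i> * of_int m))) {-pi..pi}"
  proof (rule fundamental_theorem_of_calculus)
    fix x :: real
    show "((\<lambda>x. cis (of_int m * x) / (\<i> * of_int m)) has_vector_derivative cis (of_int m * x)) (at x within {-pi..pi})"
      unfolding cis_conv_exp
      by (rule derivative_eq_intros has_vector_derivative_real_field | use False in \<open>simp add: field_simps\<close>)+
  qed simp
  moreover have "cis (of_int m * pi) = cis (of_int m * (-pi))"
    by (simp add: complex_eq_iff sin_zero_iff_int2)
  ultimately show ?thesis using False by (simp add: integral_unique)
qed (simp add: scaleR_conv_of_real)

text \<open>Both sides obey the recurrence that comes from the factor of one part. For the integrals
  it determines the values at negative \<open>m\<close> as well: they are bounded and are multiplied by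
  \<open>q ^ a k < 1\<close> when \<open>m\<close> decreases by \<open>a k\<close>, so they vanish.\<close>

lemma integral_genfun:
  assumes "finite S" "\<And>k. k \<in> S \<Longrightarrow> a k \<ge> 1" "0 < q" "q < 1"
  shows "integral {-pi..pi} (\<lambda>\<theta>. genfun a q S \<theta> * cis (- (of_int m * \<theta>))) =
           (if m \<ge> 0 then of_real (2 * pi * real (num_parts a S (nat m)) * q ^ nat m) else 0)"
  using assms(1,2)
proof (induction S arbitrary: m rule: finite_induct)
  case empty
  have "integral {-pi..pi} (\<lambda>\<theta>. genfun a q {} \<theta> * cis (- (of_int m * \<theta>))) =
        integral {-pi..pi} (\<lambda>\<theta>. cis (of_int (-m) * \<theta>))"
    by (simp add: genfun_def)
  also have "\<dots> = (if m = 0 then 2 * pi else 0)" by (subst integral_cis_int) auto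
  finally show ?case by (auto simp: num_parts_empty)
next
  case (insert k S)
  let ?S = "insert k S"
  define J where "J = (\<lambda>m::int. integral {-pi..pi} (\<lambda>\<theta>. genfun a q ?S \<theta> * cis (- (of_int m * \<theta>))))"
  define I where "I = (\<lambda>m::int. integral {-pi..pi} (\<lambda>\<theta>. genfun a q S \<theta> * cis (- (of_int m * \<theta>))))"
  have ak: "a k \<ge> 1" using insert.prems by auto
  have qa: "0 < q ^ a k" "q ^ a k < 1"
    using ak assms(3,4) by (auto intro: power_less_one_iff[THEN iffD2])
  have IH: "I m = (if m \<ge> 0 then of_real (2 * pi * real (num_parts a S (nat m)) * q ^ nat m) else 0)" for m
    unfolding I_def using insert.IH insert.prems by auto
  have rec: "J m = I m + of_real (q ^ a k) * J (m - int (a k))" for m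
  proof -
    have "genfun a q S \<theta> * cis (- (of_int m * \<theta>)) =
          genfun a q ?S \<theta> * cis (- (of_int m * \<theta>)) -
          of_real (q ^ a k) * (genfun a q ?S \<theta> * cis (- (of_int (m - int (a k)) * \<theta>)))" for \<theta>
    proof -
      have c: "cis (- (of_int (m - int (a k)) * \<theta>)) = cis (real (a k) * \<theta>) * cis (- (of_int m * \<theta>))"
        by (simp add: cis_mult algebra_simps)
      have "genfun a q S \<theta> = genfun a q ?S \<theta> * (1 - of_real (q ^ a k) * cis (real (a k) * \<theta>))"
        using insert.hyps one_minus_cis_nz[OF assms(3,4) ak, of "real (a k) * \<theta>"]
        by (simp add: genfun_def)
      hence "genfun a q S \<theta> * cis (- (of_int m * \<theta>)) =
        genfun a q ?S \<theta> * (1 - of_real (q ^ a k) * cis (real (a k) * \<theta>)) * cis (- (of_int m * \<theta>))"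
        by simp
      thus ?thesis unfolding c by (simp add: algebra_simps)
    qed
    hence "I m = integral {-pi..pi} (\<lambda>\<theta>. genfun a q ?S \<theta> * cis (- (of_int m * \<theta>)) -
          of_real (q ^ a k) * (genfun a q ?S \<theta> * cis (- (of_int (m - int (a k)) * \<theta>))))"
      unfolding I_def by (intro integral_cong) auto
    also have "\<dots> = J m - of_real (q ^ a k) * J (m - int (a k))"
      unfolding J_def using insert.prems assms(3,4)
      by (subst integral_diff) (auto intro!: integrable_continuous_interval continuous_intros)
    finally show ?thesis by simp
  qed
  have "\<exists>C. \<forall>m. norm (J m) \<le> C"
  proof -
    have "compact (genfun a q ?S ` {-pi..pi})"
      using insert.prems assms(3,4) by (intro compact_continuous_image continuous_on_genfun) auto
    then obtain C where C: "\<And>\<theta>. \<theta> \<in> {-pi..pi} \<Longrightarrow> norm (genfun a q ?S \<theta>) \<le> C"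
      using compact_imp_bounded bounded_iff by (metis imageI)
    have "norm (J m) \<le> C * (pi - (-pi))" for m
      unfolding J_def
      by (rule integral_bound)
         (use insert.prems assms(3,4) C in \<open>auto intro!: continuous_intros simp: norm_mult\<close>)
    thus ?thesis by blast
  qed
  then obtain C where C: "\<And>m. norm (J m) \<le> C" by blast
  have neg: "J m = 0" if "m < 0" for m
  proof -
    have iter: "J m = of_real (q ^ a k) ^ j * J (m - int j * int (a k))" for j
    proof (induction j)
      case (Suc j)
      have "m - int j * int (a k) < 0" using that by (smt (verit) mult_nonneg_nonneg of_nat_0_le_iff)
      hence "J (m - int j * int (a k)) = of_real (q ^ a k) * J (m - int j * int (a k) - int (a k))"
        using rec[of "m - int j * int (a k)"] IH[of "m - int j * int (a k)"] by simp
      thus ?case using Suc by (simp add: algebra_simps)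
    qed simp
    have "norm (J m) \<le> (q ^ a k) ^ j * C" for j
    proof -
      have "norm (J m) = (q ^ a k) ^ j * norm (J (m - int j * int (a k)))"
        by (subst iter[of j]) (use assms(3) in \<open>simp add: norm_mult norm_power\<close>)
      also have "\<dots> \<le> (q ^ a k) ^ j * C" using C qa by (intro mult_left_mono) auto
      finally show ?thesis .
    qed
    moreover have "(\<lambda>j. (q ^ a k) ^ j * C) \<longlonglongrightarrow> 0 * C"
      using qa by (intro tendsto_intros LIMSEQ_realpow_zero) auto
    ultimately have "norm (J m) \<le> 0 * C"
      by (intro LIMSEQ_le_const) auto
    thus ?thesis by simp
  qed
  have "J m = (if m \<ge> 0 then of_real (2 * pi * real (num_parts a ?S (nat m)) * q ^ nat m) else 0)"
  proof (induction "nat m" arbitrary: m rule: less_induct)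
    case less
    show ?case
    proof (cases "m \<ge> int (a k)")
      case True
      have "J (m - int (a k)) = of_real (2 * pi * real (num_parts a ?S (nat (m - int (a k)))) * q ^ nat (m - int (a k)))"
        using less[of "m - int (a k)"] True ak by auto
      moreover have "nat (m - int (a k)) = nat m - a k" "a k \<le> nat m" using True by auto
      moreover have "q ^ nat m = q ^ a k * q ^ (nat m - a k)"
        using \<open>a k \<le> nat m\<close> by (simp flip: power_add)
      moreover have "num_parts a ?S (nat m) = num_parts a S (nat m) + num_parts a ?S (nat m - a k)"
        using num_parts_insert[of S k a "nat m"] insert.hyps insert.prems \<open>a k \<le> nat m\<close> by simp
      ultimately show ?thesis
        using rec[of m] IH[of m] True by (simp add: algebra_simps)
    next
      case False
      hence "\<not> a k \<le> nat m" using ak by auto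
      hence "num_parts a ?S (nat m) = num_parts a S (nat m)"
        using num_parts_insert[of S k a "nat m", OF insert.hyps(1,2) insert.prems] by simp
      with False show ?thesis using rec[of m] IH[of m] neg[of "m - int (a k)"] neg[of m] by simp
    qed
  qed
  thus ?case unfolding J_def .
qed

section \<open>Elementary estimates\<close>

lemma jordan_inequality:
  assumes "0 \<le> y" "y \<le> pi / 2"
  shows "2 / pi * y \<le> sin y"
proof -
  have "convex_on {0..pi} (\<lambda>x. - sin x)"
    by (rule f''_ge0_imp_convex[where f' = "\<lambda>x. - cos x" and f'' = sin])
       (auto intro!: derivative_eq_intros sin_ge_zero)
  from convex_onD[OF this, of "2 / pi * y" 0 "pi / 2"] assms show ?thesis
    by (simp add: field_simps)
qed

lemma abs_sin_ge:
  assumes "\<bar>t\<bar> \<le> pi"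
  shows "\<bar>t\<bar> / pi \<le> \<bar>sin (t / 2)\<bar>"
proof -
  have "2 / pi * (\<bar>t\<bar> / 2) \<le> sin (\<bar>t\<bar> / 2)" using assms by (intro jordan_inequality) auto
  also have "\<dots> \<le> \<bar>sin (t / 2)\<bar>" by (cases "t \<ge> 0") auto
  finally show ?thesis by simp
qed

lemma exp_neg_le_power:
  assumes "y > (0::real)"
  shows "exp (- y) \<le> real D ^ D / y ^ D"
proof (cases "D = 0")
  case False
  have "(y / real D) ^ D \<le> (1 + y / real D) ^ D" using assms by (intro power_mono) auto
  also have "\<dots> \<le> exp y" using False assms by (intro exp_ge_one_plus_x_over_n_power_n) auto
  finally show ?thesis using assms False by (simp add: exp_minus field_simps)
qed (use assms in auto)

lemma inverse_one_minus_exp_le: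
  assumes "t > (0::real)"
  shows "1 / (1 - exp (- t)) \<le> (1 + t) / t"
proof -
  have "exp (- t) \<le> 1 / (1 + t)" using assms exp_ge_add_one_self[of t] by (simp add: exp_minus field_simps)
  hence "t / (1 + t) \<le> 1 - exp (- t)" using assms by (simp add: field_simps)
  moreover have "0 < t / (1 + t)" using assms by simp
  ultimately have "1 / (1 - exp (- t)) \<le> 1 / (t / (1 + t))" by (intro frac_le) auto
  thus ?thesis by simp
qed

lemma ln_add_one_ge: "0 \<le> y \<Longrightarrow> y / (1 + y) \<le> ln (1 + y :: real)"
  using ln_add_one_self_le_self2[of "- y / (1 + y)"] ln_inverse[of "1 + y"]
  by (simp add: field_simps)

section \<open>The saddle point\<close>

text \<open>\<open>D\<close> keeps all sums over parts polynomial in the scale, so that exponentially small factors win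
  against them. \<open>g\<close> makes the standard deviation of the tilted sum exceed the scale \<open>B\<close> by a power
  of \<open>B\<close>. The last assumption controls the characteristic function away from 0: for every frequency
  there are as many parts of bounded size as desired that see it.\<close>

locale partition_weights =
  fixes a :: "'a \<Rightarrow> nat" and I :: "'a set" and D :: nat and g c0 :: real
  assumes a_pos: "k \<in> I \<Longrightarrow> a k \<ge> 1"
    and summable_weights: "(\<lambda>k. 1 / real (a k) ^ D) summable_on I"
    and g_pos: "g > 0" and c0_pos: "c0 > 0"
    and count_ge: "x \<ge> 1 \<Longrightarrow> c0 * x powr g \<le> real (card {k \<in> I. real (a k) \<le> x})"
    and aperiodic: "\<exists>R c. c > 0 \<and> (\<forall>\<theta>. \<bar>\<theta>\<bar> \<le> pi \<longrightarrow>
          (\<exists>T\<subseteq>I. finite T \<and> card T = J \<and>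
             (\<forall>k\<in>T. real (a k) \<le> R \<and> c * \<bar>\<theta>\<bar> \<le> \<bar>sin (real (a k) * \<theta> / 2)\<bar>)))"
begin

definition weight_sum :: real where "weight_sum = (\<Sum>\<^sub>\<infinity>k\<in>I. 1 / real (a k) ^ D)"

definition tail_const :: real where "tail_const = (4 * real D) ^ D * weight_sum"

text \<open>For \<open>X\<close> geometric with ratio \<open>exp (- a k / B)\<close>, the values for \<open>j = 1\<close> and \<open>j = 2\<close> are mean and
  variance of \<open>a k * X\<close>. For \<open>j = 3\<close> this bounds the third derivative of the logarithm of its
  characteristic function, up to a constant.\<close>

definition mom :: "nat \<Rightarrow> real \<Rightarrow> 'a \<Rightarrow> real" where
  "mom j B k = (real (a k) / (1 - exp (- (real (a k) / B)))) ^ j * exp (- (real (a k) / B))"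

lemma weight_sum_nonneg: "weight_sum \<ge> 0"
  unfolding weight_sum_def by (intro infsum_nonneg) auto

lemma tail_const_nonneg: "tail_const \<ge> 0"
  unfolding tail_const_def using weight_sum_nonneg by simp

lemma sum_inverse_le: "finite K \<Longrightarrow> K \<subseteq> I \<Longrightarrow> (\<Sum>k\<in>K. 1 / real (a k) ^ D) \<le> weight_sum"
  unfolding weight_sum_def by (intro finite_sum_le_infsum summable_weights) auto

lemma one_minus_exp_pos: "k \<in> I \<Longrightarrow> B > 0 \<Longrightarrow> 1 - exp (- (real (a k) / B)) > 0"
  using a_pos[of k] by simp

lemma mom_pos: "k \<in> I \<Longrightarrow> B > 0 \<Longrightarrow> mom j B k > 0"
  unfolding mom_def using one_minus_exp_pos[of k B] a_pos[of k] by (intro mult_pos_pos zero_less_power) auto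

lemma base_le:
  assumes "k \<in> I" "B > 0"
  shows "real (a k) / (1 - exp (- (real (a k) / B))) \<le> B * (1 + real (a k) / B)"
proof -
  define t where "t = real (a k) / B"
  have t: "t > 0" using assms a_pos[of k] by (simp add: t_def)
  have "real (a k) * (1 / (1 - exp (- t))) \<le> real (a k) * ((1 + t) / t)"
    using inverse_one_minus_exp_le[OF t] by (intro mult_left_mono) auto
  moreover have "real (a k) = B * t" using assms by (simp add: t_def)
  hence "real (a k) * ((1 + t) / t) = B * (1 + t)" using t by simp
  ultimately show ?thesis by (simp add: t_def)
qed

text \<open>With \<open>t = a k / B\<close> the base of the power is at most \<open>B * (1 + t)\<close>, and \<open>(1 + t) ^ 3\<close> is at
  most \<open>216 * exp (t / 2)\<close>. Half of the exponential decay remains to make sums over \<open>k\<close> converge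
  and to make their tails small.\<close>

lemma mom_le:
  assumes "k \<in> I" "B > 0" "j \<le> 3"
  shows "mom j B k \<le> 216 * B ^ j * exp (- (real (a k) / (2 * B)))"
proof -
  define t where "t = real (a k) / B"
  have t: "t > 0" using assms a_pos[of k] by (simp add: t_def)
  have "1 + t \<le> 6 * exp (t / 6)" using exp_ge_add_one_self[of "t / 6"] by linarith
  hence "real (a k) / (1 - exp (- t)) \<le> B * (6 * exp (t / 6))"
    using base_le[OF assms(1,2)] assms(2)
    by (smt (verit) mult_left_mono t_def)
  moreover have "0 \<le> real (a k) / (1 - exp (- t))" using t by simp
  ultimately have "(real (a k) / (1 - exp (- t))) ^ j \<le> (B * (6 * exp (t / 6))) ^ j"
    by (intro power_mono)
  also have "\<dots> = B ^ j * (6 * exp (t / 6)) ^ j" by (simp add: power_mult_distrib)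
  also have "\<dots> \<le> B ^ j * (6 * exp (t / 6)) ^ 3"
    using assms t \<open>1 + t \<le> 6 * exp (t / 6)\<close> by (intro mult_left_mono power_increasing) auto
  also have "(6 * exp (t / 6)) ^ 3 = 216 * exp (t / 2)"
    by (simp add: power_mult_distrib flip: exp_of_nat_mult)
  finally have "mom j B k \<le> B ^ j * (216 * exp (t / 2)) * exp (- t)"
    unfolding mom_def t_def[symmetric] by (intro mult_right_mono) auto
  also have "\<dots> = 216 * B ^ j * (exp (t / 2) * exp (- t))" by simp
  also have "exp (t / 2) * exp (- t) = exp (- (t / 2))" by (simp flip: exp_add)
  also have "t / 2 = real (a k) / (2 * B)" by (simp add: t_def)
  finally show ?thesis .
qed

lemma exp_le_weight:
  assumes "k \<in> I" "B > 0"
  shows "exp (- (real (a k) / (4 * B))) \<le> (4 * real D) ^ D * B ^ D * (1 / real (a k) ^ D)"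
  using exp_neg_le_power[of "real (a k) / (4 * B)" D] assms a_pos[of k]
  by (simp add: power_divide power_mult_distrib field_simps)

lemma sum_exp_le:
  assumes "finite K" "K \<subseteq> I" "B > 0"
  shows "(\<Sum>k\<in>K. exp (- (real (a k) / (4 * B)))) \<le> tail_const * B ^ D"
proof -
  have "(\<Sum>k\<in>K. exp (- (real (a k) / (4 * B)))) \<le> (\<Sum>k\<in>K. (4 * real D) ^ D * B ^ D * (1 / real (a k) ^ D))"
    using assms by (intro sum_mono exp_le_weight) auto
  also have "\<dots> = (4 * real D) ^ D * B ^ D * (\<Sum>k\<in>K. 1 / real (a k) ^ D)" by (simp add: sum_distrib_left)
  also have "\<dots> \<le> (4 * real D) ^ D * B ^ D * weight_sum" using assms sum_inverse_le by (intro mult_left_mono) auto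
  finally show ?thesis by (simp add: tail_const_def algebra_simps)
qed

lemma sum_mom_tail_le:
  assumes "finite K" "K \<subseteq> I" "B > 0" "j \<le> 3" "\<And>k. k \<in> K \<Longrightarrow> real (a k) \<ge> B * A"
  shows "(\<Sum>k\<in>K. mom j B k) \<le> 216 * B ^ j * exp (- (A / 4)) * (tail_const * B ^ D)"
proof -
  have "mom j B k \<le> 216 * B ^ j * exp (- (A / 4)) * exp (- (real (a k) / (4 * B)))" if "k \<in> K" for k
  proof -
    have "A \<le> real (a k) / B" using assms(3) assms(5)[OF that] by (simp add: field_simps)
    hence "exp (- (real (a k) / (2 * B))) \<le> exp (- (A / 4) + - (real (a k) / (4 * B)))"
      by (simp add: field_simps)
    hence "216 * B ^ j * exp (- (real (a k) / (2 * B))) \<le> 216 * B ^ j * (exp (- (A / 4)) * exp (- (real (a k) / (4 * B))))"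
      unfolding exp_add using assms(3) by (intro mult_left_mono) auto
    moreover have "mom j B k \<le> 216 * B ^ j * exp (- (real (a k) / (2 * B)))"
      using that assms by (intro mom_le) auto
    ultimately show ?thesis by (simp add: mult.assoc)
  qed
  hence "(\<Sum>k\<in>K. mom j B k) \<le> (\<Sum>k\<in>K. 216 * B ^ j * exp (- (A / 4)) * exp (- (real (a k) / (4 * B))))"
    by (rule sum_mono)
  also have "\<dots> = 216 * B ^ j * exp (- (A / 4)) * (\<Sum>k\<in>K. exp (- (real (a k) / (4 * B))))"
    by (simp add: sum_distrib_left)
  also have "\<dots> \<le> 216 * B ^ j * exp (- (A / 4)) * (tail_const * B ^ D)"
    using assms sum_exp_le by (intro mult_left_mono) auto
  finally show ?thesis .
qed

lemma sum_mom_le: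
  assumes "finite K" "K \<subseteq> I" "B > 0" "j \<le> 3"
  shows "(\<Sum>k\<in>K. mom j B k) \<le> 216 * B ^ j * (tail_const * B ^ D)"
  using sum_mom_tail_le[of K B j 0] assms by simp

text \<open>Parts up to size \<open>B\<close> each contribute the full order \<open>B ^ j\<close>; with the lower bound for the number
  of such parts this bounds all means and variances from below.\<close>

lemma mom_ge:
  assumes "k \<in> I" "B > 0" "real (a k) \<le> B"
  shows "mom j B k \<ge> B ^ j / 3"
proof -
  define t where "t = real (a k) / B"
  have t: "0 < t" "t \<le> 1" using assms a_pos[of k] by (auto simp: t_def)
  have "1 - exp (- t) \<le> t" using exp_ge_add_one_self[of "-t"] by linarith
  hence "real (a k) / t \<le> real (a k) / (1 - exp (- t))"
    using t by (intro divide_left_mono mult_pos_pos) auto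
  moreover have "real (a k) / t = B" using assms a_pos[of k] by (simp add: t_def)
  ultimately have 1: "B ^ j \<le> (real (a k) / (1 - exp (- t))) ^ j" using assms by (intro power_mono) auto
  have "exp (-1) \<le> exp (- t)" using t by simp
  moreover have "1 / 3 \<le> exp (-1 :: real)" using exp_le by (simp add: exp_minus field_simps)
  ultimately have "1 / 3 \<le> exp (- t)" by linarith
  hence "B ^ j * (1 / 3) \<le> (real (a k) / (1 - exp (- t))) ^ j * exp (- t)"
    using 1 assms order_trans[OF zero_le_power[OF less_imp_le[OF assms(2)]] 1]
    by (intro mult_mono) auto
  thus ?thesis by (simp add: mom_def t_def)
qed

lemma finite_weights_le: "finite {k \<in> I. real (a k) \<le> x}"
proof (rule ccontr)
  assume inf: "infinite {k \<in> I. real (a k) \<le> x}"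
  define y where "y = max 1 x"
  obtain N :: nat where N: "real N > weight_sum * y ^ D" using reals_Archimedean2 by blast
  obtain K where K: "K \<subseteq> {k \<in> I. real (a k) \<le> x}" "finite K" "card K = N"
    using infinite_arbitrarily_large[OF inf] by blast
  have "real N * (1 / y ^ D) = (\<Sum>k\<in>K. 1 / y ^ D)" using K by simp
  also have "\<dots> \<le> (\<Sum>k\<in>K. 1 / real (a k) ^ D)"
  proof (intro sum_mono divide_left_mono power_mono)
    fix k assume "k \<in> K"
    hence k: "k \<in> I" "real (a k) \<le> x" using K by auto
    show "real (a k) \<le> y" using k by (simp add: y_def)
    show "0 < y ^ D * real (a k) ^ D" using a_pos[OF k(1)] by (simp add: y_def)
  qed auto
  also have "\<dots> \<le> weight_sum" using K by (intro sum_inverse_le) auto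
  finally have "real N \<le> weight_sum * y ^ D" by (simp add: y_def field_simps)
  thus False using N by simp
qed

lemma sum_mom_ge:
  assumes "B \<ge> 1" "finite K" "K \<subseteq> I" "{k \<in> I. real (a k) \<le> B} \<subseteq> K"
  shows "(\<Sum>k\<in>K. mom j B k) \<ge> c0 / 3 * (B ^ j * B powr g)"
proof -
  let ?L = "{k \<in> I. real (a k) \<le> B}"
  have "c0 / 3 * (B ^ j * B powr g) = c0 * B powr g * (B ^ j / 3)" by simp
  also have "\<dots> \<le> real (card ?L) * (B ^ j / 3)" using assms count_ge by (intro mult_right_mono) auto
  also have "\<dots> = (\<Sum>k\<in>?L. B ^ j / 3)" by simp
  also have "\<dots> \<le> (\<Sum>k\<in>?L. mom j B k)" using assms by (intro sum_mono mom_ge) auto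
  also have "\<dots> \<le> (\<Sum>k\<in>K. mom j B k)"
    using assms mom_pos[of _ B j] by (intro sum_mono2) (auto intro!: less_imp_le)
  finally show ?thesis .
qed

lemma summable_mean:
  assumes "B > 0"
  shows "mom 1 B summable_on I"
proof (rule summable_on_comparison_test)
  show "(\<lambda>k. 216 * B * ((4 * real D) ^ D * (2 * B) ^ D) * (1 / real (a k) ^ D)) summable_on I"
    by (intro summable_on_cmult_right summable_weights)
  fix k assume k: "k \<in> I"
  show "0 \<le> mom 1 B k" using mom_pos[OF k assms] by (rule less_imp_le)
  have "exp (- (real (a k) / (2 * B))) \<le> exp (- (real (a k) / (4 * B)))"
    using assms by (simp add: field_simps)
  also have "\<dots> \<le> (4 * real D) ^ D * B ^ D * (1 / real (a k) ^ D)" by (rule exp_le_weight[OF k assms])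
  also have "\<dots> \<le> (4 * real D) ^ D * (2 * B) ^ D * (1 / real (a k) ^ D)"
    using assms by (intro mult_right_mono mult_left_mono power_mono) auto
  finally have "216 * B * exp (- (real (a k) / (2 * B))) \<le> 216 * B * ((4 * real D) ^ D * (2 * B) ^ D * (1 / real (a k) ^ D))"
    using assms by (intro mult_left_mono) auto
  thus "mom 1 B k \<le> 216 * B * ((4 * real D) ^ D * (2 * B) ^ D) * (1 / real (a k) ^ D)"
    using mom_le[OF k assms, of 1] by (simp add: mult.assoc)
qed

text \<open>Expected weight under the tilted law with ratio \<open>exp (- 1 / B)\<close>. It increases strictly and
  continuously from 0 to infinity in \<open>B\<close>, so the saddle point equation has exactly one solution.\<close>

definition mean :: "real \<Rightarrow> real" where "mean B = (\<Sum>\<^sub>\<infinity>k\<in>I. mom 1 B k)"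

lemma has_sum_mean: "B > 0 \<Longrightarrow> (mom 1 B has_sum mean B) I"
  unfolding mean_def using summable_mean by (simp add: has_sum_infsum)

lemma mom1_strict_mono:
  assumes "k \<in> I" "0 < B" "B < B'"
  shows "mom 1 B k < mom 1 B' k"
proof -
  have a: "real (a k) > 0" using a_pos[OF assms(1)] by simp
  have *: "mom 1 b k = real (a k) / (exp (real (a k) / b) - 1)" if "b > 0" for b
    using that a one_minus_exp_pos[OF assms(1) that] by (simp add: mom_def exp_minus field_simps)
  have "real (a k) / B' < real (a k) / B" using assms a by (intro divide_strict_left_mono) auto
  hence "exp (real (a k) / B') < exp (real (a k) / B)" by simp
  moreover have "exp (real (a k) / B') > 1" using a assms by simp
  ultimately show ?thesis unfolding *[OF assms(2)] *[OF less_trans[OF assms(2,3)]]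
    using a by (intro divide_strict_left_mono mult_pos_pos) auto
qed

lemma I_nonempty: "I \<noteq> {}"
  using count_ge[of 1] c0_pos by auto

lemma mean_strict_mono:
  assumes "0 < B" "B < B'"
  shows "mean B < mean B'"
proof -
  obtain k where k: "k \<in> I" using I_nonempty by blast
  show ?thesis
    by (rule has_sum_strict_mono[OF has_sum_mean has_sum_mean])
       (use assms k mom1_strict_mono in \<open>auto intro: less_imp_le\<close>)
qed

lemma mean_ge:
  assumes "B \<ge> 1"
  shows "mean B \<ge> c0 / 3 * (B * B powr g)"
proof -
  let ?K = "{k \<in> I. real (a k) \<le> B}"
  have "c0 / 3 * (B ^ 1 * B powr g) \<le> (\<Sum>k\<in>?K. mom 1 B k)"
    using assms finite_weights_le by (intro sum_mom_ge) auto
  also have "\<dots> \<le> mean B"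
    using assms mom_pos[of _ B 1] finite_weights_le
    by (intro finite_sum_le_has_sum[OF has_sum_mean]) (auto intro!: less_imp_le)
  finally show ?thesis by simp
qed

lemma mean_le:
  assumes "B > 0"
  shows "mean B \<le> 216 * B * (tail_const * B ^ D)"
  unfolding mean_def
  by (rule infsum_le_finite_sums[OF summable_mean[OF assms]])
     (use sum_mom_le[OF _ _ assms, of _ 1] in auto)

lemma continuous_on_mean:
  assumes b: "b > 0" and c: "b \<le> c"
  shows "continuous_on {b..c} mean"
proof (rule uniform_limit_theorem)
  show "uniform_limit {b..c} (\<lambda>X y. \<Sum>k\<in>X. mom 1 y k) mean (finite_subsets_at_top I)"
  proof (rule Weierstrass_m_test_general')
    show "norm (mom 1 y k) \<le> mom 1 c k" if "k \<in> I" "y \<in> {b..c}" for k y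
      using that b mom1_strict_mono[of k y c] mom_pos[of k y 1] by (cases "y = c") auto
    show "(mom 1 y has_sum mean y) I" if "y \<in> {b..c}" for y
      using that b by (intro has_sum_mean) auto
    show "mom 1 c summable_on I"
      using c b by (intro summable_mean) auto
  qed
  show "\<forall>\<^sub>F X in finite_subsets_at_top I. continuous_on {b..c} (\<lambda>y. \<Sum>k\<in>X. mom 1 y k)"
  proof (rule eventually_finite_subsets_at_top_weakI)
    fix X assume X: "finite X" "X \<subseteq> I"
    show "continuous_on {b..c} (\<lambda>y. \<Sum>k\<in>X. mom 1 y k)"
      unfolding mom_def
    proof (intro continuous_intros ballI)
      fix k y assume "k \<in> X" "y \<in> {b..c}"
      hence "k \<in> I" "y > 0" using b X by auto
      thus "1 - exp (- (real (a k) / y)) \<noteq> 0" using one_minus_exp_pos[of k y] by linarith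
    qed (use b in auto)
  qed
qed simp

lemma ex1_mean_eq:
  assumes "n \<ge> (1::nat)"
  shows "\<exists>!B. B > 0 \<and> mean B = real n"
proof -
  have "((\<lambda>B. 216 * B * (tail_const * B ^ D)) \<longlongrightarrow> 216 * 0 * (tail_const * 0 ^ D)) (at_right 0)"
    by (intro tendsto_intros)
  hence "eventually (\<lambda>B. 216 * B * (tail_const * B ^ D) < real n) (at_right 0)"
    by (rule order_tendstoD) (use assms in auto)
  moreover have "eventually (\<lambda>B::real. B > 0 \<and> B < 1) (at_right 0)" 
    by (auto simp: eventually_at intro!: exI[of _ 1])
  ultimately have "eventually (\<lambda>B. 216 * B * (tail_const * B ^ D) < real n \<and> B > 0 \<and> B < 1) (at_right 0)"
    by eventually_elim auto
  hence "\<exists>b. 216 * b * (tail_const * b ^ D) < real n \<and> b > 0 \<and> b < 1"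
    using eventually_happens trivial_limit_at_right_real by blast
  then obtain b where b: "b > 0" "b < 1" "216 * b * (tail_const * b ^ D) < real n" by blast
  have "eventually (\<lambda>B. c0 / 3 * (B * B powr g) \<ge> real n) at_top"
    using c0_pos g_pos by real_asymp
  then obtain N where N: "\<And>B. B \<ge> N \<Longrightarrow> c0 / 3 * (B * B powr g) \<ge> real n"
    unfolding eventually_at_top_linorder by blast
  define c where "c = max 1 N"
  have "mean b \<le> real n" using mean_le[OF b(1)] b(3) by simp
  moreover have "mean c \<ge> real n" using mean_ge[of c] N[of c] by (simp add: c_def)
  ultimately obtain B where B: "b \<le> B" "B \<le> c" "mean B = real n"
    using IVT'[of mean b "real n" c] continuous_on_mean[OF b(1), of c] b(2) unfolding c_def by fastforce
  show ?thesis
  proof (rule ex1I[of _ B])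
    show "B > 0 \<and> mean B = real n" using B b by simp
    fix B' assume B': "B' > 0 \<and> mean B' = real n"
    show "B' = B"
      using mean_strict_mono[of B B'] mean_strict_mono[of B' B] B B' b by (cases B B' rule: linorder_cases) simp_all
  qed
qed

definition saddle :: "nat \<Rightarrow> real" where
  "saddle n = (THE B. B > 0 \<and> mean B = real n)"

lemma saddle:
  assumes "n \<ge> 1"
  shows "saddle n > 0" "mean (saddle n) = real n"
  using theI'[OF ex1_mean_eq[OF assms]] unfolding saddle_def by auto

lemma filterlim_saddle: "filterlim saddle at_top sequentially"
  unfolding filterlim_at_top
proof
  fix Z :: real
  define Y where "Y = max 1 Z"
  obtain N :: nat where N: "real N > mean Y" using reals_Archimedean2 by blast
  have "saddle n \<ge> Z" if n: "n \<ge> max 1 N" for n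
  proof (rule ccontr)
    assume "\<not> saddle n \<ge> Z"
    hence "saddle n < Y" by (simp add: Y_def)
    hence "real n < mean Y" using mean_strict_mono[of "saddle n" Y] saddle[of n] n by simp
    thus False using N n by simp
  qed
  thus "eventually (\<lambda>n. Z \<le> saddle n) sequentially"
    unfolding eventually_sequentially by blast
qed

end

lemma exp_cut_negligible:
  assumes "c > 0" "g > 0"
  shows "\<forall>\<^sub>F B::real in at_top. 216 * B\<^sup>2 * exp (- (B powr (g / 8) / 4)) * (C * B ^ D) \<le> c * (B\<^sup>2 * B powr g)"
  using assms by real_asymp

lemma ln_le_power_div_cut:
  assumes "c > 0" "g > 0"
  shows "\<forall>\<^sub>F B::real in at_top. C * ln B \<le> c * sqrt B powr g * (1 / (3 * (B powr (g / 8))\<^sup>2))"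
  using assms by real_asymp

context partition_weights
begin

section \<open>Bounds on the characteristic function\<close>

text \<open>\<open>phi\<close> is the characteristic function of a single weighted geometric variable, \<open>psi\<close> that of
  their sum over \<open>K\<close>.\<close>

definition phi :: "real \<Rightarrow> 'a \<Rightarrow> real \<Rightarrow> complex" where
  "phi B k \<theta> = of_real (1 - exp (- (real (a k) / B))) / (1 - of_real (exp (- (real (a k) / B))) * cis (real (a k) * \<theta>))"

definition psi :: "real \<Rightarrow> 'a set \<Rightarrow> real \<Rightarrow> complex" where
  "psi B K \<theta> = (\<Prod>k\<in>K. phi B k \<theta>)"

text \<open>The amount by which the factor of the part \<open>k\<close> damps \<open>psi\<close> at the frequency \<open>\<theta>\<close>:
  \<open>norm (phi B k \<theta>)\<close> is \<open>1 / sqrt (1 + osc B k \<theta>)\<close>.\<close>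

definition osc :: "real \<Rightarrow> 'a \<Rightarrow> real \<Rightarrow> real" where
  "osc B k \<theta> = 4 * exp (- (real (a k) / B)) / (1 - exp (- (real (a k) / B)))\<^sup>2 * (sin (real (a k) * \<theta> / 2))\<^sup>2"

lemma osc_nonneg: "osc B k \<theta> \<ge> 0"
  by (simp add: osc_def)

lemma norm_one_minus_cis:
  "(norm (1 - complex_of_real q * cis t))\<^sup>2 = (1 - q)\<^sup>2 + 4 * q * (sin (t / 2))\<^sup>2"
proof -
  have c: "cos t = 1 - 2 * (sin (t / 2))\<^sup>2"
    using cos_double_sin[of "t / 2"] by simp
  have "(norm (1 - complex_of_real q * cis t))\<^sup>2 = (1 - q * cos t)\<^sup>2 + (q * sin t)\<^sup>2"
    by (simp add: cmod_power2)
  also have "\<dots> = 1 - 2 * q * cos t + q\<^sup>2 * ((sin t)\<^sup>2 + (cos t)\<^sup>2)"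
    by algebra
  also have "\<dots> = 1 - 2 * q * cos t + q\<^sup>2" by simp
  also have "\<dots> = (1 - q)\<^sup>2 + 4 * q * (sin (t / 2))\<^sup>2"
    unfolding c by (simp add: power2_eq_square algebra_simps)
  finally show ?thesis .
qed

lemma norm_phi:
  assumes "k \<in> I" "B > 0"
  shows "(norm (phi B k \<theta>))\<^sup>2 = 1 / (1 + osc B k \<theta>)"
proof -
  define q where "q = exp (- (real (a k) / B))"
  have q: "1 - q > 0" using one_minus_exp_pos[OF assms] by (simp add: q_def)
  have "(norm (phi B k \<theta>))\<^sup>2 = (1 - q)\<^sup>2 / ((1 - q)\<^sup>2 + 4 * q * (sin (real (a k) * \<theta> / 2))\<^sup>2)"
    unfolding phi_def q_def[symmetric] norm_divide power_divide norm_one_minus_cis norm_of_real by simp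
  also have "\<dots> = 1 / (((1 - q)\<^sup>2 + 4 * q * (sin (real (a k) * \<theta> / 2))\<^sup>2) / (1 - q)\<^sup>2)" by simp
  also have "((1 - q)\<^sup>2 + 4 * q * (sin (real (a k) * \<theta> / 2))\<^sup>2) / (1 - q)\<^sup>2 = 1 + osc B k \<theta>"
    using q unfolding osc_def q_def[symmetric] by (simp add: add_divide_distrib)
  finally show ?thesis .
qed

text \<open>No factor exceeds 1, so any subset of the parts may be used to bound \<open>psi\<close>. The different
  ranges of \<open>\<theta>\<close> call for different subsets.\<close>

lemma norm_psi_le:
  assumes "B > 0" "finite K" "K \<subseteq> I" "T \<subseteq> K" "\<And>k. k \<in> T \<Longrightarrow> 0 \<le> y k \<and> y k \<le> osc B k \<theta>"
  shows "(norm (psi B K \<theta>))\<^sup>2 \<le> (\<Prod>k\<in>T. 1 / (1 + y k))"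
proof -
  have o: "0 \<le> 1 / (1 + osc B k \<theta>)" "1 / (1 + osc B k \<theta>) \<le> 1" for k
    using osc_nonneg[of B k \<theta>] by auto
  have "(norm (psi B K \<theta>))\<^sup>2 = (\<Prod>k\<in>K. (norm (phi B k \<theta>))\<^sup>2)"
    unfolding psi_def by (simp add: prod_norm flip: prod_power_distrib)
  also have "\<dots> = (\<Prod>k\<in>K. 1 / (1 + osc B k \<theta>))"
    using assms by (intro prod.cong refl norm_phi) auto
  also have "\<dots> = (\<Prod>k\<in>T. 1 / (1 + osc B k \<theta>)) * (\<Prod>k\<in>K-T. 1 / (1 + osc B k \<theta>))"
    using assms by (subst prod.subset_diff[of T K]) (auto simp: mult.commute)
  also have "\<dots> \<le> (\<Prod>k\<in>T. 1 / (1 + y k)) * 1"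
  proof (intro mult_mono prod_mono prod_le_1)
    fix k assume "k \<in> T"
    thus "0 \<le> 1 / (1 + osc B k \<theta>) \<and> 1 / (1 + osc B k \<theta>) \<le> 1 / (1 + y k)"
      using assms(5)[of k] osc_nonneg[of B k \<theta>] by (auto intro!: divide_left_mono mult_pos_pos)
  qed (use o assms(5) in \<open>auto intro!: prod_nonneg simp: add_nonneg_nonneg\<close>)
  finally show ?thesis by simp
qed

lemma osc_ge_mom:
  assumes "k \<in> I" "B > 0" "real (a k) * \<bar>\<theta>\<bar> \<le> pi"
  shows "4 / pi\<^sup>2 * \<theta>\<^sup>2 * mom 2 B k \<le> osc B k \<theta>"
proof -
  have "real (a k) * \<bar>\<theta>\<bar> / pi \<le> \<bar>sin (real (a k) * \<theta> / 2)\<bar>"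
    using abs_sin_ge[of "real (a k) * \<theta>"] assms by (simp add: abs_mult)
  hence "(real (a k) * \<bar>\<theta>\<bar> / pi)\<^sup>2 \<le> (sin (real (a k) * \<theta> / 2))\<^sup>2"
    by (metis abs_ge_zero abs_le_square_iff abs_of_nonneg divide_nonneg_pos mult_nonneg_nonneg of_nat_0_le_iff pi_gt_zero)
  hence "4 * exp (- (real (a k) / B)) / (1 - exp (- (real (a k) / B)))\<^sup>2 * (real (a k) * \<bar>\<theta>\<bar> / pi)\<^sup>2 \<le> osc B k \<theta>"
    unfolding osc_def by (intro mult_left_mono) auto
  thus ?thesis by (simp add: mom_def power_divide power_mult_distrib mult_ac)
qed

lemma osc_ge_sin:
  assumes "k \<in> I" "B > 0" "real (a k) \<le> B" "real (a k) \<le> R" "s \<ge> 0" "s \<le> \<bar>sin (real (a k) * \<theta> / 2)\<bar>"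
  shows "4 / 3 * (B * s / R)\<^sup>2 \<le> osc B k \<theta>"
proof -
  have a: "real (a k) > 0" using a_pos[OF assms(1)] by simp
  have "B\<^sup>2 / 3 \<le> mom 2 B k" by (rule mom_ge[OF assms(1-3)])
  moreover have "osc B k \<theta> = 4 * mom 2 B k / (real (a k))\<^sup>2 * (sin (real (a k) * \<theta> / 2))\<^sup>2"
    using a by (simp add: osc_def mom_def power_divide)
  moreover have "s\<^sup>2 \<le> (sin (real (a k) * \<theta> / 2))\<^sup>2"
    using assms by (metis abs_le_square_iff abs_of_nonneg)
  moreover have "(real (a k))\<^sup>2 \<le> R\<^sup>2" using assms by (intro power_mono) auto
  moreover have "4 * (B\<^sup>2 / 3) / R\<^sup>2 \<le> 4 * mom 2 B k / (real (a k))\<^sup>2"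
    using a mom_pos[OF assms(1,2), of 2] calculation(1,4) by (intro frac_le) auto
  ultimately have "4 * (B\<^sup>2 / 3) / R\<^sup>2 * s\<^sup>2 \<le> osc B k \<theta>"
    using a mom_pos[OF assms(1,2), of 2] by (simp only:) (intro mult_mono, auto)
  thus ?thesis by (simp add: power_mult_distrib power_divide)
qed

text \<open>This is \<open>sinh t \<ge> t\<close> at \<open>t = a k / (2 * B)\<close>. It keeps \<open>\<theta>\<^sup>2 * mom 2 B k\<close>
  bounded for \<open>\<bar>\<theta>\<bar> \<le> pi / B\<close>, so that \<open>ln (1 + y) \<ge> y / (1 + y)\<close> loses only a constant factor.\<close>

lemma mom2_le: assumes "k \<in> I" "B > 0" shows "mom 2 B k \<le> B\<^sup>2"
proof -
  define t where "t = real (a k) / (2 * B)"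
  have t: "t > 0" using assms a_pos[of k] by (simp add: t_def)
  have a: "real (a k) = 2 * t * B" using assms by (simp add: t_def)
  have at: "real (a k) / B = 2 * t" using assms by (simp add: t_def)
  have "1 - exp (- (2 * t)) = 2 * sinh t * exp (- t)"
    by (simp add: sinh_def algebra_simps flip: exp_add)
  moreover have "2 * t * exp (- t) \<le> 2 * sinh t * exp (- t)"
    using t real_le_x_sinh[of t] by (intro mult_right_mono) (auto simp: sinh_def exp_minus)
  ultimately have 1: "2 * t * exp (- t) \<le> 1 - exp (- (2 * t))" by simp
  have "0 < 2 * t * exp (- t)" using t by simp
  hence "real (a k) / (1 - exp (- (2 * t))) \<le> real (a k) / (2 * t * exp (- t))"
    using 1 by (intro frac_le) auto
  also have "\<dots> = B * exp t" using t by (simp add: a exp_minus field_simps)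
  finally have "(real (a k) / (1 - exp (- (2 * t)))) ^ 2 \<le> (B * exp t) ^ 2"
    using t by (intro power_mono) auto
  hence "mom 2 B k \<le> (B * exp t)\<^sup>2 * exp (- (2 * t))"
    unfolding mom_def at by (intro mult_right_mono) auto
  also have "\<dots> = B\<^sup>2 * exp (t + t + - (2 * t))"
    unfolding exp_add by (simp add: power2_eq_square)
  also have "\<dots> = B\<^sup>2" by simp
  finally show ?thesis .
qed

text \<open>Parts larger than \<open>B * cut B\<close> are negligible. A power of \<open>B\<close> rather than a constant is taken
  here: then crude polynomial bounds suffice for the large parts, and no sharp asymptotics of
  their number are needed. The exponent is small enough for \<open>B * cut B\<close> to be of smaller order than
  the standard deviation.\<close>

definition cut :: "real \<Rightarrow> real" where "cut B = B powr (g / 8)"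

definition good :: "real \<Rightarrow> 'a set \<Rightarrow> bool" where
  "good B K \<longleftrightarrow> finite K \<and> K \<subseteq> I \<and> {k \<in> I. real (a k) \<le> B * cut B} \<subseteq> K"

definition var :: "real \<Rightarrow> 'a set \<Rightarrow> real" where "var B K = (\<Sum>k\<in>K. mom 2 B k)"

lemma goodD: "good B K \<Longrightarrow> finite K" "good B K \<Longrightarrow> K \<subseteq> I"
  by (auto simp: good_def)

lemma cut_ge_1: "B \<ge> 1 \<Longrightarrow> cut B \<ge> 1"
  unfolding cut_def using g_pos by (intro ge_one_powr_ge_zero) auto

lemma good_mem: "good B K \<Longrightarrow> k \<in> I \<Longrightarrow> real (a k) \<le> B * cut B \<Longrightarrow> k \<in> K"
  by (auto simp: good_def)

lemma good_mem_le:
  assumes "good B K" "B \<ge> 1" "k \<in> I" "real (a k) \<le> B"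
  shows "k \<in> K"
proof (rule good_mem[OF assms(1,3)])
  have "B * 1 \<le> B * cut B" using assms(2) cut_ge_1[OF assms(2)] by (intro mult_left_mono) auto
  thus "real (a k) \<le> B * cut B" using assms(4) by simp
qed

lemma var_ge: "good B K \<Longrightarrow> B \<ge> 1 \<Longrightarrow> var B K \<ge> c0 / 3 * (B\<^sup>2 * B powr g)"
  unfolding var_def using good_mem_le by (intro sum_mom_ge) (auto simp: good_def)

lemma var_pos: "good B K \<Longrightarrow> B \<ge> 1 \<Longrightarrow> var B K > 0"
  by (rule less_le_trans[OF _ var_ge]) (use c0_pos in auto)

lemma var_le: "good B K \<Longrightarrow> B \<ge> 1 \<Longrightarrow> var B K \<le> 216 * B\<^sup>2 * (tail_const * B ^ D)"
  unfolding var_def by (intro sum_mom_le) (auto simp: good_def)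

text \<open>The parts beyond \<open>B * cut B\<close> have total variance at most \<open>exp (- cut B / 4)\<close> times a power of \<open>B\<close>.\<close>

lemma var_central:
  "\<forall>\<^sub>F B in at_top. \<forall>K. good B K \<longrightarrow> var B K / 2 \<le> (\<Sum>k | k \<in> K \<and> real (a k) \<le> B * cut B. mom 2 B k)"
proof -
  have "\<forall>\<^sub>F B::real in at_top. 216 * B\<^sup>2 * exp (- (B powr (g/8) / 4)) * (tail_const * B ^ D) \<le> c0 / 6 * (B\<^sup>2 * B powr g)"
    using exp_cut_negligible[of "c0 / 6"] g_pos c0_pos by simp
  with eventually_ge_at_top[of 1] show ?thesis
  proof eventually_elim
    case (elim B)
    show ?case
    proof (intro allI impI)
      fix K assume K: "good B K"
      let ?L = "{k \<in> K. real (a k) \<le> B * cut B}" and ?H = "{k \<in> K. \<not> real (a k) \<le> B * cut B}"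
      have "(\<Sum>k\<in>?H. mom 2 B k) \<le> 216 * B\<^sup>2 * exp (- (cut B / 4)) * (tail_const * B ^ D)"
        using goodD[OF K] elim by (intro sum_mom_tail_le) auto
      also have "\<dots> \<le> c0 / 6 * (B\<^sup>2 * B powr g)" using elim by (simp add: cut_def)
      also have "\<dots> \<le> var B K / 2" using var_ge[OF K elim(1)] by (simp add: mult_ac)
      finally have "(\<Sum>k\<in>?H. mom 2 B k) \<le> var B K / 2" .
      moreover have "var B K = (\<Sum>k\<in>?L. mom 2 B k) + (\<Sum>k\<in>?H. mom 2 B k)"
      proof -
        have "var B K = (\<Sum>k\<in>?L \<union> ?H. mom 2 B k)" unfolding var_def by (rule sum.cong) auto
        thus ?thesis using goodD(1)[OF K] by (simp add: sum.union_disjoint disjoint_iff)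
      qed
      ultimately show "var B K / 2 \<le> (\<Sum>k\<in>?L. mom 2 B k)" by linarith
    qed
  qed
qed

text \<open>For \<open>\<bar>\<theta>\<bar> \<le> pi / (B * cut B)\<close> the phases \<open>a k * \<theta> / 2\<close> of all parts up to the cut lie
  in \<open>[- pi / 2, pi / 2]\<close>, where the sine is bounded below linearly, so each of them contributes at least
  a multiple of its variance times \<open>\<theta>\<^sup>2\<close> to the decay.\<close>

lemma psi_near:
  "\<forall>\<^sub>F B in at_top. \<forall>K \<theta>. good B K \<longrightarrow> \<bar>\<theta>\<bar> \<le> pi / (B * cut B) \<longrightarrow>
     norm (psi B K \<theta>) \<le> exp (- (var B K * \<theta>\<^sup>2 / 52))"
  using var_central eventually_ge_at_top[of 1]
proof eventually_elim
  case (elim B)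
  show ?case
  proof (intro allI impI)
    fix K \<theta> assume K: "good B K" and \<theta>: "\<bar>\<theta>\<bar> \<le> pi / (B * cut B)"
    let ?L = "{k \<in> K. real (a k) \<le> B * cut B}"
    let ?y = "\<lambda>k. 4 / pi\<^sup>2 * \<theta>\<^sup>2 * mom 2 B k"
    have B: "B > 0" "cut B \<ge> 1" using elim cut_ge_1 by auto
    have \<theta>': "B * \<bar>\<theta>\<bar> \<le> pi"
    proof -
      have "B * \<bar>\<theta>\<bar> \<le> B * cut B * \<bar>\<theta>\<bar>" using B by (intro mult_right_mono) auto
      also have "\<dots> \<le> pi" using \<theta> B by (simp add: field_simps)
      finally show ?thesis .
    qed
    have y: "0 \<le> ?y k \<and> ?y k \<le> osc B k \<theta>" if "k \<in> ?L" for k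
    proof
      have kI: "k \<in> I" using that goodD[OF K] by auto
      show "0 \<le> ?y k" using mom_pos[OF kI B(1), of 2] by simp
      have "real (a k) * \<bar>\<theta>\<bar> \<le> B * cut B * \<bar>\<theta>\<bar>" using that by (intro mult_right_mono) auto
      also have "\<dots> \<le> pi" using \<theta> B by (simp add: field_simps)
      finally show "?y k \<le> osc B k \<theta>" using kI B by (intro osc_ge_mom) auto
    qed
    have y4: "?y k \<le> 4" if "k \<in> ?L" for k
    proof -
      have kI: "k \<in> I" using that goodD[OF K] by auto
      have "\<theta>\<^sup>2 * mom 2 B k \<le> \<theta>\<^sup>2 * B\<^sup>2" using mom2_le[OF kI B(1)] by (intro mult_left_mono) auto
      also have "\<dots> = (B * \<bar>\<theta>\<bar>)\<^sup>2" by (simp add: power_mult_distrib)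
      also have "\<dots> \<le> pi\<^sup>2" using \<theta>' B by (intro power_mono) auto
      finally show ?thesis by (simp add: field_simps)
    qed
    have pi2: "pi\<^sup>2 \<le> 10.4"
    proof -
      have "pi \<le> 3.2" using pi_approx by simp
      hence "pi\<^sup>2 \<le> 3.2\<^sup>2" by (intro power_mono) auto
      thus ?thesis by (simp add: power2_eq_square)
    qed
    have "(norm (psi B K \<theta>))\<^sup>2 \<le> (\<Prod>k\<in>?L. 1 / (1 + ?y k))"
      using goodD[OF K] y B by (intro norm_psi_le) auto
    also have "\<dots> \<le> (\<Prod>k\<in>?L. exp (- (?y k / 5)))"
    proof (intro prod_mono conjI)
      fix k assume k: "k \<in> ?L"
      show "0 \<le> 1 / (1 + ?y k)" using y[OF k] by simp
      have "?y k / 5 \<le> ?y k / (1 + ?y k)" using y[OF k] y4[OF k] by (intro divide_left_mono) auto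
      also have "\<dots> \<le> ln (1 + ?y k)" using y[OF k] by (intro ln_add_one_ge) auto
      finally have "exp (?y k / 5) \<le> 1 + ?y k" using y[OF k] by (simp add: ln_ge_iff)
      thus "1 / (1 + ?y k) \<le> exp (- (?y k / 5))" using y[OF k]
        by (simp add: exp_minus inverse_eq_divide frac_le)
    qed
    also have "\<dots> = exp (\<Sum>k\<in>?L. - (?y k / 5))" using goodD[OF K] by (simp add: exp_sum)
    also have "(\<Sum>k\<in>?L. - (?y k / 5)) = - (4 / (5 * pi\<^sup>2) * \<theta>\<^sup>2 * (\<Sum>k\<in>?L. mom 2 B k))"
      by (simp add: sum_negf sum_distrib_left field_simps)
    also have "exp \<dots> \<le> exp (- (1 / 13 * \<theta>\<^sup>2 * (var B K / 2)))"
      unfolding exp_le_cancel_iff neg_le_iff_le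
      using elim(1) K var_pos[OF K elim(2)] pi2 by (intro mult_mono) (auto simp: field_simps)
    also have "\<dots> = (exp (- (var B K * \<theta>\<^sup>2 / 52)))\<^sup>2"
      by (simp add: power2_eq_square flip: exp_add)
    finally show "norm (psi B K \<theta>) \<le> exp (- (var B K * \<theta>\<^sup>2 / 52))"
      by (rule power2_le_imp_le) simp
  qed
qed

text \<open>Parts up to \<open>sqrt B\<close> still have small phases here. Each reduces \<open>psi\<close> by a factor that
  differs from 1 by order \<open>1 / cut B ^ 2\<close>, and their number, at least \<open>c0 * sqrt B powr g\<close>, exceeds \<open>cut B ^ 2\<close>
  by a power of \<open>B\<close>. The exponent \<open>D / 2 + 2\<close> is chosen to beat the standard deviation, which
  is at most of order \<open>B powr (D / 2 + 1)\<close>.\<close>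

lemma psi_middle:
  "\<forall>\<^sub>F B in at_top. \<forall>K \<theta>. good B K \<longrightarrow> pi / (B * cut B) \<le> \<bar>\<theta>\<bar> \<longrightarrow> \<bar>\<theta>\<bar> \<le> 1 / sqrt B \<longrightarrow>
     norm (psi B K \<theta>) \<le> B powr (- (real D / 2 + 2))"
proof -
  have "\<forall>\<^sub>F B::real in at_top. (real D + 4) * ln B \<le> (c0 * sqrt B powr g) * (1 / (3 * (B powr (g/8))\<^sup>2))"
    using ln_le_power_div_cut[of c0 g] g_pos c0_pos by simp
  with eventually_ge_at_top[of 1] show ?thesis
  proof eventually_elim
    case (elim B)
    show ?case
    proof (intro allI impI)
      fix K \<theta> assume K: "good B K" and \<theta>: "pi / (B * cut B) \<le> \<bar>\<theta>\<bar>" "\<bar>\<theta>\<bar> \<le> 1 / sqrt B"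
      let ?L = "{k \<in> I. real (a k) \<le> sqrt B}"
      have B: "B \<ge> 1" "cut B \<ge> 1" "sqrt B \<ge> 1" using elim cut_ge_1 by auto
      moreover have "sqrt B * 1 \<le> sqrt B * sqrt B" using B(1) by (intro mult_left_mono) auto
      ultimately have B: "B \<ge> 1" "cut B \<ge> 1" "sqrt B \<ge> 1" "sqrt B \<le> B" by auto
      define y where "y = 1 / (cut B)\<^sup>2"
      have y: "0 \<le> y" "y \<le> 1" using B by (auto simp: y_def)
      have yo: "0 \<le> y \<and> y \<le> osc B k \<theta>" if k: "k \<in> ?L" for k
      proof
        have "real (a k) * \<bar>\<theta>\<bar> \<le> sqrt B * (1 / sqrt B)" using k \<theta> B by (intro mult_mono) auto
        also have "\<dots> \<le> pi" using B pi_gt3 by simp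
        finally have "4 / pi\<^sup>2 * \<theta>\<^sup>2 * mom 2 B k \<le> osc B k \<theta>" using k B by (intro osc_ge_mom) auto
        moreover have "4 / pi\<^sup>2 * (pi / (B * cut B))\<^sup>2 * (B\<^sup>2 / 3) \<le> 4 / pi\<^sup>2 * \<theta>\<^sup>2 * mom 2 B k"
        proof (intro mult_mono mult_left_mono)
          show "(pi / (B * cut B))\<^sup>2 \<le> \<theta>\<^sup>2" using \<theta> B by (subst power2_abs[of \<theta>, symmetric], intro power_mono) auto
          show "B\<^sup>2 / 3 \<le> mom 2 B k" using k B by (intro mom_ge) auto
        qed auto
        moreover have "4 / pi\<^sup>2 * (pi / (B * cut B))\<^sup>2 * (B\<^sup>2 / 3) = 4 / 3 * y"
          using B by (simp add: y_def power_mult_distrib power_divide)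
        ultimately have "4 / 3 * y \<le> osc B k \<theta>" by linarith
        thus "y \<le> osc B k \<theta>" using y by simp
      qed (use y in auto)
      have sub: "?L \<subseteq> K" using good_mem_le[OF K B(1)] B by auto
      have "exp (y / 2) \<le> 1 + y"
      proof -
        have "y / 2 \<le> y / (1 + y)" using y by (intro divide_left_mono) auto
        also have "\<dots> \<le> ln (1 + y)" using y by (intro ln_add_one_ge) auto
        finally have "exp (y / 2) \<le> exp (ln (1 + y))" by simp
        thus ?thesis using y by simp
      qed
      hence e: "1 / (1 + y) \<le> exp (- (y / 2))" using y by (simp add: exp_minus inverse_eq_divide frac_le)
      have "(norm (psi B K \<theta>))\<^sup>2 \<le> (\<Prod>k\<in>?L. 1 / (1 + y))"
        using goodD[OF K] yo B sub by (intro norm_psi_le) auto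
      also have "\<dots> = (1 / (1 + y)) ^ card ?L" by simp
      also have "\<dots> \<le> exp (- (y / 2)) ^ card ?L" using e y by (intro power_mono) auto
      also have "\<dots> = exp (- (real (card ?L) * (y / 2)))" by (simp flip: exp_of_nat_mult)
      also have "\<dots> \<le> exp (- ((c0 * sqrt B powr g) * (y / 3)))"
        unfolding exp_le_cancel_iff neg_le_iff_le using B y c0_pos by (intro mult_mono count_ge) auto
      also have "\<dots> \<le> exp (- ((real D + 4) * ln B))"
        using elim unfolding y_def cut_def by simp
      also have "\<dots> = B powr (- (real D + 4))" using B by (simp add: powr_def algebra_simps)
      also have "\<dots> = (B powr (- (real D / 2 + 2)))\<^sup>2"
        by (simp add: power2_eq_square flip: powr_add)
      finally show "norm (psi B K \<theta>) \<le> B powr (- (real D / 2 + 2))"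
        by (rule power2_le_imp_le) simp
    qed
  qed
qed

text \<open>For frequencies above \<open>1 / sqrt B\<close> a single part of bounded size already reduces \<open>psi\<close> by a
  factor of order \<open>1 / sqrt B\<close>. By aperiodicity there are \<open>D + 4\<close> such parts.\<close>

lemma psi_far:
  "\<exists>C. \<forall>\<^sub>F B in at_top. \<forall>K \<theta>. good B K \<longrightarrow> 1 / sqrt B \<le> \<bar>\<theta>\<bar> \<longrightarrow> \<bar>\<theta>\<bar> \<le> pi \<longrightarrow>
     norm (psi B K \<theta>) \<le> C * B powr (- (real D / 2 + 2))"
proof -
  obtain R c where c: "c > 0" and T: "\<And>\<theta>. \<bar>\<theta>\<bar> \<le> pi \<Longrightarrow>
     \<exists>T\<subseteq>I. finite T \<and> card T = D + 4 \<and> (\<forall>k\<in>T. real (a k) \<le> R \<and> c * \<bar>\<theta>\<bar> \<le> \<bar>sin (real (a k) * \<theta> / 2)\<bar>)"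
    using aperiodic[of "D + 4"] by blast
  \<comment> \<open>With this constant \<open>osc B k \<theta> \<ge> c' * B\<close> for each of the \<open>D + 4\<close> parts.\<close>
  define c' where "c' = (c / R)\<^sup>2"
  have R: "R > 0"
  proof -
    obtain T' where "T' \<subseteq> I" "finite T'" "card T' = D + 4" "\<forall>k\<in>T'. real (a k) \<le> R"
      using T[of 0] by auto
    then obtain k where "k \<in> I" "real (a k) \<le> R" by (metis card.empty add_is_0 ex_in_conv numeral_neq_zero zero_neq_numeral subsetD)
    thus ?thesis using a_pos[of k] by linarith
  qed
  have c': "c' > 0" using c R by (simp add: c'_def)
  define C where "C = c' powr (- (real D / 2 + 2))"
  have "\<forall>\<^sub>F B in at_top. \<forall>K \<theta>. good B K \<longrightarrow> 1 / sqrt B \<le> \<bar>\<theta>\<bar> \<longrightarrow> \<bar>\<theta>\<bar> \<le> pi \<longrightarrow>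
     norm (psi B K \<theta>) \<le> C * B powr (- (real D / 2 + 2))"
    using eventually_ge_at_top[of "max 1 R"]
  proof eventually_elim
    case (elim B)
    hence B: "B \<ge> 1" "R \<le> B" by auto
    show ?case
    proof (intro allI impI)
      fix K \<theta> assume K: "good B K" and \<theta>: "1 / sqrt B \<le> \<bar>\<theta>\<bar>" "\<bar>\<theta>\<bar> \<le> pi"
      obtain L where L: "L \<subseteq> I" "finite L" "card L = D + 4"
        "\<And>k. k \<in> L \<Longrightarrow> real (a k) \<le> R" "\<And>k. k \<in> L \<Longrightarrow> c * \<bar>\<theta>\<bar> \<le> \<bar>sin (real (a k) * \<theta> / 2)\<bar>"
        using T[OF \<theta>(2)] by metis
      have y: "0 \<le> c' * B \<and> c' * B \<le> osc B k \<theta>" if k: "k \<in> L" for k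
      proof
        have kR: "real (a k) \<le> R" "real (a k) \<le> B" using L(4)[OF k] B by auto
        have "c' * B \<le> 4 / 3 * (c' * B)" using c' B by simp
        also have "\<dots> = 4 / 3 * (B * (c * (1 / sqrt B)) / R)\<^sup>2"
          using B R by (simp add: c'_def power_mult_distrib power_divide) (simp add: power2_eq_square field_simps)
        also have "\<dots> \<le> 4 / 3 * (B * (c * \<bar>\<theta>\<bar>) / R)\<^sup>2"
          using B c R \<theta> by (intro mult_left_mono power_mono divide_right_mono) auto
        also have "\<dots> \<le> osc B k \<theta>"
          using L k kR B c by (intro osc_ge_sin) auto
        finally show "c' * B \<le> osc B k \<theta>" .
      qed (use c' B in auto)
      have sub: "L \<subseteq> K" using good_mem_le[OF K B(1)] B L by fastforce
      have "(norm (psi B K \<theta>))\<^sup>2 \<le> (\<Prod>k\<in>L. 1 / (1 + c' * B))"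
        using goodD[OF K] y B sub by (intro norm_psi_le) auto
      also have "\<dots> = (1 / (1 + c' * B)) ^ (D + 4)" using L by simp
      also have "\<dots> \<le> (1 / (c' * B)) ^ (D + 4)" using c' B by (intro power_mono frac_le) auto
      also have "\<dots> = (c' * B) powr (- real (D + 4))"
        using c' B by (simp add: powr_minus powr_realpow power_one_over inverse_eq_divide del: of_nat_add)
      also have "\<dots> = ((c' * B) powr (- (real D / 2 + 2)))\<^sup>2"
        using c' B by (simp add: power2_eq_square flip: powr_add)
      also have "(c' * B) powr (- (real D / 2 + 2)) = C * B powr (- (real D / 2 + 2))"
        using c' B by (simp add: C_def powr_mult)
      finally show "norm (psi B K \<theta>) \<le> C * B powr (- (real D / 2 + 2))"
        by (rule power2_le_imp_le) (simp add: C_def)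
    qed
  qed
  thus ?thesis by blast
qed

text \<open>Both outer ranges gain \<open>B powr (- (D / 2 + 2))\<close> against a standard deviation of order at most
  \<open>B powr (D / 2 + 1)\<close>, so the product tends to 0 uniformly in the set of parts.\<close>

lemma psi_rest:
  "\<exists>E. (E \<longlongrightarrow> 0) at_top \<and> (\<forall>\<^sub>F B in at_top. \<forall>K \<theta>. good B K \<longrightarrow> pi / (B * cut B) \<le> \<bar>\<theta>\<bar> \<longrightarrow> \<bar>\<theta>\<bar> \<le> pi \<longrightarrow>
     sqrt (var B K) * norm (psi B K \<theta>) \<le> E B)"
proof -
  obtain C where C: "\<forall>\<^sub>F B in at_top. \<forall>K \<theta>. good B K \<longrightarrow> 1 / sqrt B \<le> \<bar>\<theta>\<bar> \<longrightarrow> \<bar>\<theta>\<bar> \<le> pi \<longrightarrow>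
     norm (psi B K \<theta>) \<le> C * B powr (- (real D / 2 + 2))" using psi_far by blast
  define E where "E = (\<lambda>B::real. sqrt (216 * tail_const) * max 1 C * B powr (-1))"
  have "((\<lambda>B::real. B powr (-1)) \<longlongrightarrow> 0) at_top" by real_asymp
  hence "(E \<longlongrightarrow> sqrt (216 * tail_const) * max 1 C * 0) at_top"
    unfolding E_def by (intro tendsto_intros)
  moreover have "\<forall>\<^sub>F B in at_top. \<forall>K \<theta>. good B K \<longrightarrow> pi / (B * cut B) \<le> \<bar>\<theta>\<bar> \<longrightarrow> \<bar>\<theta>\<bar> \<le> pi \<longrightarrow>
     sqrt (var B K) * norm (psi B K \<theta>) \<le> E B"
    using psi_middle C eventually_ge_at_top[of 1]
  proof eventually_elim
    case (elim B)
    show ?case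
    proof (intro allI impI)
      fix K \<theta> assume K: "good B K" and \<theta>: "pi / (B * cut B) \<le> \<bar>\<theta>\<bar>" "\<bar>\<theta>\<bar> \<le> pi"
      let ?p = "B powr (- (real D / 2 + 2))"
      have "norm (psi B K \<theta>) \<le> max 1 C * ?p"
      proof (cases "\<bar>\<theta>\<bar> \<le> 1 / sqrt B")
        case True
        hence "norm (psi B K \<theta>) \<le> 1 * ?p" using elim(1) K \<theta> by simp
        also have "\<dots> \<le> max 1 C * ?p" by (intro mult_right_mono) auto
        finally show ?thesis .
      next
        case False
        hence "norm (psi B K \<theta>) \<le> C * ?p" using elim(2) K \<theta> by simp
        also have "\<dots> \<le> max 1 C * ?p" by (intro mult_right_mono) auto
        finally show ?thesis .
      qed
      moreover have "sqrt (var B K) \<le> sqrt (216 * B\<^sup>2 * (tail_const * B ^ D))" using var_le[OF K elim(3)] by simp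
      ultimately have "sqrt (var B K) * norm (psi B K \<theta>) \<le> sqrt (216 * B\<^sup>2 * (tail_const * B ^ D)) * (max 1 C * ?p)"
        using var_pos[OF K elim(3)] tail_const_nonneg elim by (intro mult_mono) auto
      also have "sqrt (216 * B\<^sup>2 * (tail_const * B ^ D)) = sqrt (216 * tail_const) * sqrt (B ^ (D + 2))"
        by (simp add: power_add mult_ac power2_eq_square flip: real_sqrt_mult)
      also have "sqrt (B ^ (D + 2)) = B powr (real D / 2 + 1)"
      proof -
        have "sqrt (B ^ (D + 2)) = (B powr real (D + 2)) powr (1 / 2)"
          using elim(3) by (subst powr_realpow) (simp_all add: powr_half_sqrt)
        thus ?thesis unfolding powr_powr by (simp add: add_divide_distrib add.commute)
      qed
      also have "sqrt (216 * tail_const) * B powr (real D / 2 + 1) * (max 1 C * ?p) = E B"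
      proof -
        have p: "B powr (real D / 2 + 1) * ?p = B powr (-1)" unfolding powr_add[symmetric] by simp
        have "u * v * (w * z) = u * w * (v * z)" for u v w z :: real by simp
        from this[of "sqrt (216 * tail_const)" "B powr (real D / 2 + 1)" "max 1 C" ?p]
        show ?thesis unfolding E_def p .
      qed
      finally show "sqrt (var B K) * norm (psi B K \<theta>) \<le> E B" .
    qed
  qed
  ultimately show ?thesis by (intro exI[of _ E] conjI) (simp_all only: mult_zero_right)
qed


section \<open>The local limit theorem\<close>

text \<open>The mean of the truncated sum, in which only the parts in \<open>K\<close> occur.\<close>

definition mu :: "real \<Rightarrow> 'a set \<Rightarrow> real" where "mu B K = (\<Sum>k\<in>K. mom 1 B k)"

text \<open>Taylor expansion of \<open>- Ln (1 - exp w)\<close> to second order at \<open>w = - a k / B\<close>, along the vertical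
  line through this point. There the third derivative \<open>exp w * (1 + exp w) / (1 - exp w) ^ 3\<close> is
  bounded by twice \<open>e / (1 - e) ^ 3\<close> with \<open>e = exp (- a k / B)\<close>.\<close>

lemma phi_expansion:
  assumes "k \<in> I" "B > 0"
  shows "\<exists>\<epsilon>. norm \<epsilon> \<le> \<bar>\<theta>\<bar> ^ 3 * mom 3 B k \<and>
           phi B k \<theta> = exp (\<i> * of_real (mom 1 B k * \<theta>) - of_real (mom 2 B k * \<theta>\<^sup>2 / 2) + \<epsilon>)"
proof -
  define x where "x = real (a k) / B"
  define e where "e = exp (- x)"
  have x: "x > 0" using assms a_pos[of k] by (simp add: x_def)
  have e: "0 < e" "e < 1" using x by (auto simp: e_def)
  define S where "S = {w. Re w = - x}"
  define f :: "nat \<Rightarrow> complex \<Rightarrow> complex" where "f = (\<lambda>i w.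
     if i = 0 then - Ln (1 - exp w) else if i = 1 then exp w / (1 - exp w)
     else if i = 2 then exp w / (1 - exp w) ^ 2 else exp w * (1 + exp w) / (1 - exp w) ^ 3)"
  have norm_e: "norm (exp w) = e" if "w \<in> S" for w using that by (simp add: S_def e_def)
  have nz: "1 - exp w \<noteq> 0" if "w \<in> S" for w
    using norm_e[OF that] e by (metis eq_iff_diff_eq_0 less_irrefl norm_one)
  have nonpos: "1 - exp w \<notin> \<real>\<^sub>\<le>\<^sub>0" if "w \<in> S" for w
  proof -
    have "Re (exp w) \<le> e" using complex_Re_le_cmod[of "exp w"] norm_e[OF that] by simp
    hence "Re (1 - exp w) > 0" using e by simp
    thus ?thesis by (auto simp: complex_nonpos_Reals_iff)
  qed
  have taylor: "cmod (f 0 (Complex (-x) (real (a k) * \<theta>)) - (\<Sum>i\<le>2. f i (Complex (-x) 0) * (Complex (-x) (real (a k) * \<theta>) - Complex (-x) 0) ^ i / fact i))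
     \<le> (2 * e / (1 - e) ^ 3) * cmod (Complex (-x) (real (a k) * \<theta>) - Complex (-x) 0) ^ Suc 2 / fact 2"
  proof (rule complex_Taylor[of S])
    show "convex S"
      unfolding S_def convex_def by (auto simp: algebra_simps) (metis distrib_right mult_1)
    fix i :: nat and w assume w: "w \<in> S" and i: "i \<le> 2"
    consider "i = 0" | "i = 1" | "i = 2" using i by linarith
    thus "(f i has_field_derivative f (Suc i) w) (at w within S)"
    proof cases
      case 1
      thus ?thesis unfolding f_def using nonpos[OF w] nz[OF w]
        by (auto intro!: derivative_eq_intros simp: field_simps)
    next
      case 2
      thus ?thesis unfolding f_def using nz[OF w]
        by (auto intro!: derivative_eq_intros simp: field_simps power2_eq_square)
    next
      case 3
      have "((\<lambda>w. exp w / (1 - exp w) ^ 2) has_field_derivative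
              ((exp w * (1 - exp w) ^ 2 - exp w * (2 * (1 - exp w) * (- exp w))) / ((1 - exp w) ^ 2 * (1 - exp w) ^ 2))) (at w within S)"
        using nz[OF w] by (auto intro!: derivative_eq_intros)
      also have "(exp w * (1 - exp w) ^ 2 - exp w * (2 * (1 - exp w) * (- exp w))) / ((1 - exp w) ^ 2 * (1 - exp w) ^ 2)
          = (1 - exp w) * (exp w * (1 + exp w)) / ((1 - exp w) * (1 - exp w) ^ 3)"
        by (intro arg_cong2[where f = "(/)"]) algebra+
      also have "\<dots> = exp w * (1 + exp w) / (1 - exp w) ^ 3" using nz[OF w] by simp
      finally show ?thesis using 3 unfolding f_def by simp
    qed
  next
    fix w assume w: "w \<in> S"
    have "1 - e \<le> norm (1 - exp w)" using norm_triangle_ineq2[of 1 "exp w"] norm_e[OF w] by simp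
    hence "(1 - e) ^ 3 \<le> norm (1 - exp w) ^ 3" using e by (intro power_mono) auto
    moreover have "norm (1 + exp w) \<le> 2" using norm_triangle_ineq[of 1 "exp w"] norm_e[OF w] e by simp
    hence "e * norm (1 + exp w) \<le> 2 * e" using e by simp
    ultimately have "e * norm (1 + exp w) / norm (1 - exp w) ^ 3 \<le> 2 * e / (1 - e) ^ 3"
      using e by (intro frac_le) auto
    thus "cmod (f (Suc 2) w) \<le> 2 * e / (1 - e) ^ 3"
      unfolding f_def using norm_e[OF w] by (simp add: norm_divide norm_mult norm_power del: norm_exp_eq_Re)
  qed (auto simp: S_def)
  have diff: "Complex (-x) (real (a k) * \<theta>) - Complex (-x) 0 = \<i> * of_real (real (a k) * \<theta>)"
    by (simp add: complex_eq_iff)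
  have "Complex (-x) 0 = of_real (-x)" by (simp add: complex_eq_iff)
  hence exp_w0: "exp (Complex (-x) 0) = of_real e" unfolding e_def by (simp only: exp_of_real)
  define \<epsilon> where "\<epsilon> = f 0 (Complex (-x) (real (a k) * \<theta>)) -
      (f 0 (Complex (-x) 0) + \<i> * of_real (mom 1 B k * \<theta>) - of_real (mom 2 B k * \<theta>\<^sup>2 / 2))"
  have mom1: "mom 1 B k = real (a k) * e / (1 - e)" and mom2: "mom 2 B k = (real (a k))\<^sup>2 * e / (1 - e)\<^sup>2"
    by (simp_all add: mom_def power_divide flip: x_def e_def)
  have f12: "f 1 (Complex (-x) 0) = of_real (e / (1 - e))" "f 2 (Complex (-x) 0) = of_real (e / (1 - e)\<^sup>2)"
    unfolding f_def by (simp_all add: exp_w0)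
  have "(\<Sum>i\<le>2. f i (Complex (-x) 0) * (\<i> * of_real (real (a k) * \<theta>)) ^ i / fact i) =
     f 0 (Complex (-x) 0) + f 1 (Complex (-x) 0) * (\<i> * of_real (real (a k) * \<theta>)) + f 2 (Complex (-x) 0) * (\<i> * of_real (real (a k) * \<theta>))\<^sup>2 / 2"
    by (simp add: numeral_2_eq_2)
  also have "\<dots> = f 0 (Complex (-x) 0) + \<i> * of_real (mom 1 B k * \<theta>) - of_real (mom 2 B k * \<theta>\<^sup>2 / 2)"
    unfolding f12 mom1 mom2 by (simp add: power_mult_distrib algebra_simps)
  finally have "norm \<epsilon> \<le> (2 * e / (1 - e) ^ 3) * cmod (\<i> * of_real (real (a k) * \<theta>)) ^ Suc 2 / fact 2"
    using taylor unfolding diff \<epsilon>_def by (simp only:)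
  also have "cmod (\<i> * of_real (real (a k) * \<theta>)) = \<bar>real (a k) * \<theta>\<bar>"
    by (simp only: norm_mult norm_of_real norm_ii mult_1)
  also have "(2 * e / (1 - e) ^ 3) * \<bar>real (a k) * \<theta>\<bar> ^ Suc 2 / fact 2 = (2 * e / (1 - e) ^ 3) * \<bar>real (a k) * \<theta>\<bar> ^ 3 / 2"
    by (simp add: eval_nat_numeral)
  also have "\<dots> = \<bar>\<theta>\<bar> ^ 3 * mom 3 B k"
    by (simp add: mom_def power_divide power_mult_distrib abs_mult flip: x_def e_def)
  finally have "norm \<epsilon> \<le> \<bar>\<theta>\<bar> ^ 3 * mom 3 B k" .
  moreover have "phi B k \<theta> = exp (f 0 (Complex (-x) (real (a k) * \<theta>)) - f 0 (Complex (-x) 0))"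
  proof -
    have z: "Complex (-x) (real (a k) * \<theta>) \<in> S" "Complex (-x) 0 \<in> S" by (auto simp: S_def)
    have "exp (Complex (-x) (real (a k) * \<theta>)) = of_real e * cis (real (a k) * \<theta>)"
      by (simp add: exp_eq_polar e_def)
    moreover have "exp (f 0 w - f 0 v) = (1 - exp v) / (1 - exp w)" if "w \<in> S" "v \<in> S" for w v
    proof -
      have "f 0 w - f 0 v = Ln (1 - exp v) - Ln (1 - exp w)" by (simp add: f_def)
      thus ?thesis by (simp only: exp_diff exp_Ln[OF nz[OF that(1)]] exp_Ln[OF nz[OF that(2)]])
    qed
    ultimately show ?thesis using z exp_w0 by (simp add: phi_def flip: x_def e_def)
  qed
  ultimately show ?thesis
    by (intro exI[of _ \<epsilon>]) (simp add: \<epsilon>_def)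
qed

text \<open>Third moments are at most \<open>2 * B * cut B\<close> times the variance for the parts up to the cut, and the
  larger parts together contribute at most \<open>B * cut B\<close> times the variance.\<close>

lemma psi_expansion:
  "\<forall>\<^sub>F B in at_top. \<forall>K \<theta>. good B K \<longrightarrow> (\<exists>\<epsilon>. norm \<epsilon> \<le> \<bar>\<theta>\<bar> ^ 3 * (3 * B * cut B * var B K) \<and>
     psi B K \<theta> = exp (\<i> * of_real (mu B K * \<theta>) - of_real (var B K * \<theta>\<^sup>2 / 2) + \<epsilon>))"
proof -
  have "\<forall>\<^sub>F B::real in at_top. 216 * B\<^sup>2 * exp (- (B powr (g/8) / 4)) * (tail_const * B ^ D) \<le> c0 / 3 * (B\<^sup>2 * B powr g)"
    using exp_cut_negligible[of "c0 / 3"] g_pos c0_pos by simp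
  with eventually_ge_at_top[of 1] show ?thesis
  proof eventually_elim
    case (elim B)
    hence B: "B > 0" "cut B \<ge> 1" using cut_ge_1 by auto
    show ?case
    proof (intro allI impI)
      fix K \<theta> assume K: "good B K"
      let ?L = "{k \<in> K. real (a k) \<le> B * cut B}" and ?H = "{k \<in> K. \<not> real (a k) \<le> B * cut B}"
      have v: "var B K > 0" by (rule var_pos[OF K elim(1)])
      have "(\<Sum>k\<in>?H. mom 3 B k) \<le> 216 * B ^ 3 * exp (- (cut B / 4)) * (tail_const * B ^ D)"
        using goodD[OF K] B by (intro sum_mom_tail_le) auto
      also have "\<dots> = B * (216 * B\<^sup>2 * exp (- (cut B / 4)) * (tail_const * B ^ D))"
        by (simp add: eval_nat_numeral)
      also have "\<dots> \<le> B * (c0 / 3 * (B\<^sup>2 * B powr g))"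
        using elim(2) B by (intro mult_left_mono) (auto simp: cut_def)
      also have "\<dots> \<le> B * var B K" using var_ge[OF K elim(1)] B by (intro mult_left_mono) auto
      also have "\<dots> \<le> B * cut B * var B K" using B v by simp
      finally have H: "(\<Sum>k\<in>?H. mom 3 B k) \<le> B * cut B * var B K" .
      have "mom 3 B k \<le> 2 * B * cut B * mom 2 B k" if k: "k \<in> ?L" for k
      proof -
        have kI: "k \<in> I" using k goodD[OF K] by auto
        have "real (a k) / (1 - exp (- (real (a k) / B))) \<le> B * (1 + real (a k) / B)"
          by (rule base_le[OF kI B(1)])
        also have "\<dots> = B + real (a k)" using B by (simp add: field_simps)
        also have "\<dots> \<le> B * cut B + B * cut B" using k B by (intro add_mono) auto
        finally have "real (a k) / (1 - exp (- (real (a k) / B))) * mom 2 B k \<le> 2 * B * cut B * mom 2 B k"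
          using mom_pos[OF kI B(1), of 2] by (intro mult_right_mono) auto
        thus ?thesis by (simp add: mom_def power_divide eval_nat_numeral)
      qed
      hence "(\<Sum>k\<in>?L. mom 3 B k) \<le> (\<Sum>k\<in>?L. 2 * B * cut B * mom 2 B k)" by (rule sum_mono)
      also have "\<dots> = 2 * B * cut B * (\<Sum>k\<in>?L. mom 2 B k)" by (simp add: sum_distrib_left)
      also have "\<dots> \<le> 2 * B * cut B * var B K"
        unfolding var_def using B goodD[OF K] mom_pos[OF _ B(1), of _ 2]
        by (intro mult_left_mono sum_mono2) (auto intro!: less_imp_le)
      finally have L: "(\<Sum>k\<in>?L. mom 3 B k) \<le> 2 * B * cut B * var B K" .
      have "(\<Sum>k\<in>K. mom 3 B k) = (\<Sum>k\<in>?L \<union> ?H. mom 3 B k)" by (rule sum.cong) auto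
      also have "\<dots> = (\<Sum>k\<in>?L. mom 3 B k) + (\<Sum>k\<in>?H. mom 3 B k)"
        using goodD(1)[OF K] by (intro sum.union_disjoint) auto
      also have "\<dots> \<le> 3 * B * cut B * var B K" using H L by simp
      finally have third: "(\<Sum>k\<in>K. mom 3 B k) \<le> 3 * B * cut B * var B K" .
      have "\<forall>k\<in>K. \<exists>\<epsilon>. norm \<epsilon> \<le> \<bar>\<theta>\<bar> ^ 3 * mom 3 B k \<and>
           phi B k \<theta> = exp (\<i> * of_real (mom 1 B k * \<theta>) - of_real (mom 2 B k * \<theta>\<^sup>2 / 2) + \<epsilon>)"
        using goodD[OF K] B phi_expansion by auto
      then obtain \<epsilon> where \<epsilon>: "\<And>k. k \<in> K \<Longrightarrow> norm (\<epsilon> k) \<le> \<bar>\<theta>\<bar> ^ 3 * mom 3 B k"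
         "\<And>k. k \<in> K \<Longrightarrow> phi B k \<theta> = exp (\<i> * of_real (mom 1 B k * \<theta>) - of_real (mom 2 B k * \<theta>\<^sup>2 / 2) + \<epsilon> k)"
        by metis
      have "psi B K \<theta> = exp (\<Sum>k\<in>K. \<i> * of_real (mom 1 B k * \<theta>) - of_real (mom 2 B k * \<theta>\<^sup>2 / 2) + \<epsilon> k)"
        unfolding psi_def using \<epsilon>(2) goodD[OF K] by (simp add: exp_sum)
      also have "(\<Sum>k\<in>K. \<i> * of_real (mom 1 B k * \<theta>) - of_real (mom 2 B k * \<theta>\<^sup>2 / 2) + \<epsilon> k) =
          \<i> * of_real (mu B K * \<theta>) - of_real (var B K * \<theta>\<^sup>2 / 2) + (\<Sum>k\<in>K. \<epsilon> k)"
        by (simp add: mu_def var_def sum.distrib sum_subtractf sum_distrib_left sum_distrib_right sum_divide_distrib)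
      finally have "psi B K \<theta> = exp (\<i> * of_real (mu B K * \<theta>) - of_real (var B K * \<theta>\<^sup>2 / 2) + (\<Sum>k\<in>K. \<epsilon> k))" .
      moreover have "norm (\<Sum>k\<in>K. \<epsilon> k) \<le> (\<Sum>k\<in>K. \<bar>\<theta>\<bar> ^ 3 * mom 3 B k)"
        using \<epsilon>(1) by (rule sum_norm_le)
      moreover have "\<dots> = \<bar>\<theta>\<bar> ^ 3 * (\<Sum>k\<in>K. mom 3 B k)" by (simp add: sum_distrib_left)
      moreover have "\<dots> \<le> \<bar>\<theta>\<bar> ^ 3 * (3 * B * cut B * var B K)" using third by (intro mult_left_mono) auto
      ultimately show "\<exists>\<epsilon>. norm \<epsilon> \<le> \<bar>\<theta>\<bar> ^ 3 * (3 * B * cut B * var B K) \<and>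
         psi B K \<theta> = exp (\<i> * of_real (mu B K * \<theta>) - of_real (var B K * \<theta>\<^sup>2 / 2) + \<epsilon>)"
        by (intro exI[of _ "\<Sum>k\<in>K. \<epsilon> k"] conjI) linarith+
    qed
  qed
qed

lemma sd_ge:
  assumes "good B K" "B \<ge> 1"
  shows "sqrt (c0 / 3) * (B * B powr (g / 2)) \<le> sqrt (var B K)"
proof -
  have "sqrt (c0 / 3) * (B * B powr (g / 2)) = sqrt (c0 / 3) * (sqrt (B\<^sup>2) * sqrt (B powr g))"
    using assms(2) by (simp add: powr_powr flip: powr_half_sqrt)
  also have "\<dots> = sqrt (c0 / 3 * (B\<^sup>2 * B powr g))" by (simp only: real_sqrt_mult)
  also have "\<dots> \<le> sqrt (var B K)" using var_ge[OF assms] by simp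
  finally show ?thesis .
qed

lemma cut_div_sd:
  "((\<lambda>B. 3 * B * cut B / sqrt (c0 / 3 * (B\<^sup>2 * B powr g))) \<longlongrightarrow> 0) at_top"
proof -
  have "((\<lambda>B. 3 * B * B powr (g / 8) / sqrt (c * (B\<^sup>2 * B powr g))) \<longlongrightarrow> 0) at_top" if "c > 0" for c :: real
    using that g_pos by real_asymp
  from this[of "c0 / 3"] show ?thesis using c0_pos by (simp add: cut_def)
qed

text \<open>With \<open>\<theta> = u / sqrt (var B K)\<close> the cubic error of \<open>psi_expansion\<close> becomes
  \<open>\<bar>u\<bar> ^ 3\<close> times \<open>3 * B * cut B / sqrt (var B K)\<close>, which tends to 0 because the standard deviation
  is of order at least \<open>B powr (1 + g / 2)\<close>.\<close>

lemma clt_pointwise: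
  fixes B :: "nat \<Rightarrow> real" and K :: "nat \<Rightarrow> 'a set" and m :: "nat \<Rightarrow> real"
  assumes B: "filterlim B at_top sequentially" and K: "\<forall>\<^sub>F n in sequentially. good (B n) (K n)"
    and m: "(\<lambda>n. (m n - mu (B n) (K n)) / sqrt (var (B n) (K n))) \<longlonglongrightarrow> 0"
  shows "(\<lambda>n. psi (B n) (K n) (u / sqrt (var (B n) (K n))) * cis (- (m n * (u / sqrt (var (B n) (K n))))))
           \<longlonglongrightarrow> of_real (exp (- (u\<^sup>2 / 2)))"
proof -
  define s where "s = (\<lambda>n. sqrt (var (B n) (K n)))"
  define P where "P = (\<lambda>n \<epsilon>. norm \<epsilon> \<le> \<bar>u / s n\<bar> ^ 3 * (3 * B n * cut (B n) * var (B n) (K n)) \<and>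
     psi (B n) (K n) (u / s n) = exp (\<i> * of_real (mu (B n) (K n) * (u / s n)) - of_real (var (B n) (K n) * (u / s n)\<^sup>2 / 2) + \<epsilon>))"
  define \<epsilon> where "\<epsilon> = (\<lambda>n. SOME \<epsilon>. P n \<epsilon>)"
  have ev: "\<forall>\<^sub>F n in sequentially. B n \<ge> 1"
    using B by (simp add: filterlim_at_top)
  have "\<forall>\<^sub>F n in sequentially. \<exists>\<epsilon>. P n \<epsilon>"
    using eventually_compose_filterlim[OF psi_expansion B] K
  proof eventually_elim
    case (elim n)
    from elim(1)[rule_format, OF elim(2), of "u / s n"] show ?case unfolding P_def .
  qed
  hence P: "\<forall>\<^sub>F n in sequentially. P n (\<epsilon> n)"
    by eventually_elim (auto simp: \<epsilon>_def intro: someI_ex)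
  have "\<forall>\<^sub>F n in sequentially. norm (\<epsilon> n) \<le> \<bar>u\<bar> ^ 3 * (3 * B n * cut (B n) / sqrt (c0 / 3 * ((B n)\<^sup>2 * B n powr g)))"
    using P K ev
  proof eventually_elim
    case (elim n)
    have v: "var (B n) (K n) > 0" by (rule var_pos[OF elim(2,3)])
    hence s: "s n > 0" "var (B n) (K n) = (s n)\<^sup>2" by (auto simp: s_def)
    have "norm (\<epsilon> n) \<le> \<bar>u / s n\<bar> ^ 3 * (3 * B n * cut (B n) * var (B n) (K n))"
      using elim(1) by (simp add: P_def)
    also have "\<dots> = \<bar>u\<bar> ^ 3 * (3 * B n * cut (B n) / s n)"
      using s by (simp add: power_divide eval_nat_numeral)
    also have "\<dots> \<le> \<bar>u\<bar> ^ 3 * (3 * B n * cut (B n) / sqrt (c0 / 3 * ((B n)\<^sup>2 * B n powr g)))"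
    proof (intro mult_left_mono divide_left_mono mult_pos_pos)
      show "sqrt (c0 / 3 * ((B n)\<^sup>2 * B n powr g)) \<le> s n"
        using var_ge[OF elim(2,3)] by (simp add: s_def)
    qed (use elim(3) c0_pos cut_ge_1[OF elim(3)] s(1) in auto)
    finally show ?case .
  qed
  moreover have "(\<lambda>n. \<bar>u\<bar> ^ 3 * (3 * B n * cut (B n) / sqrt (c0 / 3 * ((B n)\<^sup>2 * B n powr g)))) \<longlonglongrightarrow> \<bar>u\<bar> ^ 3 * 0"
    by (intro tendsto_mult tendsto_const filterlim_compose[OF cut_div_sd B])
  ultimately have \<epsilon>0: "\<epsilon> \<longlonglongrightarrow> 0"
    by (intro Lim_null_comparison[of \<epsilon>]) simp_all
  have "(\<lambda>n. exp (- (\<i> * of_real (u * ((m n - mu (B n) (K n)) / s n))) - of_real (u\<^sup>2 / 2) + \<epsilon> n))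
     \<longlonglongrightarrow> exp (- (\<i> * of_real (u * 0)) - of_real (u\<^sup>2 / 2) + 0)"
    using m by (intro tendsto_intros \<epsilon>0) (simp add: s_def)
  also have "exp (- (\<i> * of_real (u * 0)) - of_real (u\<^sup>2 / 2) + 0) = complex_of_real (exp (- (u\<^sup>2 / 2)))"
    by (simp flip: exp_of_real)
  finally show ?thesis
  proof (rule Lim_transform_eventually)
    show "\<forall>\<^sub>F n in sequentially. exp (- (\<i> * of_real (u * ((m n - mu (B n) (K n)) / s n))) - of_real (u\<^sup>2 / 2) + \<epsilon> n) =
        psi (B n) (K n) (u / sqrt (var (B n) (K n))) * cis (- (m n * (u / sqrt (var (B n) (K n)))))"
      using P K ev
    proof eventually_elim
      case (elim n)
      have v: "var (B n) (K n) > 0" by (rule var_pos[OF elim(2,3)])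
      hence s: "s n > 0" "var (B n) (K n) = (s n)\<^sup>2" by (auto simp: s_def)
      have "psi (B n) (K n) (u / s n) * cis (- (m n * (u / s n))) =
          exp (\<i> * of_real (mu (B n) (K n) * (u / s n)) - of_real (var (B n) (K n) * (u / s n)\<^sup>2 / 2) + \<epsilon> n + \<i> * of_real (- (m n * (u / s n))))"
        unfolding exp_add[of _ "\<i> * of_real (- (m n * (u / s n)))"] cis_conv_exp
        using elim(1) by (simp add: P_def)
      also have "\<i> * of_real (mu (B n) (K n) * (u / s n)) - of_real (var (B n) (K n) * (u / s n)\<^sup>2 / 2) + \<epsilon> n + \<i> * of_real (- (m n * (u / s n))) =
          - (\<i> * of_real (u * ((m n - mu (B n) (K n)) / s n))) - complex_of_real (u\<^sup>2 / 2) + \<epsilon> n"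
        using s by (simp add: power_divide diff_divide_distrib algebra_simps)
      finally show ?case by (simp add: s_def)
    qed
  qed
qed

text \<open>The integrand of the rescaled Fourier integral, restricted to the range of \<open>psi_near\<close>.\<close>

definition central :: "real \<Rightarrow> 'a set \<Rightarrow> real \<Rightarrow> real \<Rightarrow> complex" where
  "central B K m u = indicator {- (sqrt (var B K) * (pi / (B * cut B)))..sqrt (var B K) * (pi / (B * cut B))} u *\<^sub>R
     (psi B K (u / sqrt (var B K)) * cis (- (m * (u / sqrt (var B K)))))"

lemma continuous_on_psi [continuous_intros]:
  assumes "B > 0" "K \<subseteq> I" shows "continuous_on T (psi B K)"
  unfolding psi_def phi_def
proof (intro continuous_intros ballI)
  fix k t assume "k \<in> K"
  hence "exp (- (real (a k) / B)) < 1" using a_pos[of k] assms by auto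
  thus "1 - complex_of_real (exp (- (real (a k) / B))) * cis (real (a k) * t) \<noteq> 0"
    by (metis abs_of_pos eq_iff_diff_eq_0 exp_gt_zero less_irrefl mult.right_neutral norm_cis norm_mult norm_of_real norm_one)
qed

lemma continuous_on_psi' [continuous_intros]:
  assumes "B > 0" "K \<subseteq> I" "continuous_on T f" shows "continuous_on T (\<lambda>x. psi B K (f x))"
  using continuous_on_compose2[OF continuous_on_psi[OF assms(1,2)] assms(3) subset_UNIV] .

lemma gauss_integrable: "integrable lborel (\<lambda>u::real. exp (- (u\<^sup>2 / 52)))"
proof -
  have "integrable lborel (\<lambda>u. sqrt (2 * pi * (sqrt 26)\<^sup>2) * normal_density 0 (sqrt 26) u)"
    by (intro integrable_mult_right integrable_normal_density) simp
  thus ?thesis by (simp add: normal_density_def)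
qed

lemma gauss_integral: "(\<integral>u. exp (- (u\<^sup>2 / 2)) \<partial>lborel) = sqrt (2 * pi)"
proof -
  have "(\<integral>u. sqrt (2 * pi) * normal_density 0 1 u \<partial>lborel) = sqrt (2 * pi)"
    by (subst integral_mult_right_zero) (simp add: integral_normal_density)
  thus ?thesis by (simp add: normal_density_def)
qed

lemma fourier_central:
  "\<exists>E. (E \<longlongrightarrow> 0) at_top \<and> (\<forall>\<^sub>F B in at_top. \<forall>K m. good B K \<longrightarrow>
     central B K m \<in> borel_measurable lborel \<and>
     (\<forall>u. norm (central B K m u) \<le> exp (- (u\<^sup>2 / 52))) \<and>
     norm (of_real (sqrt (var B K)) * integral {-pi..pi} (\<lambda>\<theta>. psi B K \<theta> * cis (- (m * \<theta>))) -
           (\<integral>u. central B K m u \<partial>lborel)) \<le> E B)"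
proof -
  obtain E where E: "(E \<longlongrightarrow> 0) at_top" "\<forall>\<^sub>F B in at_top. \<forall>K \<theta>. good B K \<longrightarrow> pi / (B * cut B) \<le> \<bar>\<theta>\<bar> \<longrightarrow> \<bar>\<theta>\<bar> \<le> pi \<longrightarrow>
     sqrt (var B K) * norm (psi B K \<theta>) \<le> E B" using psi_rest by blast
  have "((\<lambda>B. 2 * pi * E B) \<longlongrightarrow> 2 * pi * 0) at_top" by (intro tendsto_intros E)
  moreover have "\<forall>\<^sub>F B in at_top. \<forall>K m. good B K \<longrightarrow>
     central B K m \<in> borel_measurable lborel \<and>
     (\<forall>u. norm (central B K m u) \<le> exp (- (u\<^sup>2 / 52))) \<and>
     norm (of_real (sqrt (var B K)) * integral {-pi..pi} (\<lambda>\<theta>. psi B K \<theta> * cis (- (m * \<theta>))) -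
           (\<integral>u. central B K m u \<partial>lborel)) \<le> 2 * pi * E B"
    using E(2) psi_near eventually_ge_at_top[of 1]
  proof eventually_elim
    case (elim B)
    show ?case
    proof (intro allI impI conjI)
      fix K m assume K: "good B K"
      define s where "s = sqrt (var B K)"
      define t where "t = pi / (B * cut B)"
      have B: "B > 0" "cut B \<ge> 1" using elim cut_ge_1 by auto
      have s: "s > 0" "var B K = s\<^sup>2" using var_pos[OF K elim(3)] by (auto simp: s_def)
      have "pi / (B * cut B) \<le> pi / 1" using B elim(3) mult_mono[of 1 B 1 "cut B"] by (intro divide_left_mono) auto
      hence t: "0 < t" "t \<le> pi" using B by (auto simp: t_def)
      define f where "f = (\<lambda>\<theta>. psi B K \<theta> * cis (- (m * \<theta>)))"
      have cont: "continuous_on T f" for T unfolding f_def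
        using B goodD[OF K] by (intro continuous_intros) auto
      have c: "central B K m = (\<lambda>u. indicator {- (s * t)..s * t} u *\<^sub>R f (u / s))"
        by (rule ext) (simp add: central_def f_def s_def t_def)
      show "central B K m \<in> borel_measurable lborel"
        unfolding c using cont[of UNIV] s
        by (intro borel_measurable_scaleR borel_measurable_indicator measurable_compose[OF _ borel_measurable_continuous_onI[OF cont]]) auto
      show "norm (central B K m u) \<le> exp (- (u\<^sup>2 / 52))" for u
      proof (cases "u \<in> {- (s * t)..s * t}")
        case True
        hence "\<bar>u / s\<bar> \<le> t" using s by (auto simp: abs_le_iff field_simps)
        hence "norm (psi B K (u / s)) \<le> exp (- (var B K * (u / s)\<^sup>2 / 52))"
          using elim(2) K by (simp add: t_def)
        thus ?thesis using s True by (simp add: c f_def norm_mult power_divide)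
      qed (simp add: c)
      have int: "f integrable_on {x..y}" for x y
        by (intro integrable_continuous_interval cont)
      have "integral {-pi..pi} f = integral {-pi..-t} f + integral {-t..pi} f"
        using t by (intro Henstock_Kurzweil_Integration.integral_combine[symmetric] int) auto
      also have "integral {-t..pi} f = integral {-t..t} f + integral {t..pi} f"
        using t by (intro Henstock_Kurzweil_Integration.integral_combine[symmetric] int) auto
      finally have split: "integral {-pi..pi} f - integral {-t..t} f = integral {-pi..-t} f + integral {t..pi} f"
        by simp
      have bnd: "norm (f \<theta>) \<le> E B / s" if "t \<le> \<bar>\<theta>\<bar>" "\<bar>\<theta>\<bar> \<le> pi" for \<theta>
      proof -
        have "s * norm (psi B K \<theta>) \<le> E B" using elim(1) K that by (simp add: t_def s_def)
        thus ?thesis using s(1) by (simp add: f_def norm_mult field_simps)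
      qed
      have E0: "0 \<le> E B / s" using order_trans[OF norm_ge_zero bnd[of pi]] t by simp
      have "norm (integral {-pi..-t} f) \<le> E B / s * (-t - (-pi))"
        using t by (intro integral_bound cont bnd) auto
      moreover have "norm (integral {t..pi} f) \<le> E B / s * (pi - t)"
        using t by (intro integral_bound cont bnd) auto
      ultimately have "norm (integral {-pi..pi} f - integral {-t..t} f) \<le> E B / s * (pi - t) + E B / s * (pi - t)"
        unfolding split by (intro norm_triangle_le add_mono) auto
      also have "\<dots> \<le> E B / s * pi + E B / s * pi"
        using E0 t by (intro add_mono mult_left_mono) auto
      finally have 1: "norm (integral {-pi..pi} f - integral {-t..t} f) \<le> 2 * pi * E B / s" by simp
      have "integral {-t..t} f = (LINT \<theta>:{-t..t}|lborel. f \<theta>)"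
        using cont by (intro set_borel_integral_eq_integral(2)[symmetric] borel_integrable_atLeastAtMost') auto
      also have "\<dots> = (\<integral>\<theta>. indicator {-t..t} \<theta> *\<^sub>R f \<theta> \<partial>lborel)" by (simp add: set_lebesgue_integral_def)
      also have "\<dots> = \<bar>1 / s\<bar> *\<^sub>R (\<integral>u. indicator {-t..t} (0 + 1 / s * u) *\<^sub>R f (0 + 1 / s * u) \<partial>lborel)"
        using s by (intro lborel_integral_real_affine) auto
      also have "(\<lambda>u. indicator {-t..t} (0 + 1 / s * u) *\<^sub>R f (0 + 1 / s * u)) = central B K m"
        unfolding c using s by (intro ext) (auto simp: indicator_def field_simps)
      finally have "(\<integral>u. central B K m u \<partial>lborel) = of_real s * integral {-t..t} f"
        using s by (simp add: scaleR_conv_of_real field_simps)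
      hence "of_real s * integral {-pi..pi} f - (\<integral>u. central B K m u \<partial>lborel) = of_real s * (integral {-pi..pi} f - integral {-t..t} f)"
        by (simp add: algebra_simps)
      also have "norm \<dots> = s * norm (integral {-pi..pi} f - integral {-t..t} f)" using s by (simp add: norm_mult)
      also have "\<dots> \<le> s * (2 * pi * E B / s)" using 1 s by (intro mult_left_mono) auto
      also have "\<dots> = 2 * pi * E B" using s by simp
      finally show "norm (of_real (sqrt (var B K)) * integral {-pi..pi} (\<lambda>\<theta>. psi B K \<theta> * cis (- (m * \<theta>))) -
           (\<integral>u. central B K m u \<partial>lborel)) \<le> 2 * pi * E B" unfolding s_def f_def .
    qed
  qed
  ultimately show ?thesis by (intro exI[of _ "\<lambda>B. 2 * pi * E B"] conjI) (simp_all only: mult_zero_right)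
qed

lemma fourier_bounded:
  "\<exists>C. \<forall>\<^sub>F B in at_top. \<forall>K m. good B K \<longrightarrow>
     sqrt (var B K) * norm (integral {-pi..pi} (\<lambda>\<theta>. psi B K \<theta> * cis (- (m * \<theta>)))) \<le> C"
proof -
  obtain E where E: "(E \<longlongrightarrow> 0) at_top" "\<forall>\<^sub>F B in at_top. \<forall>K m. good B K \<longrightarrow>
     central B K m \<in> borel_measurable lborel \<and>
     (\<forall>u. norm (central B K m u) \<le> exp (- (u\<^sup>2 / 52))) \<and>
     norm (of_real (sqrt (var B K)) * integral {-pi..pi} (\<lambda>\<theta>. psi B K \<theta> * cis (- (m * \<theta>))) -
           (\<integral>u. central B K m u \<partial>lborel)) \<le> E B" using fourier_central by blast
  have "\<forall>\<^sub>F B in at_top. E B < 1" using E(1) by (rule order_tendstoD) simp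
  with E(2) eventually_ge_at_top[of 1]
  have "\<forall>\<^sub>F B in at_top. \<forall>K m. good B K \<longrightarrow>
     sqrt (var B K) * norm (integral {-pi..pi} (\<lambda>\<theta>. psi B K \<theta> * cis (- (m * \<theta>)))) \<le> 1 + (\<integral>u. exp (- ((u::real)\<^sup>2 / 52)) \<partial>lborel)"
  proof eventually_elim
    case (elim B)
    show ?case
    proof (intro allI impI)
      fix K m assume K: "good B K"
      let ?J = "integral {-pi..pi} (\<lambda>\<theta>. psi B K \<theta> * cis (- (m * \<theta>)))"
      let ?c = "\<integral>u. central B K m u \<partial>lborel"
      have "norm ?c \<le> (\<integral>u. exp (- ((u::real)\<^sup>2 / 52)) \<partial>lborel)"
      proof (rule order_trans[OF integral_norm_bound integral_mono])
        have "integrable lborel (central B K m)"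
          by (rule Bochner_Integration.integrable_bound[OF gauss_integrable]) (use elim(1) K in auto)
        thus "integrable lborel (\<lambda>u. norm (central B K m u))" by simp
      qed (use elim(1) K gauss_integrable in auto)
      moreover have "norm (of_real (sqrt (var B K)) * ?J - ?c) \<le> 1"
        using elim(1)[rule_format, OF K, of m, THEN conjunct2, THEN conjunct2] elim(3) by linarith
      moreover have "norm (of_real (sqrt (var B K)) * ?J) \<le> norm (of_real (sqrt (var B K)) * ?J - ?c) + norm ?c"
        using norm_triangle_ineq[of "of_real (sqrt (var B K)) * ?J - ?c" ?c] by (simp only: diff_add_cancel)
      moreover have "norm (of_real (sqrt (var B K)) * ?J) = sqrt (var B K) * norm ?J"
        using var_pos[OF K elim(2)] by (simp add: norm_mult)
      ultimately show "sqrt (var B K) * norm ?J \<le> 1 + (\<integral>u. exp (- ((u::real)\<^sup>2 / 52)) \<partial>lborel)" by linarith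
    qed
  qed
  thus ?thesis by blast
qed

text \<open>Dominated convergence on the central range, with the Gaussian bound of \<open>psi_near\<close> as majorant.\<close>

theorem fourier_limit:
  fixes B :: "nat \<Rightarrow> real" and K :: "nat \<Rightarrow> 'a set" and m :: "nat \<Rightarrow> real"
  assumes B: "filterlim B at_top sequentially" and K: "\<forall>\<^sub>F n in sequentially. good (B n) (K n)"
    and m: "(\<lambda>n. (m n - mu (B n) (K n)) / sqrt (var (B n) (K n))) \<longlonglongrightarrow> 0"
  shows "(\<lambda>n. of_real (sqrt (var (B n) (K n))) * integral {-pi..pi} (\<lambda>\<theta>. psi (B n) (K n) \<theta> * cis (- (m n * \<theta>))))
           \<longlonglongrightarrow> complex_of_real (sqrt (2 * pi))"
proof -
  obtain E where E: "(E \<longlongrightarrow> 0) at_top" "\<forall>\<^sub>F B in at_top. \<forall>K m. good B K \<longrightarrow>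
     central B K m \<in> borel_measurable lborel \<and>
     (\<forall>u. norm (central B K m u) \<le> exp (- (u\<^sup>2 / 52))) \<and>
     norm (of_real (sqrt (var B K)) * integral {-pi..pi} (\<lambda>\<theta>. psi B K \<theta> * cis (- (m * \<theta>))) -
           (\<integral>u. central B K m u \<partial>lborel)) \<le> E B" using fourier_central by blast
  define P where "P = (\<lambda>n. central (B n) (K n) (m n) \<in> borel_measurable lborel \<and>
     (\<forall>u. norm (central (B n) (K n) (m n) u) \<le> exp (- (u\<^sup>2 / 52))))"
  define c where "c = (\<lambda>n u. if P n then central (B n) (K n) (m n) u else 0)"
  have ev: "\<forall>\<^sub>F n in sequentially. B n \<ge> 1"
    using B by (simp add: filterlim_at_top)
  have P: "\<forall>\<^sub>F n in sequentially. P n"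
    using eventually_compose_filterlim[OF E(2) B] K
    by eventually_elim (auto simp: P_def)
  have sd_large: "filterlim (\<lambda>n. sqrt (var (B n) (K n)) * (pi / (B n * cut (B n)))) at_top sequentially"
  proof (rule filterlim_at_top_mono)
    have "filterlim (\<lambda>B. c * (B * B powr (g / 2)) * (pi / (B * B powr (g / 8)))) at_top at_top" if "c > 0" for c :: real
      using that g_pos by real_asymp
    from this[of "sqrt (c0 / 3)"] have "filterlim (\<lambda>B. sqrt (c0 / 3) * (B * B powr (g / 2)) * (pi / (B * cut B))) at_top at_top"
      using c0_pos unfolding cut_def by simp
    thus "filterlim (\<lambda>n. sqrt (c0 / 3) * (B n * B n powr (g / 2)) * (pi / (B n * cut (B n)))) at_top sequentially"
      using B by (rule filterlim_compose)
    show "\<forall>\<^sub>F n in sequentially. sqrt (c0 / 3) * (B n * B n powr (g / 2)) * (pi / (B n * cut (B n)))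
        \<le> sqrt (var (B n) (K n)) * (pi / (B n * cut (B n)))"
      using K ev
    proof eventually_elim
      case (elim n)
      thus ?case using sd_ge[OF elim] cut_ge_1[OF elim(2)] by (intro mult_right_mono) auto
    qed
  qed
  have "(\<lambda>n. \<integral>u. c n u \<partial>lborel) \<longlonglongrightarrow> (\<integral>u. complex_of_real (exp (- (u\<^sup>2 / 2))) \<partial>lborel)"
  proof (rule integral_dominated_convergence[where w = "\<lambda>u. exp (- (u\<^sup>2 / 52))"])
    show "c n \<in> borel_measurable lborel" for n
    proof (cases "P n")
      case True
      hence "c n = central (B n) (K n) (m n)" by (simp add: c_def)
      thus ?thesis using True by (simp add: P_def)
    next
      case False
      hence "c n = (\<lambda>_. 0)" by (simp add: c_def)
      thus ?thesis by simp
    qed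
    show "AE u in lborel. norm (c n u) \<le> exp (- (u\<^sup>2 / 52))" for n
      by (rule AE_I2) (auto simp: c_def P_def)
    show "AE u in lborel. (\<lambda>n. c n u) \<longlonglongrightarrow> complex_of_real (exp (- (u\<^sup>2 / 2)))"
    proof (rule AE_I2)
      fix u :: real
      show "(\<lambda>n. c n u) \<longlonglongrightarrow> complex_of_real (exp (- (u\<^sup>2 / 2)))"
      proof (rule Lim_transform_eventually[OF clt_pointwise[OF B K m, of u]])
        have "\<forall>\<^sub>F n in sequentially. \<bar>u\<bar> \<le> sqrt (var (B n) (K n)) * (pi / (B n * cut (B n)))"
          using sd_large by (simp add: filterlim_at_top)
        with P show "\<forall>\<^sub>F n in sequentially. psi (B n) (K n) (u / sqrt (var (B n) (K n))) * cis (- (m n * (u / sqrt (var (B n) (K n))))) = c n u"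
        proof eventually_elim
          case (elim n)
          hence "u \<in> {- (sqrt (var (B n) (K n)) * (pi / (B n * cut (B n))))..sqrt (var (B n) (K n)) * (pi / (B n * cut (B n)))}"
            unfolding atLeastAtMost_iff abs_le_iff by linarith
          thus ?case using elim(1) by (simp only: c_def central_def if_True indicator_simps scaleR_one)
        qed
      qed
    qed
  qed (use gauss_integrable in auto)
  also have "(\<integral>u. complex_of_real (exp (- (u\<^sup>2 / 2))) \<partial>lborel) = of_real (sqrt (2 * pi))"
    by (simp only: integral_complex_of_real gauss_integral)
  finally have lim: "(\<lambda>n. \<integral>u. c n u \<partial>lborel) \<longlonglongrightarrow> complex_of_real (sqrt (2 * pi))" .
  have "(\<lambda>n. of_real (sqrt (var (B n) (K n))) * integral {-pi..pi} (\<lambda>\<theta>. psi (B n) (K n) \<theta> * cis (- (m n * \<theta>))) - (\<integral>u. c n u \<partial>lborel)) \<longlonglongrightarrow> 0"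
  proof (rule Lim_null_comparison)
    show "(\<lambda>n. E (B n)) \<longlonglongrightarrow> 0" using E(1) B by (rule filterlim_compose)
    show "\<forall>\<^sub>F n in sequentially. norm (of_real (sqrt (var (B n) (K n))) * integral {-pi..pi} (\<lambda>\<theta>. psi (B n) (K n) \<theta> * cis (- (m n * \<theta>))) - (\<integral>u. c n u \<partial>lborel)) \<le> E (B n)"
      using eventually_compose_filterlim[OF E(2) B] K P
      by eventually_elim (auto simp: c_def)
  qed
  from tendsto_add[OF this lim] show ?thesis by simp
qed


section \<open>Ratios of partition numbers\<close>

text \<open>Larger parts do not occur in partitions of \<open>n\<close>, so the finitely many parts up to \<open>n\<close> suffice;
  \<open>mean_error_negligible\<close> says that the truncation does not disturb the centring at \<open>n\<close>.\<close>

definition parts_upto :: "nat \<Rightarrow> 'a set" where "parts_upto n = {k \<in> I. a k \<le> n}"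

lemma finite_parts_upto: "finite (parts_upto n)"
  using finite_weights_le[of "real n"] by (simp add: parts_upto_def)

lemma cut_le_mean: "\<forall>\<^sub>F B in at_top. B * cut B \<le> mean B"
proof -
  have "\<forall>\<^sub>F B::real in at_top. B * B powr (g / 8) \<le> c * (B * B powr g)" if "c > 0" for c
    using that g_pos by real_asymp
  from this[of "c0 / 3"] c0_pos have "\<forall>\<^sub>F B::real in at_top. B * B powr (g / 8) \<le> c0 / 3 * (B * B powr g)"
    by simp
  with eventually_ge_at_top[of 1] show ?thesis
  proof eventually_elim
    case (elim B)
    from elim(2) mean_ge[OF elim(1)] show ?case unfolding cut_def by linarith
  qed
qed

lemma good_saddle: "\<forall>\<^sub>F n in sequentially. good (saddle n) (parts_upto n)"
  using eventually_compose_filterlim[OF cut_le_mean filterlim_saddle] eventually_ge_at_top[of 1]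
proof eventually_elim
  case (elim n)
  hence "saddle n * cut (saddle n) \<le> real n" using saddle(2)[OF elim(2)] by simp
  thus ?case using finite_parts_upto by (auto simp: good_def parts_upto_def)
qed

lemma mean_minus_mu:
  assumes "B > 0" "finite K" "K \<subseteq> I" "\<And>k. k \<in> I - K \<Longrightarrow> B * A \<le> real (a k)"
  shows "0 \<le> mean B - mu B K" "mean B - mu B K \<le> 216 * B * exp (- (A / 4)) * (tail_const * B ^ D)"
proof -
  have "(mom 1 B has_sum (mean B - mu B K)) (I - K)"
    unfolding mu_def using assms by (intro has_sum_Diff has_sum_mean has_sum_finite) auto
  hence s: "mom 1 B summable_on (I - K)" "mean B - mu B K = infsum (mom 1 B) (I - K)"
    by (auto simp: has_sum_iff)
  show "0 \<le> mean B - mu B K"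
    unfolding s(2) using mom_pos[OF _ assms(1)] by (intro infsum_nonneg) (auto intro!: less_imp_le)
  show "mean B - mu B K \<le> 216 * B * exp (- (A / 4)) * (tail_const * B ^ D)"
    unfolding s(2)
  proof (rule infsum_le_finite_sums[OF s(1)])
    fix F assume F: "finite F" "F \<subseteq> I - K"
    have "sum (mom 1 B) F \<le> 216 * B ^ 1 * exp (- (A / 4)) * (tail_const * B ^ D)"
      using F assms by (intro sum_mom_tail_le) auto
    thus "sum (mom 1 B) F \<le> 216 * B * exp (- (A / 4)) * (tail_const * B ^ D)" by simp
  qed
qed

lemma scale_div_sd:
  "(\<lambda>n. saddle n / sqrt (var (saddle n) (parts_upto n))) \<longlonglongrightarrow> 0"
proof (rule real_tendsto_sandwich[OF _ _ tendsto_const filterlim_compose[OF cut_div_sd filterlim_saddle]])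
  have ev: "\<forall>\<^sub>F n in sequentially. saddle n \<ge> 1"
    using filterlim_saddle by (simp add: filterlim_at_top)
  show "\<forall>\<^sub>F n in sequentially. 0 \<le> saddle n / sqrt (var (saddle n) (parts_upto n))"
    using ev good_saddle
  proof eventually_elim
    case (elim n)
    thus ?case using var_pos[OF elim(2,1)] by simp
  qed
  show "\<forall>\<^sub>F n in sequentially. saddle n / sqrt (var (saddle n) (parts_upto n)) \<le>
      3 * saddle n * cut (saddle n) / sqrt (c0 / 3 * ((saddle n)\<^sup>2 * saddle n powr g))"
    using ev good_saddle
  proof eventually_elim
    case (elim n)
    have "1 * saddle n \<le> (3 * cut (saddle n)) * saddle n"
      using elim(1) cut_ge_1[OF elim(1)] by (intro mult_right_mono) auto
    moreover have "sqrt (c0 / 3 * ((saddle n)\<^sup>2 * saddle n powr g)) \<le> sqrt (var (saddle n) (parts_upto n))"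
      using var_ge[OF elim(2,1)] by simp
    moreover have "0 < sqrt (c0 / 3 * ((saddle n)\<^sup>2 * saddle n powr g))"
      using elim(1) c0_pos by simp
    ultimately show ?case using elim(1) by (intro frac_le) auto
  qed
qed

text \<open>Since \<open>n\<close> is the mean of the untruncated sum, the difference is the mean of the parts larger
  than \<open>n \<ge> B * cut B\<close>, which is exponentially small in \<open>cut B\<close>.\<close>

lemma mean_error_negligible:
  "(\<lambda>n. (real n - mu (saddle n) (parts_upto n)) / sqrt (var (saddle n) (parts_upto n))) \<longlonglongrightarrow> 0"
proof -
  have ev: "\<forall>\<^sub>F n in sequentially. saddle n \<ge> 1"
    using filterlim_saddle by (simp add: filterlim_at_top)
  have "((\<lambda>B. 216 * exp (- (B powr (g / 8) / 4)) * (C * B ^ D)) \<longlongrightarrow> 0) at_top" for C :: real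
    using g_pos by real_asymp
  hence e: "((\<lambda>B. 216 * exp (- (cut B / 4)) * (tail_const * B ^ D)) \<longlongrightarrow> 0) at_top"
    unfolding cut_def by blast
  have "(\<lambda>n. 216 * exp (- (cut (saddle n) / 4)) * (tail_const * saddle n ^ D) * (saddle n / sqrt (var (saddle n) (parts_upto n)))) \<longlonglongrightarrow> 0 * 0"
    by (intro tendsto_mult filterlim_compose[OF e filterlim_saddle] scale_div_sd)
  hence lim: "(\<lambda>n. 216 * saddle n * exp (- (cut (saddle n) / 4)) * (tail_const * saddle n ^ D) / sqrt (var (saddle n) (parts_upto n))) \<longlonglongrightarrow> 0"
    by (simp add: mult_ac)
  show ?thesis
  proof (rule real_tendsto_sandwich[OF _ _ tendsto_const lim])
    show "\<forall>\<^sub>F n in sequentially. 0 \<le> (real n - mu (saddle n) (parts_upto n)) / sqrt (var (saddle n) (parts_upto n))"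
      using good_saddle ev eventually_ge_at_top[of 1]
    proof eventually_elim
      case (elim n)
      have "0 \<le> mean (saddle n) - mu (saddle n) (parts_upto n)"
        using elim(2) goodD[OF elim(1)] by (intro mean_minus_mu[where A = 0]) auto
      thus ?case using saddle(2)[OF elim(3)] var_pos[OF elim(1,2)] by simp
    qed
    show "\<forall>\<^sub>F n in sequentially. (real n - mu (saddle n) (parts_upto n)) / sqrt (var (saddle n) (parts_upto n))
       \<le> 216 * saddle n * exp (- (cut (saddle n) / 4)) * (tail_const * saddle n ^ D) / sqrt (var (saddle n) (parts_upto n))"
      using good_saddle ev eventually_ge_at_top[of 1]
    proof eventually_elim
      case (elim n)
      have "mean (saddle n) - mu (saddle n) (parts_upto n) \<le> 216 * saddle n * exp (- (cut (saddle n) / 4)) * (tail_const * saddle n ^ D)"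
      proof (rule mean_minus_mu(2))
        show "saddle n * cut (saddle n) \<le> real (a k)" if "k \<in> I - parts_upto n" for k
          using good_mem[OF elim(1), of k] that by force
      qed (use elim(2) goodD[OF elim(1)] in auto)
      thus ?case using saddle(2)[OF elim(3)] var_pos[OF elim(1,2)] by (intro divide_right_mono) auto
    qed
  qed
qed

definition norm_const :: "real \<Rightarrow> 'a set \<Rightarrow> real" where
  "norm_const B K = (\<Prod>k\<in>K. 1 - exp (- (real (a k) / B)))"

lemma norm_const_pos: "B > 0 \<Longrightarrow> K \<subseteq> I \<Longrightarrow> norm_const B K > 0"
  unfolding norm_const_def using one_minus_exp_pos by (intro prod_pos) auto

lemma integral_psi:
  assumes "B > 0" "finite K" "K \<subseteq> I"
  shows "integral {-pi..pi} (\<lambda>\<theta>. psi B K \<theta> * cis (- (real m * \<theta>))) =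
           of_real (norm_const B K * (2 * pi * real (num_parts a K m) * exp (- (real m / B))))"
proof -
  define q where "q = exp (- (1 / B))"
  have q: "0 < q" "q < 1" using assms by (auto simp: q_def)
  have qa: "q ^ j = exp (- (real j / B))" for j
    by (simp add: q_def flip: exp_of_nat_mult)
  have "psi B K \<theta> = of_real (norm_const B K) * genfun a q K \<theta>" for \<theta>
    unfolding psi_def genfun_def norm_const_def phi_def of_real_prod qa prod.distrib[symmetric]
    by (intro prod.cong) auto
  hence "integral {-pi..pi} (\<lambda>\<theta>. psi B K \<theta> * cis (- (real m * \<theta>))) =
      integral {-pi..pi} (\<lambda>\<theta>. of_real (norm_const B K) * (genfun a q K \<theta> * cis (- (of_int (int m) * \<theta>))))"
    by (simp add: mult.assoc)
  also have "\<dots> = of_real (norm_const B K) * integral {-pi..pi} (\<lambda>\<theta>. genfun a q K \<theta> * cis (- (of_int (int m) * \<theta>)))"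
    by (rule integral_mult_right)
  also have "integral {-pi..pi} (\<lambda>\<theta>. genfun a q K \<theta> * cis (- (of_int (int m) * \<theta>))) =
      of_real (2 * pi * real (num_parts a K m) * q ^ m)"
    using assms q a_pos by (subst integral_genfun) auto
  finally show ?thesis unfolding qa by simp
qed

text \<open>Up to the constant \<open>2 * pi\<close>, the probability of the value \<open>m\<close> under the tilted law of parameter
  \<open>saddle n\<close>, times the standard deviation.\<close>

definition density :: "nat \<Rightarrow> nat \<Rightarrow> real" where
  "density n m = sqrt (var (saddle n) (parts_upto n)) * (norm_const (saddle n) (parts_upto n) *
      (2 * pi * real (num_parts a I m) * exp (- (real m / saddle n))))"

lemma density_eq:
  assumes "n \<ge> 1" "m \<le> n"
  shows "of_real (sqrt (var (saddle n) (parts_upto n))) *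
      integral {-pi..pi} (\<lambda>\<theta>. psi (saddle n) (parts_upto n) \<theta> * cis (- (real m * \<theta>))) = complex_of_real (density n m)"
proof -
  have "num_parts a (parts_upto n) m = num_parts a I m"
    unfolding num_parts_def parts_upto_def using parts_restrict[OF assms(2)] by metis
  thus ?thesis using saddle(1)[OF assms(1)] finite_parts_upto
    by (subst integral_psi) (auto simp: density_def parts_upto_def)
qed

lemma mean_div_large: "filterlim (\<lambda>n. real n / saddle n) at_top sequentially"
proof (rule filterlim_at_top_mono)
  have "filterlim (\<lambda>B::real. c * B powr g) at_top at_top" if "c > 0" for c :: real
    using that g_pos by real_asymp
  from this[of "c0 / 3"] have "filterlim (\<lambda>B::real. c0 / 3 * B powr g) at_top at_top" using c0_pos by simp
  thus "filterlim (\<lambda>n. c0 / 3 * saddle n powr g) at_top sequentially"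
    using filterlim_saddle by (rule filterlim_compose)
  have ev: "\<forall>\<^sub>F n in sequentially. saddle n \<ge> 1"
    using filterlim_saddle by (simp add: filterlim_at_top)
  show "\<forall>\<^sub>F n in sequentially. c0 / 3 * saddle n powr g \<le> real n / saddle n"
    using ev eventually_ge_at_top[of 1]
  proof eventually_elim
    case (elim n)
    thus ?case using mean_ge[OF elim(1)] saddle(2)[OF elim(2)] by (simp add: field_simps)
  qed
qed

lemma shift_le: 
  assumes "(\<lambda>n. real (t n) / saddle n) \<longlonglongrightarrow> x"
  shows "\<forall>\<^sub>F n in sequentially. t n \<le> n"
proof -
  have "\<forall>\<^sub>F n in sequentially. real (t n) / saddle n < x + 1"
    using assms by (rule order_tendstoD) simp
  moreover have "\<forall>\<^sub>F n in sequentially. x + 1 \<le> real n / saddle n"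
    using mean_div_large by (simp add: filterlim_at_top)
  ultimately show ?thesis using eventually_ge_at_top[of 1]
  proof eventually_elim
    case (elim n)
    hence "real (t n) / saddle n < real n / saddle n" by linarith
    thus ?case using saddle(1)[OF elim(3)] by (simp add: divide_less_cancel)
  qed
qed

lemma density_limit:
  assumes t: "(\<lambda>n. real (t n) / saddle n) \<longlonglongrightarrow> x"
  shows "(\<lambda>n. density n (n - t n)) \<longlonglongrightarrow> sqrt (2 * pi)"
proof -
  let ?sd = "\<lambda>n. sqrt (var (saddle n) (parts_upto n))"
  have le: "\<forall>\<^sub>F n in sequentially. t n \<le> n" by (rule shift_le[OF t])
  have "(\<lambda>n. (real n - mu (saddle n) (parts_upto n)) / ?sd n - real (t n) / saddle n * (saddle n / ?sd n)) \<longlonglongrightarrow> 0 - x * 0"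
    by (intro tendsto_intros mean_error_negligible scale_div_sd t)
  hence "(\<lambda>n. (real n - mu (saddle n) (parts_upto n)) / ?sd n - real (t n) / saddle n * (saddle n / ?sd n)) \<longlonglongrightarrow> 0"
    by simp
  hence "(\<lambda>n. (real (n - t n) - mu (saddle n) (parts_upto n)) / ?sd n) \<longlonglongrightarrow> 0"
  proof (rule Lim_transform_eventually)
    show "\<forall>\<^sub>F n in sequentially. (real n - mu (saddle n) (parts_upto n)) / ?sd n - real (t n) / saddle n * (saddle n / ?sd n) =
       (real (n - t n) - mu (saddle n) (parts_upto n)) / ?sd n"
      using le eventually_ge_at_top[of 1]
    proof eventually_elim
      case (elim n)
      have "real (t n) / saddle n * (saddle n / ?sd n) = real (t n) / ?sd n"
        using saddle(1)[OF elim(2)] by simp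
      thus ?case using elim(1) by (simp add: of_nat_diff diff_divide_distrib)
    qed
  qed
  hence "(\<lambda>n. of_real (?sd n) * integral {-pi..pi} (\<lambda>\<theta>. psi (saddle n) (parts_upto n) \<theta> * cis (- (real (n - t n) * \<theta>))))
     \<longlonglongrightarrow> complex_of_real (sqrt (2 * pi))"
    by (intro fourier_limit filterlim_saddle good_saddle)
  hence "(\<lambda>n. complex_of_real (density n (n - t n))) \<longlonglongrightarrow> complex_of_real (sqrt (2 * pi))"
  proof (rule Lim_transform_eventually)
    show "\<forall>\<^sub>F n in sequentially. of_real (?sd n) * integral {-pi..pi} (\<lambda>\<theta>. psi (saddle n) (parts_upto n) \<theta> * cis (- (real (n - t n) * \<theta>))) = complex_of_real (density n (n - t n))"
      using eventually_ge_at_top[of 1] by eventually_elim (rule density_eq, auto)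
  qed
  thus ?thesis by (simp only: tendsto_of_real_iff)
qed

lemma density_self_ge: "\<forall>\<^sub>F n in sequentially. density n n \<ge> 1"
proof -
  have "(\<lambda>n. density n (n - 0)) \<longlonglongrightarrow> sqrt (2 * pi)" by (rule density_limit[where x = 0]) simp
  moreover have "sqrt (2 * pi) > 1" using pi_gt3 by simp
  ultimately have "\<forall>\<^sub>F n in sequentially. density n (n - 0) > 1" by (rule order_tendstoD)
  thus ?thesis by eventually_elim simp
qed

lemma num_parts_pos: "\<forall>\<^sub>F n in sequentially. num_parts a I n > 0"
  using density_self_ge
proof eventually_elim
  case (elim n)
  thus ?case by (cases "num_parts a I n = 0") (auto simp: density_def)
qed

lemma ratio_density:
  assumes "n \<ge> 1" "t \<le> n" "density n n \<ge> 1"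
  shows "real (num_parts a I (n - t)) / real (num_parts a I n) = density n (n - t) / density n n * exp (- (real t / saddle n))"
proof -
  have s: "saddle n > 0" by (rule saddle(1)[OF assms(1)])
  define c where "c = sqrt (var (saddle n) (parts_upto n)) * norm_const (saddle n) (parts_upto n) * (2 * pi)"
  have d: "density n m = c * (real (num_parts a I m) * exp (- (real m / saddle n)))" for m
    by (simp add: density_def c_def)
  have "density n n \<noteq> 0" using assms(3) by linarith
  hence c: "c \<noteq> 0" "real (num_parts a I n) \<noteq> 0" unfolding d by auto
  have "exp (- (real n / saddle n)) = exp (- (real (n - t) / saddle n)) * exp (- (real t / saddle n))"
    using assms(2) s by (simp add: of_nat_diff field_simps flip: exp_add)
  thus ?thesis using c unfolding d by simp
qed

text \<open>A shift \<open>t = O(B)\<close> is of smaller order than the standard deviation, so the tilted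
  probabilities of \<open>n - t\<close> and \<open>n\<close> are asymptotically equal. What remains of the ratio is the
  quotient of the tilting factors.\<close>

theorem num_parts_ratio_limit:
  assumes t: "(\<lambda>n. real (t n) / saddle n) \<longlonglongrightarrow> x"
  shows "(\<lambda>n. real (num_parts a I (n - t n)) / real (num_parts a I n)) \<longlonglongrightarrow> exp (- x)"
proof -
  have "(\<lambda>n. density n (n - t n) / density n (n - 0) * exp (- (real (t n) / saddle n))) \<longlonglongrightarrow> sqrt (2 * pi) / sqrt (2 * pi) * exp (- x)"
    by (intro tendsto_intros density_limit[OF t] density_limit[where x = 0] t) auto
  hence "(\<lambda>n. density n (n - t n) / density n n * exp (- (real (t n) / saddle n))) \<longlonglongrightarrow> exp (- x)" by simp
  thus ?thesis
  proof (rule Lim_transform_eventually)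
    show "\<forall>\<^sub>F n in sequentially. density n (n - t n) / density n n * exp (- (real (t n) / saddle n)) =
       real (num_parts a I (n - t n)) / real (num_parts a I n)"
      using shift_le[OF t] density_self_ge eventually_ge_at_top[of 1]
      by eventually_elim (rule ratio_density[symmetric], auto)
  qed
qed

text \<open>Fourier coefficients are bounded by the integral of \<open>norm psi\<close>, uniformly in \<open>t\<close>, while the
  coefficient at \<open>n\<close> attains this order.\<close>

theorem num_parts_ratio_bound:
  "\<exists>C. \<forall>\<^sub>F n in sequentially. \<forall>t\<le>n.
     real (num_parts a I (n - t)) / real (num_parts a I n) \<le> C * exp (- (real t / saddle n))"
proof -
  obtain C where C: "\<forall>\<^sub>F B in at_top. \<forall>K m. good B K \<longrightarrow>
     sqrt (var B K) * norm (integral {-pi..pi} (\<lambda>\<theta>. psi B K \<theta> * cis (- (m * \<theta>)))) \<le> C"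
    using fourier_bounded by blast
  have "\<forall>\<^sub>F n in sequentially. \<forall>t\<le>n.
     real (num_parts a I (n - t)) / real (num_parts a I n) \<le> C * exp (- (real t / saddle n))"
    using eventually_compose_filterlim[OF C filterlim_saddle] good_saddle density_self_ge eventually_ge_at_top[of 1]
  proof eventually_elim
    case (elim n)
    show ?case
    proof (intro allI impI)
      fix t assume t: "t \<le> n"
      have v: "0 \<le> var (saddle n) (parts_upto n)"
        unfolding var_def using saddle(1)[OF elim(4)]
        by (intro sum_nonneg less_imp_le mom_pos) (auto simp: parts_upto_def)
      have "density n (n - t) \<le> norm (complex_of_real (density n (n - t)))" by simp
      also have "\<dots> = sqrt (var (saddle n) (parts_upto n)) *
          norm (integral {-pi..pi} (\<lambda>\<theta>. psi (saddle n) (parts_upto n) \<theta> * cis (- (real (n - t) * \<theta>))))"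
        unfolding density_eq[OF elim(4) diff_le_self, symmetric] norm_mult norm_of_real
        using v by simp
      also have "\<dots> \<le> C" using elim(1,2) by blast
      finally have d: "density n (n - t) \<le> C" .
      have "0 \<le> density n (n - t)"
        unfolding density_def using norm_const_pos[OF saddle(1)[OF elim(4)], of "parts_upto n"]
        using v by (intro mult_nonneg_nonneg) (auto simp: parts_upto_def)
      hence "density n (n - t) / density n n \<le> density n (n - t) / 1"
        using elim(3) by (intro divide_left_mono) auto
      also have "\<dots> \<le> C" using d by simp
      finally show "real (num_parts a I (n - t)) / real (num_parts a I n) \<le> C * exp (- (real t / saddle n))"
        unfolding ratio_density[OF elim(4) t elim(3)] by (intro mult_right_mono) auto
    qed
  qed
  thus ?thesis by blast
qed

end

section \<open>Integrality of Weyl's dimension formula\<close>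

text \<open>Induction on the degree by passing to the difference polynomial \<open>f (x + 1) - f x\<close>.\<close>

lemma dvd_poly_values:
  fixes f :: "int poly"
  assumes "degree f \<le> d" "\<And>i. i \<le> d \<Longrightarrow> c dvd poly f (int i)"
  shows "c dvd poly f (int n)"
  using assms
proof (induction d arbitrary: f n)
  case 0
  then obtain b where "f = [:b:]" by (auto elim: degree_eq_zeroE)
  thus ?case using 0(2)[of 0] by simp
next
  case (Suc d)
  define h where "h = pcompose f [:1, 1:] - f"
  have h: "poly h x = poly f (1 + x) - poly f x" for x
    by (simp add: h_def poly_pcompose)
  have "degree h \<le> d"
  proof (rule degree_le, intro allI impI)
    fix i assume i: "d < i"
    have d1: "degree (pcompose f [:1, 1:]) = degree f" by (simp add: degree_pcompose)
    show "coeff h i = 0"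
    proof (cases "i = degree f")
      case True
      have "coeff (pcompose f [:1, 1:]) (degree f) = lead_coeff f"
        using lead_coeff_comp[of "[:1, 1:]" f] d1 by simp
      thus ?thesis using True by (simp add: h_def)
    next
      case False
      hence "i > degree f" using i Suc.prems(1) by linarith
      thus ?thesis using d1 by (simp add: h_def coeff_eq_0)
    qed
  qed
  moreover have "c dvd poly h (int i)" if "i \<le> d" for i
    using Suc.prems(2)[of i] Suc.prems(2)[of "Suc i"] that by (simp add: h)
  ultimately have dvd_h: "c dvd poly h (int n)" for n by (rule Suc.IH)
  show ?case
  proof (induction n)
    case 0
    thus ?case using Suc.prems(2)[of 0] by simp
  next
    case (Suc n)
    have "poly f (int (Suc n)) = poly h (int n) + poly f (int n)" by (simp add: h)
    thus ?case using dvd_h[of n] Suc.IH by (metis dvd_add)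
  qed
qed

definition vpairs :: "nat \<Rightarrow> (nat \<times> nat) set" where
  "vpairs r = (SIGMA j:{..r}. {..<j})"

text \<open>The Vandermonde product of \<open>x 0, \<dots>, x r\<close>.\<close>

definition vdm :: "nat \<Rightarrow> (nat \<Rightarrow> nat) \<Rightarrow> int" where
  "vdm r x = (\<Prod>(j, i)\<in>vpairs r. int (x j) - int (x i))"

lemma finite_vpairs: "finite (vpairs r)" by (simp add: vpairs_def)

lemma prod_vpairs_diff: "(\<Prod>(j, i)\<in>vpairs r. int j - int i) = (\<Prod>j\<le>r. fact j)"
proof -
  have row: "(\<Prod>i<j. int j - int i) = fact j" for j
  proof -
    have "(\<Prod>i<j. int j - int i) = (\<Prod>i\<in>{1..j}. int i)"
      by (rule prod.reindex_bij_witness[of _ "\<lambda>i. j - i" "\<lambda>i. j - i"]) (auto simp: of_nat_diff)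
    thus ?thesis by (simp add: fact_prod)
  qed
  have "(\<Prod>(j, i)\<in>vpairs r. int j - int i) = (\<Prod>j\<le>r. \<Prod>i<j. int j - int i)"
    unfolding vpairs_def by (subst prod.Sigma) auto
  thus ?thesis unfolding row .
qed

text \<open>Either two of the values coincide, or \<open>x\<close> permutes \<open>{..r}\<close> and so permutes the differences up
  to sign.\<close>

lemma vdm_small:
  assumes "\<And>j. j \<le> r \<Longrightarrow> x j \<le> r"
  shows "(\<Prod>j\<le>r. fact j) dvd vdm r x"
proof (cases "inj_on x {..r}")
  case False
  then obtain i j where ij: "i < j" "j \<le> r" "x i = x j"
    by (force simp: inj_on_def elim: linorder_neqE_nat)
  hence "(j, i) \<in> vpairs r" by (simp add: vpairs_def)
  hence "vdm r x = 0" unfolding vdm_def using ij finite_vpairs by (intro prod_zero) force+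
  thus ?thesis by simp
next
  case True
  define f where "f = (\<lambda>(j, i). (max (x j) (x i), min (x j) (x i)))"
  have "f ` vpairs r \<subseteq> vpairs r"
  proof
    fix p assume "p \<in> f ` vpairs r"
    then obtain j i where p: "p = f (j, i)" "i < j" "j \<le> r" by (auto simp: vpairs_def)
    have "x j \<noteq> x i" using inj_on_eq_iff[OF True, of j i] p by simp
    thus "p \<in> vpairs r" using p assms[of i] assms[of j] by (auto simp: vpairs_def f_def max_def min_def)
  qed
  moreover have "inj_on f (vpairs r)"
  proof (rule inj_onI)
    fix p p' assume A: "p \<in> vpairs r" "p' \<in> vpairs r" "f p = f p'"
    obtain j i j' i' where p: "p = (j, i)" "p' = (j', i')" by (metis surj_pair)
    have le: "i < j" "j \<le> r" "i' < j'" "j' \<le> r" using A p by (auto simp: vpairs_def)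
    have "x j = x j' \<and> x i = x i' \<or> x j = x i' \<and> x i = x j'"
      using A(3) p by (auto simp: f_def max_def min_def split: if_splits)
    hence "j = j' \<and> i = i' \<or> j = i' \<and> i = j'"
      using le inj_on_eq_iff[OF True, of j j'] inj_on_eq_iff[OF True, of i i']
        inj_on_eq_iff[OF True, of j i'] inj_on_eq_iff[OF True, of i j'] by simp
    thus "p = p'" using le p by auto
  qed
  ultimately have bij: "bij_betw f (vpairs r) (vpairs r)"
    using endo_inj_surj[OF finite_vpairs] by (auto simp: bij_betw_def)
  have "\<bar>vdm r x\<bar> = (\<Prod>(j, i)\<in>vpairs r. \<bar>int (x j) - int (x i)\<bar>)"
    unfolding vdm_def abs_prod by (intro prod.cong) auto
  also have "\<dots> = (\<Prod>p\<in>vpairs r. case f p of (j, i) \<Rightarrow> int j - int i)"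
    by (intro prod.cong) (auto simp: f_def max_def min_def)
  also have "\<dots> = (\<Prod>(j, i)\<in>vpairs r. int j - int i)"
    by (rule prod.reindex_bij_betw[OF bij])
  also have "\<dots> = (\<Prod>j\<le>r. fact j)" by (rule prod_vpairs_diff)
  finally show ?thesis by (metis dvd_abs_iff dvd_refl)
qed

lemma card_vpairs_incident:
  assumes "s \<le> r"
  shows "card {p \<in> vpairs r. fst p = s \<or> snd p = s} \<le> r"
proof -
  have "{p \<in> vpairs r. fst p = s \<or> snd p = s} \<subseteq> (\<lambda>i. (max i s, min i s)) ` ({..r} - {s})"
  proof
    fix p assume p: "p \<in> {p \<in> vpairs r. fst p = s \<or> snd p = s}"
    then obtain j i where "p = (j, i)" "i < j" "j \<le> r" by (auto simp: vpairs_def)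
    thus "p \<in> (\<lambda>i. (max i s, min i s)) ` ({..r} - {s})"
      using p by (auto intro!: image_eqI[where x = "if j = s then i else j"] simp: max_def min_def)
  qed
  hence "card {p \<in> vpairs r. fst p = s \<or> snd p = s} \<le> card ((\<lambda>i. (max i s, min i s)) ` ({..r} - {s}))"
    by (intro card_mono) auto
  also have "\<dots> \<le> card ({..r} - {s})" by (intro card_image_le) auto
  also have "\<dots> = r" using assms by simp
  finally show ?thesis .
qed

text \<open>The Vandermonde product has degree at most \<open>r\<close> in each variable, so divisibility spreads
  from \<open>{..r}\<close> to all values of a variable, one variable at a time; on \<open>{..r}\<close> itself
  it vanishes or is, up to sign, the product of factorials.\<close>

lemma superfactorial_dvd_vdm: "(\<Prod>j\<le>r. fact j) dvd vdm r x"
proof -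
  have "(\<Prod>j\<le>r. fact j) dvd vdm r x" if "\<And>j. s \<le> j \<Longrightarrow> j \<le> r \<Longrightarrow> x j \<le> r" "s \<le> Suc r" for s x
    using that
  proof (induction s arbitrary: x)
    case 0
    thus ?case by (intro vdm_small) auto
  next
    case (Suc s)
    define lin :: "nat \<Rightarrow> int poly" where "lin = (\<lambda>j. if j = s then [:0, 1:] else [:int (x j):])"
    define F where "F = (\<Prod>(j, i)\<in>vpairs r. lin j - lin i)"
    have val: "poly F (int n) = vdm r (x(s := n))" for n
      unfolding F_def vdm_def poly_prod by (intro prod.cong) (auto simp: lin_def)
    have "degree F \<le> (\<Sum>p\<in>vpairs r. degree (case p of (j, i) \<Rightarrow> lin j - lin i))"
      unfolding F_def using degree_prod_sum_le[OF finite_vpairs] by (simp add: o_def)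
    also have "\<dots> \<le> (\<Sum>p\<in>vpairs r. if fst p = s \<or> snd p = s then 1 else 0)"
      by (intro sum_mono) (auto simp: lin_def split: prod.splits intro!: degree_diff_le)
    also have "\<dots> = card {p \<in> vpairs r. fst p = s \<or> snd p = s}"
      using finite_vpairs by (simp add: sum.If_cases Int_def)
    also have "\<dots> \<le> r" using Suc.prems(2) by (intro card_vpairs_incident) auto
    finally have deg: "degree F \<le> r" .
    have "(\<Prod>j\<le>r. fact j) dvd poly F (int n)" if "n \<le> r" for n
      unfolding val
    proof (rule Suc.IH)
      fix j assume "s \<le> j" "j \<le> r"
      thus "(x(s := n)) j \<le> r" using that Suc.prems(1)[of j] by (cases "j = s") auto
    qed (use Suc.prems(2) in auto)
    hence "(\<Prod>j\<le>r. fact j) dvd poly F (int (x s))" by (rule dvd_poly_values[OF deg])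
    thus ?case by (simp add: val)
  qed
  from this[of "Suc r" x] show ?thesis by auto
qed

section \<open>The dimensions of the irreducible representations\<close>

definition wdim :: "nat \<Rightarrow> (nat \<Rightarrow> nat) \<Rightarrow> nat" where
  "wdim r k = nat \<lfloor>weyl_dim r (\<lambda>i. real (k i))\<rfloor>"

lemma weyl_numerator_ge:
  assumes "k \<in> pos_vecs r"
  shows "(\<Prod>j=1..r. real (k j)) \<le> (\<Prod>j=1..r. \<Prod>l=1..j. \<Sum>i=l..j. real (k i))"
proof (intro prod_mono conjI)
  fix j assume j: "j \<in> {1..r}"
  have k1: "1 \<le> k i" if "i \<in> {1..r}" for i using assms that by (auto simp: pos_vecs_def)
  have "(\<Prod>l=1..j. \<Sum>i=l..j. real (k i)) = real (k j) * (\<Prod>l\<in>{1..j} - {j}. \<Sum>i=l..j. real (k i))"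
    using j by (subst prod.remove[of _ j]) auto
  moreover have "1 \<le> (\<Prod>l\<in>{1..j} - {j}. \<Sum>i=l..j. real (k i))"
  proof (rule prod_ge_1)
    fix l assume l: "l \<in> {1..j} - {j}"
    have "1 \<le> real (k j)" using k1[OF j] by simp
    also have "\<dots> \<le> (\<Sum>i=l..j. real (k i))" using l by (intro member_le_sum) auto
    finally show "1 \<le> (\<Sum>i=l..j. real (k i))" .
  qed
  hence "real (k j) * 1 \<le> real (k j) * (\<Prod>l\<in>{1..j} - {j}. \<Sum>i=l..j. real (k i))"
    by (intro mult_left_mono) auto
  ultimately show "real (k j) \<le> (\<Prod>l=1..j. \<Sum>i=l..j. real (k i))" by simp
qed auto

lemma weyl_dim_ge:
  assumes "k \<in> pos_vecs r"
  shows "(\<Prod>j=1..r. real (k j)) / (\<Prod>i=1..r. fact i) \<le> weyl_dim r (\<lambda>i. real (k i))"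
  unfolding weyl_dim_def using weyl_numerator_ge[OF assms]
  by (intro divide_right_mono prod_nonneg) auto

lemma weyl_dim_pos:
  assumes "k \<in> pos_vecs r"
  shows "0 < weyl_dim r (\<lambda>i. real (k i))"
proof (rule less_le_trans[OF _ weyl_dim_ge[OF assms]])
  show "0 < (\<Prod>j=1..r. real (k j)) / (\<Prod>i=1..r. fact i)"
    using assms by (intro divide_pos_pos prod_pos) (auto simp: pos_vecs_def PiE_iff Suc_le_eq)
qed

text \<open>The factors of the numerator are the differences of the partial sums of \<open>k\<close>, so it is a
  Vandermonde product.\<close>

lemma weyl_dim_eq:
  assumes "k \<in> pos_vecs r"
  shows "weyl_dim r (\<lambda>i. real (k i)) = real (wdim r k)"
proof -
  define x where "x = (\<lambda>j. \<Sum>i=1..j. k i)"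
  have diff: "(\<Sum>i=l..j. real (k i)) = of_int (int (x j) - int (x (l - 1)))" if "1 \<le> l" "l \<le> j" for l j
  proof -
    have "{1..j} = {1..l - 1} \<union> {l..j}" using that by auto
    hence "x j = x (l - 1) + (\<Sum>i=l..j. k i)"
      unfolding x_def by (simp add: sum.union_disjoint)
    thus ?thesis by simp
  qed
  have "(\<Prod>j=1..r. \<Prod>l=1..j. \<Sum>i=l..j. real (k i)) = (\<Prod>j=1..r. \<Prod>i<j. of_int (int (x j) - int (x i)))"
  proof (rule prod.cong[OF refl])
    fix j assume "j \<in> {1..r}"
    have "(\<Prod>l=1..j. \<Sum>i=l..j. real (k i)) = (\<Prod>l=1..j. of_int (int (x j) - int (x (l - 1))))"
      by (intro prod.cong refl diff) auto
    also have "\<dots> = (\<Prod>i<j. of_int (int (x j) - int (x i)))"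
      by (rule prod.reindex_bij_witness[of _ Suc "\<lambda>l. l - 1"]) auto
    finally show "(\<Prod>l=1..j. \<Sum>i=l..j. real (k i)) = (\<Prod>i<j. of_int (int (x j) - int (x i)))" .
  qed
  also have "\<dots> = (\<Prod>j\<le>r. \<Prod>i<j. of_int (int (x j) - int (x i)))"
    by (intro prod.mono_neutral_left) (auto simp: not_le)
  also have "\<dots> = of_int (vdm r x)"
    unfolding vdm_def vpairs_def by (subst prod.Sigma[symmetric]) auto
  finally have num: "(\<Prod>j=1..r. \<Prod>l=1..j. \<Sum>i=l..j. real (k i)) = of_int (vdm r x)" .
  have "(\<Prod>i=1..r. fact i :: real) = (\<Prod>i\<le>r. fact i)"
    by (intro prod.mono_neutral_left) (auto simp: not_le)
  also have "\<dots> = of_int (\<Prod>i\<le>r. fact i)" by simp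
  finally have den: "(\<Prod>i=1..r. fact i :: real) = of_int (\<Prod>i\<le>r. fact i)" .
  obtain q where q: "vdm r x = (\<Prod>i\<le>r. fact i) * q" using superfactorial_dvd_vdm[of r x] by (auto elim: dvdE)
  have nz: "(\<Prod>i\<le>r. fact i :: int) \<noteq> 0" by simp
  have eq: "weyl_dim r (\<lambda>i. real (k i)) = of_int q"
    unfolding weyl_dim_def num den q using nz by (simp del: of_int_prod)
  with weyl_dim_pos[OF assms] have "q > 0" by simp
  thus ?thesis unfolding wdim_def eq by simp
qed

lemma wdim_pos: "k \<in> pos_vecs r \<Longrightarrow> wdim r k \<ge> 1"
  using weyl_dim_pos[of k r] weyl_dim_eq[of k r] by simp

lemma weyl_dim_scale: 
  assumes "s > 0"
  shows "weyl_dim r (\<lambda>i. s * y i) = s powr (real (r * (r + 1)) / 2) * weyl_dim r y"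
proof -
  have "(\<Prod>j=1..r. \<Prod>l=1..j. \<Sum>i=l..j. s * y i) = (\<Prod>j=1..r. s ^ j * (\<Prod>l=1..j. \<Sum>i=l..j. y i))"
    by (simp add: sum_distrib_left[symmetric] prod.distrib)
  also have "\<dots> = s ^ (\<Sum>j=1..r. j) * (\<Prod>j=1..r. \<Prod>l=1..j. \<Sum>i=l..j. y i)"
    by (simp add: prod.distrib power_sum)
  also have "(\<Sum>j=1..r. j) = r * (r + 1) div 2" using Sum_Icc_nat[of 1 r] by simp
  also have "s ^ (r * (r + 1) div 2) = s powr (real (r * (r + 1)) / 2)"
    using assms by (subst powr_realpow[symmetric]) (simp_all add: real_of_nat_div)
  finally show ?thesis by (simp add: weyl_dim_def)
qed

text \<open>The vectors \<open>(t, 1, \<dots>, 1)\<close>.\<close>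

definition line_vec :: "nat \<Rightarrow> nat \<Rightarrow> nat \<Rightarrow> nat" where
  "line_vec r t = (\<lambda>i\<in>{1..r}. if i = 1 then t else 1)"

lemma line_vec_in: "t \<ge> 1 \<Longrightarrow> line_vec r t \<in> pos_vecs r"
  by (auto simp: line_vec_def pos_vecs_def)

lemma inj_line_vec:
  assumes "r \<ge> 1"
  shows "inj (line_vec r)"
proof (rule injI)
  fix t t' assume "line_vec r t = line_vec r t'"
  hence "line_vec r t 1 = line_vec r t' 1" by simp
  thus "t = t'" using assms by (simp add: line_vec_def)
qed

lemma weyl_dim_line:
  assumes "r \<ge> 1" "t \<ge> 1"
  shows "weyl_dim r (\<lambda>i. real (if i = 1 then t else 1)) = real ((t + r - 1) choose r)"
  using assms(1)
proof (induction r rule: nat_induct_at_least)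
  case base
  thus ?case by (simp add: weyl_dim_def)
next
  case (Suc r)
  define y :: "nat \<Rightarrow> real" where "y = (\<lambda>i. real (if i = 1 then t else 1))"
  have "(\<Prod>l=1..Suc r. \<Sum>i=l..Suc r. y i) = (\<Sum>i=1..Suc r. y i) * (\<Prod>l=2..Suc r. \<Sum>i=l..Suc r. y i)"
    by (subst prod.atLeast_Suc_atMost) (auto simp: numeral_2_eq_2)
  also have "(\<Sum>i=1..Suc r. y i) = real (t + r)"
    by (subst sum.atLeast_Suc_atMost) (auto simp: y_def)
  also have "(\<Prod>l=2..Suc r. \<Sum>i=l..Suc r. y i) = (\<Prod>l=2..Suc r. real (Suc r + 1 - l))"
    by (intro prod.cong refl) (auto simp: y_def)
  also have "\<dots> = (\<Prod>i=1..r. real i)"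
    by (rule prod.reindex_bij_witness[of _ "\<lambda>i. Suc r + 1 - i" "\<lambda>l. Suc r + 1 - l"]) auto
  also have "\<dots> = fact r" by (simp add: fact_prod)
  finally have row: "(\<Prod>l=1..Suc r. \<Sum>i=l..Suc r. y i) = real (t + r) * fact r" .
  have "weyl_dim (Suc r) y = weyl_dim r y * ((\<Prod>l=1..Suc r. \<Sum>i=l..Suc r. y i) / fact (Suc r))"
  proof -
    have last: "prod h {1..Suc r} = h (Suc r) * prod h {1..r}" for h :: "nat \<Rightarrow> real"
      by (simp add: prod.nat_ivl_Suc')
    have "F * P / (f * Q) = P / Q * (F / f)" for F P f Q :: real by (simp add: mult.commute)
    thus ?thesis unfolding weyl_dim_def
      last[of "\<lambda>j. \<Prod>l=1..j. \<Sum>i=l..j. y i"] last[of fact] .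
  qed
  also have "(\<Prod>l=1..Suc r. \<Sum>i=l..Suc r. y i) / fact (Suc r) = real (t + r) / real (Suc r)"
    unfolding row by simp
  also have "weyl_dim r y = real ((t + r - 1) choose r)" using Suc.IH by (simp add: y_def)
  also have "real ((t + r - 1) choose r) * (real (t + r) / real (Suc r)) = real ((t + r) choose Suc r)"
  proof -
    have "Suc r * (Suc (t + r - 1) choose Suc r) = Suc (t + r - 1) * ((t + r - 1) choose r)"
      by (rule Suc_times_binomial)
    moreover have "Suc (t + r - 1) = t + r" using assms(2) by simp
    ultimately have "real (Suc r) * real ((t + r) choose Suc r) = real (t + r) * real ((t + r - 1) choose r)"
      by (metis of_nat_mult)
    thus ?thesis by (simp add: field_simps del: of_nat_Suc binomial_Suc_Suc)
  qed
  finally show ?case by (simp add: y_def)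
qed

lemma wdim_line:
  assumes "r \<ge> 1" "t \<ge> 1"
  shows "wdim r (line_vec r t) = (t + r - 1) choose r"
proof -
  have "weyl_dim r (\<lambda>i. real (line_vec r t i)) = weyl_dim r (\<lambda>i. real (if i = 1 then t else 1))"
    unfolding weyl_dim_def by (intro arg_cong2[where f = "(/)"] refl prod.cong sum.cong) (auto simp: line_vec_def)
  thus ?thesis
    using weyl_dim_line[OF assms] weyl_dim_eq[OF line_vec_in[OF assms(2)], of r] by simp
qed

lemma binomial_line_le: "t \<ge> 1 \<Longrightarrow> (t + r - 1) choose r \<le> t ^ r"
proof (induction r)
  case (Suc r)
  have "Suc r * (Suc (t + r - 1) choose Suc r) = Suc (t + r - 1) * ((t + r - 1) choose r)"
    by (rule Suc_times_binomial)
  also have "\<dots> \<le> (Suc r * t) * t ^ r"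
  proof (rule mult_mono)
    have "r * 1 \<le> r * t" using Suc.prems by (intro mult_left_mono) auto
    thus "Suc (t + r - 1) \<le> Suc r * t" using Suc.prems by simp
  qed (use Suc in auto)
  also have "\<dots> = Suc r * t ^ Suc r" by (simp add: algebra_simps)
  finally have "Suc (t + r - 1) choose Suc r \<le> t ^ Suc r" by (simp only: Suc_mult_le_cancel1)
  moreover have "Suc (t + r - 1) = t + Suc r - 1" using Suc.prems by simp
  ultimately show ?case by (simp only:)
qed simp

lemma finite_wdim_le: "finite {k \<in> pos_vecs r. real (wdim r k) \<le> x}"
proof (rule finite_subset)
  define N where "N = nat \<lceil>x * (\<Prod>i=1..r. fact i)\<rceil>"
  show "{k \<in> pos_vecs r. real (wdim r k) \<le> x} \<subseteq> {1..r} \<rightarrow>\<^sub>E {..N}"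
  proof (clarify, rule PiE_I)
    fix k i assume k: "k \<in> pos_vecs r" "real (wdim r k) \<le> x" and i: "i \<in> {1..r}"
    have k1: "1 \<le> k i" if "i \<in> {1..r}" for i using k that by (auto simp: pos_vecs_def)
    have "real (k i) \<le> real (k i) * (\<Prod>j\<in>{1..r} - {i}. real (k j))"
      using prod_ge_1[of "{1..r} - {i}" "\<lambda>j. real (k j)"] k1 mult_left_mono[of 1 _ "real (k i)"] by simp
    also have "\<dots> = (\<Prod>j=1..r. real (k j))" using i by (subst prod.remove[of _ i]) auto
    also have "\<dots> \<le> weyl_dim r (\<lambda>i. real (k i)) * (\<Prod>i=1..r. fact i)"
      using weyl_dim_ge[OF k(1)] by (simp add: pos_divide_le_eq prod_pos)
    also have "\<dots> \<le> x * (\<Prod>i=1..r. fact i)"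
      using k weyl_dim_eq[OF k(1)] by (intro mult_right_mono prod_nonneg) auto
    finally show "k i \<in> {..N}" unfolding N_def by (simp add: le_nat_iff le_ceiling_iff)
  next
    fix k i assume "k \<in> pos_vecs r" "i \<notin> {1..r}"
    thus "k i = undefined" by (auto simp: pos_vecs_def PiE_def extensional_def)
  qed
qed (auto intro: finite_PiE)

text \<open>The dimension is at least a constant times the product of the components of \<open>k\<close>, so the sum is
  dominated by a product of \<open>r\<close> convergent series.\<close>

lemma summable_wdim: "(\<lambda>k. 1 / real (wdim r k) ^ 2) summable_on pos_vecs r"
proof (rule nonneg_bdd_above_summable_on)
  define c where "c = (\<Prod>i=1..r. fact i :: real)"
  have c: "c > 0" unfolding c_def by (intro prod_pos) auto
  define z where "z = (\<Sum>j. 1 / real (Suc j) ^ 2)"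
  have sm: "summable (\<lambda>j. 1 / real (Suc j) ^ 2)"
    using inverse_power_summable[of 2, where 'a = real] by (subst summable_Suc_iff) (simp add: inverse_eq_divide)
  show "bdd_above (sum (\<lambda>k. 1 / real (wdim r k) ^ 2) ` {F. F \<subseteq> pos_vecs r \<and> finite F})"
  proof (rule bdd_aboveI2)
    fix F assume F: "F \<in> {F. F \<subseteq> pos_vecs r \<and> finite F}"
    define N where "N = (\<Sum>k\<in>F. \<Sum>i=1..r. k i)"
    have sub: "F \<subseteq> {1..r} \<rightarrow>\<^sub>E {1..N}"
    proof
      fix k assume k: "k \<in> F"
      have "k i \<le> N" if "i \<in> {1..r}" for i
      proof -
        have "k i \<le> (\<Sum>i=1..r. k i)" using that by (intro member_le_sum) auto
        also have "\<dots> \<le> N" unfolding N_def using k F by (intro member_le_sum[of k F "\<lambda>k. \<Sum>i=1..r. k i"]) auto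
        finally show ?thesis .
      qed
      thus "k \<in> {1..r} \<rightarrow>\<^sub>E {1..N}" using k F by (auto simp: pos_vecs_def PiE_iff subset_iff)
    qed
    have "(\<Sum>k\<in>F. 1 / real (wdim r k) ^ 2) \<le> (\<Sum>k\<in>F. c ^ 2 * (\<Prod>i\<in>{1..r}. 1 / real (k i) ^ 2))"
    proof (intro sum_mono)
      fix k assume "k \<in> F"
      hence k: "k \<in> pos_vecs r" using F by auto
      define P where "P = (\<Prod>j=1..r. real (k j))"
      have P: "P > 0" unfolding P_def using k by (intro prod_pos) (auto simp: pos_vecs_def PiE_iff Suc_le_eq)
      have "P / c \<le> real (wdim r k)" using weyl_dim_ge[OF k] weyl_dim_eq[OF k] by (simp add: P_def c_def)
      hence "(P / c) ^ 2 \<le> real (wdim r k) ^ 2" using P c by (intro power_mono) auto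
      hence "1 / real (wdim r k) ^ 2 \<le> 1 / (P / c) ^ 2" using P c by (intro frac_le) auto
      also have "\<dots> = c ^ 2 * (1 / P ^ 2)" using P c by (simp add: power_divide)
      also have "1 / P ^ 2 = (\<Prod>i\<in>{1..r}. 1 / real (k i) ^ 2)"
        by (simp add: P_def prod_dividef flip: prod_power_distrib)
      finally show "1 / real (wdim r k) ^ 2 \<le> c ^ 2 * (\<Prod>i\<in>{1..r}. 1 / real (k i) ^ 2)" .
    qed
    also have "\<dots> \<le> (\<Sum>k\<in>{1..r} \<rightarrow>\<^sub>E {1..N}. c ^ 2 * (\<Prod>i\<in>{1..r}. 1 / real (k i) ^ 2))"
      using sub by (intro sum_mono2) (auto intro!: finite_PiE mult_nonneg_nonneg prod_nonneg)
    also have "\<dots> = c ^ 2 * (\<Prod>i\<in>{1..r}. \<Sum>j\<in>{1..N}. 1 / real j ^ 2)"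
      by (subst prod_sum_PiE) (auto simp: sum_distrib_left)
    also have "\<dots> \<le> c ^ 2 * (\<Prod>i\<in>{1..r}. z)"
    proof (intro mult_left_mono prod_mono conjI sum_nonneg)
      have "(\<Sum>j\<in>{1..N}. 1 / real j ^ 2) = (\<Sum>j<N. 1 / real (Suc j) ^ 2)"
        by (rule sum.reindex_bij_witness[of _ Suc "\<lambda>j. j - 1"]) auto
      also have "\<dots> \<le> z" unfolding z_def by (intro sum_le_suminf sm) auto
      finally show "(\<Sum>j\<in>{1..N}. 1 / real j ^ 2) \<le> z" .
    qed auto
    finally show "(\<Sum>k\<in>F. 1 / real (wdim r k) ^ 2) \<le> c ^ 2 * (\<Prod>i\<in>{1..r}. z)" .
  qed
qed auto

lemma wdim_count:
  assumes "r \<ge> 1" "x \<ge> 1"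
  shows "1 / 2 * x powr (1 / real r) \<le> real (card {k \<in> pos_vecs r. real (wdim r k) \<le> x})"
proof -
  define y where "y = x powr (1 / real r)"
  define T where "T = nat \<lfloor>y\<rfloor>"
  have y: "y \<ge> 1" unfolding y_def using assms by (intro ge_one_powr_ge_zero) auto
  have T: "real T \<le> y" "y < real T + 1" "T \<ge> 1" using y unfolding T_def by (auto simp: le_nat_iff le_floor_iff; linarith)+
  have "line_vec r ` {1..T} \<subseteq> {k \<in> pos_vecs r. real (wdim r k) \<le> x}"
  proof clarify
    fix t assume t: "t \<in> {1..T}"
    have "real (wdim r (line_vec r t)) \<le> real (t ^ r)"
      using t assms wdim_line[of r t] binomial_line_le[of t r] by simp
    also have "\<dots> = real t ^ r" by simp
    also have "\<dots> \<le> y ^ r" using t T by (intro power_mono) auto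
    also have "\<dots> = x" unfolding y_def using assms by (subst powr_realpow[symmetric]) (auto simp: powr_powr)
    finally show "line_vec r t \<in> pos_vecs r \<and> real (wdim r (line_vec r t)) \<le> x"
      using t line_vec_in by auto
  qed
  hence "card (line_vec r ` {1..T}) \<le> card {k \<in> pos_vecs r. real (wdim r k) \<le> x}"
    by (intro card_mono finite_wdim_le)
  moreover have "card (line_vec r ` {1..T}) = T"
    using inj_line_vec[OF assms(1)] by (subst card_image) (auto intro: inj_on_subset)
  ultimately have "real T \<le> real (card {k \<in> pos_vecs r. real (wdim r k) \<le> x})" by simp
  moreover have "1 / 2 * y \<le> real T" using T by linarith
  ultimately show ?thesis unfolding y_def by linarith
qed

lemma abs_sin_diff_le: "\<bar>sin (x - y)\<bar> \<le> \<bar>sin x\<bar> + \<bar>sin (y :: real)\<bar>"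
proof -
  have "\<bar>sin (x - y)\<bar> \<le> \<bar>sin x * cos y\<bar> + \<bar>cos x * sin y\<bar>"
    unfolding sin_diff by (rule abs_triangle_ineq4)
  also have "\<dots> \<le> \<bar>sin x\<bar> * 1 + 1 * \<bar>sin y\<bar>"
    unfolding abs_mult by (intro add_mono mult_mono) auto
  finally show ?thesis by simp
qed

text \<open>The \<open>j\<close>-th differences of the binomial coefficients of order \<open>j\<close> are 1. So they cannot
  all be close to multiples of a period unless 1 is.\<close>

lemma sin_binomials:
  assumes "\<And>i. i \<le> j \<Longrightarrow> \<bar>sin (real ((s + i) choose j) * \<theta> / 2)\<bar> \<le> \<delta>"
  shows "\<bar>sin (\<theta> / 2)\<bar> \<le> 2 ^ j * \<delta>"
  using assms
proof (induction j arbitrary: \<delta>)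
  case 0
  thus ?case using "0"[of 0] by simp
next
  case (Suc j)
  have "\<bar>sin (real ((s + i) choose j) * \<theta> / 2)\<bar> \<le> 2 * \<delta>" if "i \<le> j" for i
  proof -
    have "real ((s + i) choose j) * \<theta> / 2 = real ((s + Suc i) choose Suc j) * \<theta> / 2 - real ((s + i) choose Suc j) * \<theta> / 2"
      by (simp add: algebra_simps)
    hence "\<bar>sin (real ((s + i) choose j) * \<theta> / 2)\<bar> \<le> \<bar>sin (real ((s + Suc i) choose Suc j) * \<theta> / 2)\<bar> + \<bar>sin (real ((s + i) choose Suc j) * \<theta> / 2)\<bar>"
      using abs_sin_diff_le by metis
    also have "\<dots> \<le> \<delta> + \<delta>" using that by (intro add_mono Suc.prems) auto
    finally show ?thesis by simp
  qed
  from Suc.IH[OF this] show ?case by simp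
qed

text \<open>Any \<open>r + 1\<close> consecutive vectors \<open>(t, 1, \<dots>, 1)\<close> contain one with the required property by
  \<open>sin_binomials\<close>; \<open>J\<close> disjoint blocks of such vectors give \<open>J\<close> of them.\<close>

lemma wdim_aperiodic:
  assumes "r \<ge> 1"
  shows "\<exists>R c. c > 0 \<and> (\<forall>\<theta>. \<bar>\<theta>\<bar> \<le> pi \<longrightarrow>
          (\<exists>T\<subseteq>pos_vecs r. finite T \<and> card T = J \<and>
             (\<forall>k\<in>T. real (wdim r k) \<le> R \<and> c * \<bar>\<theta>\<bar> \<le> \<bar>sin (real (wdim r k) * \<theta> / 2)\<bar>)))"
proof -
  \<comment> \<open>The arguments \<open>t\<close> of the first \<open>J\<close> blocks, which start at \<open>1 + b * (r + 1)\<close>, are at most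
     \<open>1 + J * (r + 1) + r\<close>. The factor \<open>2 ^ r\<close> in \<open>c\<close> is the loss in \<open>sin_binomials\<close>.\<close>
  define R where "R = real ((1 + J * (r + 1) + r) ^ r)"
  define c where "c = 1 / (2 ^ r * pi)"
  have c: "c > 0" by (simp add: c_def)
  have "\<exists>T\<subseteq>pos_vecs r. finite T \<and> card T = J \<and>
      (\<forall>k\<in>T. real (wdim r k) \<le> R \<and> c * \<bar>\<theta>\<bar> \<le> \<bar>sin (real (wdim r k) * \<theta> / 2)\<bar>)"
    if \<theta>: "\<bar>\<theta>\<bar> \<le> pi" for \<theta> :: real
  proof -
  have "\<exists>i\<le>r. c * \<bar>\<theta>\<bar> \<le> \<bar>sin (real (wdim r (line_vec r (1 + b * (r + 1) + i))) * \<theta> / 2)\<bar>" for b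
  proof (rule ccontr)
    assume "\<not> ?thesis"
    hence A: "\<bar>sin (real (wdim r (line_vec r (1 + b * (r + 1) + i))) * \<theta> / 2)\<bar> < c * \<bar>\<theta>\<bar>" if "i \<le> r" for i
      using that by (meson not_le)
    define m where "m = Max ((\<lambda>i. \<bar>sin (real (wdim r (line_vec r (1 + b * (r + 1) + i))) * \<theta> / 2)\<bar>) ` {..r})"
    have "m < c * \<bar>\<theta>\<bar>" unfolding m_def using A by (subst Max_less_iff) auto
    moreover have "\<bar>sin (real ((b * (r + 1) + r + i) choose r) * \<theta> / 2)\<bar> \<le> m" if "i \<le> r" for i
    proof -
      have "wdim r (line_vec r (1 + b * (r + 1) + i)) = (b * (r + 1) + r + i) choose r"
        using assms by (subst wdim_line) (auto simp: algebra_simps)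
      moreover have "\<bar>sin (real (wdim r (line_vec r (1 + b * (r + 1) + i))) * \<theta> / 2)\<bar> \<le> m"
        unfolding m_def using that by (intro Max_ge) auto
      ultimately show ?thesis by simp
    qed
    hence "\<bar>sin (\<theta> / 2)\<bar> \<le> 2 ^ r * m" by (rule sin_binomials)
    ultimately have "\<bar>sin (\<theta> / 2)\<bar> < 2 ^ r * (c * \<bar>\<theta>\<bar>)"
      by (metis le_less_trans mult_less_cancel_left_pos zero_less_numeral zero_less_power)
    also have "\<dots> = \<bar>\<theta>\<bar> / pi" by (simp add: c_def)
    finally show False using abs_sin_ge[OF \<theta>] by simp
  qed
  then obtain i where i: "\<And>b. i b \<le> r"
    "\<And>b. c * \<bar>\<theta>\<bar> \<le> \<bar>sin (real (wdim r (line_vec r (1 + b * (r + 1) + i b))) * \<theta> / 2)\<bar>" by metis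
  define f where "f = (\<lambda>b. 1 + b * (r + 1) + i b)"
  have "inj f"
  proof (rule injI)
    fix b b' assume "f b = f b'"
    hence "(b * (r + 1) + i b) div (r + 1) = (b' * (r + 1) + i b') div (r + 1)" by (simp add: f_def)
    moreover have "(b * (r + 1) + i b) div (r + 1) = b" for b using i(1)[of b] by (intro div_nat_eqI) auto
    ultimately show "b = b'" by metis
  qed
  hence inj: "inj (\<lambda>b. line_vec r (f b))"
    using inj_compose[OF inj_line_vec[OF assms]] by (simp add: o_def)
  define T where "T = (\<lambda>b. line_vec r (f b)) ` {..<J}"
  show ?thesis
  proof (intro exI[of _ T] conjI ballI)
    show "T \<subseteq> pos_vecs r" by (auto simp: T_def f_def intro: line_vec_in)
    show "card T = J" unfolding T_def using inj by (subst card_image) (auto intro: inj_on_subset)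
    fix k assume "k \<in> T"
    then obtain b where b: "b < J" "k = line_vec r (f b)" by (auto simp: T_def)
    show "c * \<bar>\<theta>\<bar> \<le> \<bar>sin (real (wdim r k) * \<theta> / 2)\<bar>" using i(2)[of b] b by (simp add: f_def)
    have "wdim r k \<le> f b ^ r"
      using wdim_line[of r "f b"] binomial_line_le[of "f b" r] assms b by (simp add: f_def)
    also have "\<dots> \<le> (1 + J * (r + 1) + r) ^ r"
      using b i(1)[of b] by (intro power_mono) (auto simp: f_def intro!: add_mono)
    finally show "real (wdim r k) \<le> R" unfolding R_def by (rule of_nat_mono)
  qed (simp add: T_def)
  qed
  with c show ?thesis by blast
qed

lemma partition_weights_wdim:
  assumes "r \<ge> 1"
  shows "partition_weights (wdim r) (pos_vecs r) 2 (1 / real r) (1 / 2)"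
proof
  show "1 / 2 * x powr (1 / real r) \<le> real (card {k \<in> pos_vecs r. real (wdim r k) \<le> x})" if "1 \<le> x" for x
    using wdim_count[OF assms that] .
qed (use assms wdim_pos summable_wdim wdim_aperiodic[OF assms] in auto)

section \<open>Limit laws for multiplicities\<close>

context partition_weights
begin

definition prob :: "nat \<Rightarrow> (('a \<Rightarrow> nat) \<Rightarrow> bool) \<Rightarrow> real" where
  "prob n E = real (card {X \<in> parts a I n. E X}) / real (num_parts a I n)"

text \<open>The least multiplicity that violates the bound \<open>y\<close> on the scaled multiplicity of \<open>k\<close>.\<close>

definition threshold :: "nat \<Rightarrow> real \<Rightarrow> 'a \<Rightarrow> nat" where
  "threshold n y k = nat \<lfloor>y * saddle n / real (a k)\<rfloor> + 1"

lemma finite_parts_I: "finite (parts a I n)"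
  using finite_parts[of I a n] a_pos finite_weights_le[of "real n"] by simp

lemma le_iff_threshold:
  assumes "n \<ge> 1" "k \<in> I" "y \<ge> 0"
  shows "real (a k) / saddle n * real x \<le> y \<longleftrightarrow> x < threshold n y k"
proof -
  have s: "saddle n > 0" "real (a k) > 0" using saddle(1)[OF assms(1)] a_pos[OF assms(2)] by auto
  have "real (a k) / saddle n * real x \<le> y \<longleftrightarrow> real x \<le> y * saddle n / real (a k)"
    using s by (simp add: field_simps)
  also have "\<dots> \<longleftrightarrow> int x \<le> \<lfloor>y * saddle n / real (a k)\<rfloor>" by (simp add: le_floor_iff)
  also have "\<dots> \<longleftrightarrow> x < threshold n y k"
  proof -
    have "0 \<le> \<lfloor>y * saddle n / real (a k)\<rfloor>" using s assms by simp
    thus ?thesis unfolding threshold_def by linarith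
  qed
  finally show ?thesis .
qed

lemma threshold_bounds:
  assumes "n \<ge> 1" "k \<in> I" "y \<ge> 0"
  shows "y \<le> real (a k * threshold n y k) / saddle n"
    and "real (a k * threshold n y k) / saddle n \<le> y + real (a k) / saddle n"
proof -
  have s: "saddle n > 0" "real (a k) > 0" using saddle(1)[OF assms(1)] a_pos[OF assms(2)] by auto
  define z where "z = y * saddle n / real (a k)"
  have z: "z \<ge> 0" using s assms by (simp add: z_def)
  have t: "real (threshold n y k) = of_int \<lfloor>z\<rfloor> + 1" using z by (simp add: threshold_def z_def)
  have e: "real (a k) * z / saddle n = y" using s by (simp add: z_def)
  have "real (a k) * z / saddle n \<le> real (a k) * real (threshold n y k) / saddle n"
    unfolding t using s by (intro divide_right_mono mult_left_mono) linarith+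
  thus "y \<le> real (a k * threshold n y k) / saddle n" unfolding e by simp
  have "real (a k) * real (threshold n y k) / saddle n \<le> real (a k) * (z + 1) / saddle n"
    unfolding t using s by (intro divide_right_mono mult_left_mono) linarith+
  also have "\<dots> = y + real (a k) / saddle n" unfolding e[symmetric] by (simp add: field_simps add_divide_distrib)
  finally show "real (a k * threshold n y k) / saddle n \<le> y + real (a k) / saddle n" by simp
qed

lemma threshold_limit:
  assumes "\<And>n. n \<ge> 1 \<Longrightarrow> k n \<in> I" "(\<lambda>n. real (a (k n)) / saddle n) \<longlonglongrightarrow> 0" "y \<ge> 0"
  shows "(\<lambda>n. real (a (k n) * threshold n y (k n)) / saddle n) \<longlonglongrightarrow> y"
proof (rule real_tendsto_sandwich[OF _ _ tendsto_const])
  show "(\<lambda>n. y + real (a (k n)) / saddle n) \<longlonglongrightarrow> y"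
    using tendsto_add[OF tendsto_const assms(2), of y] by simp
  show "\<forall>\<^sub>F n in sequentially. y \<le> real (a (k n) * threshold n y (k n)) / saddle n"
    using eventually_ge_at_top[of 1] by eventually_elim (use threshold_bounds assms in auto)
  show "\<forall>\<^sub>F n in sequentially. real (a (k n) * threshold n y (k n)) / saddle n \<le> y + real (a (k n)) / saddle n"
    using eventually_ge_at_top[of 1] by eventually_elim (use threshold_bounds assms in auto)
qed

lemma fixed_part_limit: "(\<lambda>n. real (a k) / saddle n) \<longlonglongrightarrow> 0"
  by (rule real_tendsto_divide_at_top[OF tendsto_const filterlim_saddle])

lemma card_split_threshold:
  assumes "finite P"
  shows "real (card {X \<in> P. X k < (t :: nat) \<and> E X}) = real (card {X \<in> P. E X}) - real (card {X \<in> P. t \<le> X k \<and> E X})"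
proof -
  have "{X \<in> P. E X} = {X \<in> P. X k < t \<and> E X} \<union> {X \<in> P. t \<le> X k \<and> E X}" by (auto simp: not_le)
  moreover have "card ({X \<in> P. X k < t \<and> E X} \<union> {X \<in> P. t \<le> X k \<and> E X}) =
     card {X \<in> P. X k < t \<and> E X} + card {X \<in> P. t \<le> X k \<and> E X}"
    using assms by (intro card_Un_disjoint) auto
  ultimately show ?thesis by simp
qed

theorem single_multiplicity_limit:
  assumes k: "\<And>n. n \<ge> 1 \<Longrightarrow> k n \<in> I" and small: "(\<lambda>n. real (a (k n)) / saddle n) \<longlonglongrightarrow> 0" and y: "y \<ge> 0"
  shows "(\<lambda>n. prob n (\<lambda>X. real (a (k n)) / saddle n * real (X (k n)) \<le> y)) \<longlonglongrightarrow> 1 - exp (- y)"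
proof -
  define t where "t = (\<lambda>n. a (k n) * threshold n y (k n))"
  have t: "(\<lambda>n. real (t n) / saddle n) \<longlonglongrightarrow> y"
    unfolding t_def by (rule threshold_limit[OF k small y])
  have "(\<lambda>n. 1 - real (num_parts a I (n - t n)) / real (num_parts a I n)) \<longlonglongrightarrow> 1 - exp (- y)"
    by (intro tendsto_intros num_parts_ratio_limit t)
  thus ?thesis
  proof (rule Lim_transform_eventually)
    show "\<forall>\<^sub>F n in sequentially. 1 - real (num_parts a I (n - t n)) / real (num_parts a I n) =
       prob n (\<lambda>X. real (a (k n)) / saddle n * real (X (k n)) \<le> y)"
      using shift_le[OF t] num_parts_pos eventually_ge_at_top[of 1]
    proof eventually_elim
      case (elim n)
      have "real (card {X \<in> parts a I n. X (k n) < threshold n y (k n) \<and> True}) =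
        real (card {X \<in> parts a I n. True}) - real (card {X \<in> parts a I n. threshold n y (k n) \<le> X (k n) \<and> True})"
        by (rule card_split_threshold[OF finite_parts_I])
      also have "card {X \<in> parts a I n. threshold n y (k n) \<le> X (k n) \<and> True} = num_parts a I (n - t n)"
        using card_parts_shift[of "k n" I "\<lambda>_. True" a "n - t n" "threshold n y (k n)"] k[OF elim(3)] elim(1)
        by (simp add: t_def num_parts_def)
      finally show ?case
        using elim(2) le_iff_threshold[OF elim(3) k[OF elim(3)] y]
        by (simp add: prob_def num_parts_def diff_divide_distrib)
    qed
  qed
qed

text \<open>Induction on \<open>F\<close>: the partitions that violate the bound at \<open>k\<close> correspond, by removing
  \<open>threshold n (y k) k\<close> copies of \<open>k\<close>, to partitions of a smaller number. The statement therefore has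
  to allow a shift \<open>t\<close> from the start.\<close>

lemma finite_box_limit_shifted:
  assumes "finite F" "F \<subseteq> I" "\<And>k. k \<in> F \<Longrightarrow> y k \<ge> 0" "(\<lambda>n. real (t n) / saddle n) \<longlonglongrightarrow> x"
  shows "(\<lambda>n. real (card {X \<in> parts a I (n - t n). \<forall>k\<in>F. X k < threshold n (y k) k}) / real (num_parts a I n))
           \<longlonglongrightarrow> exp (- x) * (\<Prod>k\<in>F. 1 - exp (- y k))"
  using assms
proof (induction F arbitrary: t x rule: finite_induct)
  case empty
  thus ?case using num_parts_ratio_limit[of t x] by (simp add: num_parts_def)
next
  case (insert k F)
  define G where "G = (\<lambda>t n. real (card {X \<in> parts a I (n - t n). \<forall>k\<in>F. X k < threshold n (y k) k}) / real (num_parts a I n))"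
  define t' where "t' = (\<lambda>n. t n + a k * threshold n (y k) k)"
  have "(\<lambda>n. real (a k * threshold n (y k) k) / saddle n) \<longlonglongrightarrow> y k"
    using insert.prems by (intro threshold_limit[where k = "\<lambda>_. k"] fixed_part_limit) auto
  from tendsto_add[OF insert.prems(3) this]
  have t': "(\<lambda>n. real (t' n) / saddle n) \<longlonglongrightarrow> x + y k"
    by (simp add: t'_def add_divide_distrib)
  have "(\<lambda>n. G t n - G t' n) \<longlonglongrightarrow> exp (- x) * (\<Prod>k\<in>F. 1 - exp (- y k)) - exp (- (x + y k)) * (\<Prod>k\<in>F. 1 - exp (- y k))"
    unfolding G_def using insert.prems by (intro tendsto_diff insert.IH t') auto
  also have "exp (- x) * (\<Prod>k\<in>F. 1 - exp (- y k)) - exp (- (x + y k)) * (\<Prod>k\<in>F. 1 - exp (- y k)) =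
      exp (- x) * (\<Prod>k\<in>insert k F. 1 - exp (- y k))"
  proof -
    have "exp (- (x + y k)) = exp (- x) * exp (- y k)" by (simp flip: exp_add)
    thus ?thesis using insert.hyps by (simp add: algebra_simps)
  qed
  finally show ?case
  proof (rule Lim_transform_eventually)
    show "\<forall>\<^sub>F n in sequentially. G t n - G t' n =
       real (card {X \<in> parts a I (n - t n). \<forall>k\<in>insert k F. X k < threshold n (y k) k}) / real (num_parts a I n)"
      using shift_le[OF t']
    proof eventually_elim
      case (elim n)
      let ?E = "\<lambda>X. \<forall>k\<in>F. X k < threshold n (y k) k"
      have P: "?E (X(k := v)) = ?E X" for X v using insert.hyps by auto
      have "card {X \<in> parts a I (n - t n). threshold n (y k) k \<le> X k \<and> ?E X} = card {X \<in> parts a I (n - t' n). ?E X}"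
        using card_parts_shift[of k I ?E a "n - t' n" "threshold n (y k) k", OF _ P] insert.prems elim
        by (simp add: t'_def)
      moreover have "real (card {X \<in> parts a I (n - t n). X k < threshold n (y k) k \<and> ?E X}) =
         real (card {X \<in> parts a I (n - t n). ?E X}) - real (card {X \<in> parts a I (n - t n). threshold n (y k) k \<le> X k \<and> ?E X})"
        by (rule card_split_threshold[OF finite_parts_I])
      ultimately show ?case by (simp add: G_def diff_divide_distrib)
    qed
  qed
qed

lemma finite_box_limit:
  assumes "finite F" "F \<subseteq> I" "\<And>k. k \<in> F \<Longrightarrow> y k \<ge> 0"
  shows "(\<lambda>n. prob n (\<lambda>X. \<forall>k\<in>F. X k < threshold n (y k) k)) \<longlonglongrightarrow> (\<Prod>k\<in>F. 1 - exp (- y k))"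
  using finite_box_limit_shifted[OF assms, where t = "\<lambda>_. 0" and x = 0] by (simp add: prob_def)

lemma prob_exceed_bound:
  "\<exists>C\<ge>0. \<forall>\<^sub>F n in sequentially. \<forall>k\<in>I. \<forall>y\<ge>0. prob n (\<lambda>X. threshold n y k \<le> X k) \<le> C * exp (- y)"
proof -
  obtain C where C: "\<forall>\<^sub>F n in sequentially. \<forall>t\<le>n.
     real (num_parts a I (n - t)) / real (num_parts a I n) \<le> C * exp (- (real t / saddle n))"
    using num_parts_ratio_bound by blast
  have "\<forall>\<^sub>F n in sequentially. \<forall>k\<in>I. \<forall>y\<ge>0. prob n (\<lambda>X. threshold n y k \<le> X k) \<le> max 0 C * exp (- y)"
    using C eventually_ge_at_top[of 1]
  proof eventually_elim
    case (elim n)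
    show ?case
    proof (intro ballI allI impI)
      fix k y assume k: "k \<in> I" and y: "(y::real) \<ge> 0"
      let ?t = "a k * threshold n y k"
      show "prob n (\<lambda>X. threshold n y k \<le> X k) \<le> max 0 C * exp (- y)"
      proof (cases "?t \<le> n")
        case True
        have "prob n (\<lambda>X. threshold n y k \<le> X k) = real (num_parts a I (n - ?t)) / real (num_parts a I n)"
          using card_parts_shift[of k I "\<lambda>_. True" a "n - ?t" "threshold n y k"] k True
          by (simp add: prob_def num_parts_def)
        also have "\<dots> \<le> C * exp (- (real ?t / saddle n))" using elim(1) True by blast
        also have "\<dots> \<le> max 0 C * exp (- y)"
          using threshold_bounds(1)[OF elim(2) k y] by (intro mult_mono) auto
        finally show ?thesis .
      next
        case False
        have "\<not> threshold n y k \<le> X k" if "X \<in> parts a I n" for X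
        proof
          assume "threshold n y k \<le> X k"
          hence "?t \<le> a k * X k" by simp
          also have "\<dots> \<le> n" using that weight_ge[of X a k] by (auto simp: parts_def)
          finally show False using False by simp
        qed
        hence none: "{X \<in> parts a I n. threshold n y k \<le> X k} = {}" by blast
        have "prob n (\<lambda>X. threshold n y k \<le> X k) = 0" unfolding prob_def none by simp
        thus ?thesis by simp
      qed
    qed
  qed
  thus ?thesis by (intro exI[of _ "max 0 C"]) auto
qed

lemma prob_nonneg: "prob n E \<ge> 0" by (simp add: prob_def)

lemma prob_mono: "(\<And>X. E X \<Longrightarrow> E' X) \<Longrightarrow> prob n E \<le> prob n E'"
  unfolding prob_def using finite_parts_I
  by (intro divide_right_mono of_nat_mono card_mono) auto

lemma prob_union_bound:
  assumes "finite G" "\<And>X. E X \<Longrightarrow> E' X \<or> (\<exists>k\<in>G. B k X)"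
  shows "prob n E \<le> prob n E' + (\<Sum>k\<in>G. prob n (B k))"
proof -
  have "{X \<in> parts a I n. E X} \<subseteq> {X \<in> parts a I n. E' X} \<union> (\<Union>k\<in>G. {X \<in> parts a I n. B k X})"
    using assms(2) by blast
  hence "card {X \<in> parts a I n. E X} \<le> card ({X \<in> parts a I n. E' X} \<union> (\<Union>k\<in>G. {X \<in> parts a I n. B k X}))"
    using assms(1) finite_parts_I by (intro card_mono) auto
  also have "\<dots> \<le> card {X \<in> parts a I n. E' X} + card (\<Union>k\<in>G. {X \<in> parts a I n. B k X})"
    by (rule card_Un_le)
  also have "\<dots> \<le> card {X \<in> parts a I n. E' X} + (\<Sum>k\<in>G. card {X \<in> parts a I n. B k X})"
    using assms(1) by (intro add_left_mono card_UN_le)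
  finally have "real (card {X \<in> parts a I n. E X}) \<le> real (card {X \<in> parts a I n. E' X}) + (\<Sum>k\<in>G. real (card {X \<in> parts a I n. B k X}))"
    by (metis (mono_tags, lifting) of_nat_add of_nat_le_iff of_nat_sum sum.cong)
  hence "prob n E \<le> (real (card {X \<in> parts a I n. E' X}) + (\<Sum>k\<in>G. real (card {X \<in> parts a I n. B k X}))) / real (num_parts a I n)"
    unfolding prob_def by (intro divide_right_mono) auto
  thus ?thesis by (simp add: prob_def add_divide_distrib sum_divide_distrib)
qed

text \<open>Restricting the event to a fixed \<open>F m\<close> bounds its probability from above. From below, the parts in
  \<open>F n - F m\<close> cost at most a constant times the sum of \<open>exp (- y k)\<close> over them. If \<open>L > 0\<close>, these
  sums are small for large \<open>m\<close>, uniformly in \<open>n\<close>, because the sum of \<open>exp (- y k)\<close> over \<open>F n\<close> is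
  at most \<open>- ln L\<close>.\<close>

theorem joint_multiplicity_limit:
  assumes F: "\<And>n. n \<ge> 1 \<Longrightarrow> finite (F n)" "\<And>n. n \<ge> 1 \<Longrightarrow> F n \<subseteq> I" "\<And>m n. 1 \<le> m \<Longrightarrow> m \<le> n \<Longrightarrow> F m \<subseteq> F n"
    and y: "\<And>n k. n \<ge> 1 \<Longrightarrow> k \<in> F n \<Longrightarrow> y k \<ge> 0"
  shows "\<exists>L. (\<lambda>n. prob n (\<lambda>X. \<forall>k\<in>F n. real (a k) / saddle n * real (X k) \<le> y k)) \<longlonglongrightarrow> L \<and>
             (\<lambda>n. \<Prod>k\<in>F n. 1 - exp (- y k)) \<longlonglongrightarrow> L"
proof -
  define p where "p = (\<lambda>n. \<Prod>k\<in>F n. 1 - exp (- y k))"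
  define Q where "Q = (\<lambda>m n. prob n (\<lambda>X. \<forall>k\<in>F m. X k < threshold n (y k) k))"
  have fac: "0 \<le> 1 - exp (- y k)" "1 - exp (- y k) \<le> 1" if "n \<ge> 1" "k \<in> F n" for n k
    using y[OF that] by auto
  have p01: "0 \<le> p n" "p n \<le> 1" if "n \<ge> 1" for n
    unfolding p_def using fac[OF that] by (auto intro!: prod_nonneg prod_le_1)
  have p_anti: "p n \<le> p m" if "1 \<le> m" "m \<le> n" for m n
  proof -
    have n: "n \<ge> 1" using that by simp
    have "p n = p m * (\<Prod>k\<in>F n - F m. 1 - exp (- y k))"
      unfolding p_def using F(1)[OF n] F(3)[OF that] by (simp add: prod.subset_diff mult.commute)
    also have "\<dots> \<le> p m * 1"
      using p01[OF that(1)] fac[OF n] by (intro mult_left_mono prod_le_1) auto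
    finally show ?thesis by simp
  qed
  have "decseq (\<lambda>n. p (Suc n))" using p_anti by (intro decseq_SucI) simp
  moreover have "bdd_below (range (\<lambda>n. p (Suc n)))" using p01 by (intro bdd_belowI[of _ 0]) auto
  ultimately have "(\<lambda>n. p (Suc n)) \<longlonglongrightarrow> (INF n. p (Suc n))" by (rule LIMSEQ_decseq_INF[rotated])
  then obtain L where L': "(\<lambda>n. p (Suc n)) \<longlonglongrightarrow> L" by blast
  hence L: "p \<longlonglongrightarrow> L" by (rule LIMSEQ_imp_Suc)
  have L0: "0 \<le> L" by (rule LIMSEQ_le_const[OF L']) (use p01 in auto)
  have Lp: "L \<le> p m" if "m \<ge> 1" for m
    by (rule LIMSEQ_le_const2[OF L]) (use p_anti that in auto)
  have Qlim: "(\<lambda>n. Q m n) \<longlonglongrightarrow> p m" if "m \<ge> 1" for m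
    unfolding Q_def p_def using F y that by (intro finite_box_limit) auto
  have upper: "\<forall>\<^sub>F n in sequentially. Q n n < L + e" if e: "e > 0" for e
  proof -
    have "\<forall>\<^sub>F m in sequentially. p m < L + e" using L e by (intro order_tendstoD) auto
    then obtain N where N: "\<And>m. m \<ge> N \<Longrightarrow> p m < L + e" unfolding eventually_sequentially by blast
    define M where "M = max 1 N"
    have M: "p M < L + e" "M \<ge> 1" using N[of M] by (auto simp: M_def)
    have "\<forall>\<^sub>F n in sequentially. Q M n < L + e" using Qlim[OF M(2)] M(1) by (rule order_tendstoD)
    with eventually_ge_at_top[of M] show ?thesis
    proof eventually_elim
      case (elim n)
      have "Q n n \<le> Q M n" unfolding Q_def using F(3)[OF M(2) elim(1)] by (intro prob_mono) auto
      thus ?case using elim by linarith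
    qed
  qed
  have lower: "\<forall>\<^sub>F n in sequentially. L - e < Q n n" if e: "e > 0" for e
  proof (cases "L = 0")
    case True
    have "0 \<le> Q n n" for n unfolding Q_def by (rule prob_nonneg)
    hence "L - e < Q n n" for n using e True by (smt (verit))
    thus ?thesis by simp
  next
    case False
    hence Lpos: "L > 0" using L0 by simp
    define S where "S = (\<lambda>n. \<Sum>k\<in>F n. exp (- y k))"
    have S_le: "S n \<le> - ln L" if n: "n \<ge> 1" for n
    proof -
      have "L \<le> p n" by (rule Lp[OF n])
      also have "\<dots> \<le> (\<Prod>k\<in>F n. exp (- exp (- y k)))"
        unfolding p_def using fac[OF n] exp_ge_add_one_self[of "- exp (- y k)" for k] by (intro prod_mono) auto
      also have "\<dots> = exp (- S n)" unfolding S_def using F(1)[OF n] by (simp add: exp_sum sum_negf flip: exp_sum)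
      finally have "ln L \<le> ln (exp (- S n))" using Lpos by (subst ln_le_cancel_iff) auto
      thus ?thesis by simp
    qed
    have S_mono: "S m \<le> S n" if "1 \<le> m" "m \<le> n" for m n
      unfolding S_def using F(1)[of n] F(3)[OF that] that by (intro sum_mono2) auto
    have "incseq (\<lambda>n. S (Suc n))" using S_mono by (intro incseq_SucI) simp
    moreover have "S (Suc n) \<le> - ln L" for n using S_le by simp
    ultimately obtain S' where S': "(\<lambda>n. S (Suc n)) \<longlonglongrightarrow> S'" "\<And>n. S (Suc n) \<le> S'"
      using incseq_convergent[of "\<lambda>n. S (Suc n)" "- ln L"] by blast
    obtain C where C: "C \<ge> 0" "\<forall>\<^sub>F n in sequentially. \<forall>k\<in>I. \<forall>y\<ge>0. prob n (\<lambda>X. threshold n y k \<le> X k) \<le> C * exp (- y)"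
      using prob_exceed_bound by blast
    \<comment> \<open>\<open>C\<close> may be 0, whence the \<open>C + 1\<close>.\<close>
    define d where "d = e / (2 * (C + 1))"
    have d: "d > 0" using e C by (simp add: d_def)
    have "\<forall>\<^sub>F m in sequentially. S' - d < S (Suc m)" using S'(1) d by (intro order_tendstoD) auto
    then obtain N where "S' - d < S (Suc N)" unfolding eventually_sequentially by blast
    define M where "M = Suc N"
    have M: "M \<ge> 1" "S' - d < S M" using \<open>S' - d < S (Suc N)\<close> by (auto simp: M_def)
    have "\<forall>\<^sub>F n in sequentially. p M - e / 2 < Q M n" using Qlim[OF M(1)] e by (intro order_tendstoD) auto
    with C(2) eventually_ge_at_top[of M] show ?thesis
    proof eventually_elim
      case (elim n)
      have n: "n \<ge> 1" using elim(2) M by simp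
      have "Q M n \<le> Q n n + (\<Sum>k\<in>F n - F M. prob n (\<lambda>X. threshold n (y k) k \<le> X k))"
        unfolding Q_def using F(1)[OF n] by (intro prob_union_bound) (auto simp: not_less[symmetric])
      also have "(\<Sum>k\<in>F n - F M. prob n (\<lambda>X. threshold n (y k) k \<le> X k)) \<le> (\<Sum>k\<in>F n - F M. C * exp (- y k))"
        using elim(1) F(2)[OF n] y[OF n] by (intro sum_mono) auto
      also have "\<dots> = C * (S n - S M)"
        unfolding S_def using F(1)[OF n] F(3)[OF M(1) elim(2)]
        by (simp add: sum_diff sum_distrib_left[symmetric] finite_subset)
      also have "\<dots> \<le> C * d"
      proof (rule mult_left_mono)
        have "S n \<le> S'" using S'(2)[of "n - 1"] n by simp
        thus "S n - S M \<le> d" using M by linarith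
      qed (rule C)
      also have "\<dots> \<le> (C + 1) * d" using d by simp
      also have "\<dots> = e / 2"
      proof -
        have "z * (e / (2 * z)) = e / 2" if "z > 0" for z using that by simp
        from this[of "C + 1"] C(1) show ?thesis by (simp add: d_def)
      qed
      finally have "Q M n \<le> Q n n + e / 2" by simp
      moreover have "L - e / 2 < Q M n" using elim(3) Lp[OF M(1)] by linarith
      ultimately show ?case by linarith
    qed
  qed
  have "(\<lambda>n. Q n n) \<longlonglongrightarrow> L"
  proof (rule order_tendstoI)
    fix l assume "l < L"
    thus "\<forall>\<^sub>F n in sequentially. l < Q n n" using lower[of "L - l"] by simp
  next
    fix u assume "L < u"
    thus "\<forall>\<^sub>F n in sequentially. Q n n < u" using upper[of "u - L"] by simp
  qed
  hence "(\<lambda>n. prob n (\<lambda>X. \<forall>k\<in>F n. real (a k) / saddle n * real (X k) \<le> y k)) \<longlonglongrightarrow> L"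
  proof (rule Lim_transform_eventually)
    show "\<forall>\<^sub>F n in sequentially. Q n n = prob n (\<lambda>X. \<forall>k\<in>F n. real (a k) / saddle n * real (X k) \<le> y k)"
      using eventually_ge_at_top[of 1]
    proof eventually_elim
      case (elim n)
      have "(\<forall>k\<in>F n. X k < threshold n (y k) k) = (\<forall>k\<in>F n. real (a k) / saddle n * real (X k) \<le> y k)" for X :: "'a \<Rightarrow> nat"
        using le_iff_threshold[OF elim] F(2)[OF elim] y[OF elim] by (intro ball_cong) auto
      thus ?case by (simp add: Q_def)
    qed
  qed
  thus ?thesis using L unfolding p_def by blast
qed

end

section \<open>Representations\<close>

lemma reps_eq_parts: "reps_of_dim r n = parts (wdim r) (pos_vecs r) n"
proof -
  have "rep_dim r X = real (weight (wdim r) X)" if "{k. X k \<noteq> 0} \<subseteq> pos_vecs r" for X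
    unfolding rep_dim_def weight_def of_nat_sum of_nat_mult
    using that weyl_dim_eq by (intro sum.cong) auto
  thus ?thesis by (auto simp: reps_of_dim_def is_rep_def parts_def)
qed

context
  fixes r :: nat
  assumes r: "r \<ge> 1"
begin

interpretation W: partition_weights "wdim r" "pos_vecs r" 2 "1 / real r" "1 / 2"
  by (rule partition_weights_wdim[OF r])

lemma q_equation_iff:
  assumes "B > 0"
  shows "((\<lambda>k. let d = weyl_dim r (\<lambda>i. real (k i)) in d * exp (- (1 / B)) powr d / (1 - exp (- (1 / B)) powr d))
           has_sum S) (pos_vecs r) \<longleftrightarrow> S = W.mean B"
proof -
  have "((\<lambda>k. let d = weyl_dim r (\<lambda>i. real (k i)) in d * exp (- (1 / B)) powr d / (1 - exp (- (1 / B)) powr d))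
           has_sum S) (pos_vecs r) \<longleftrightarrow> (W.mom 1 B has_sum S) (pos_vecs r)"
  proof (rule has_sum_cong)
    fix k assume k: "k \<in> pos_vecs r"
    have "exp (- (1 / B)) powr d = exp (- (d / B))" for d :: real by (simp add: powr_def)
    thus "(let d = weyl_dim r (\<lambda>i. real (k i)) in d * exp (- (1 / B)) powr d / (1 - exp (- (1 / B)) powr d)) = W.mom 1 B k"
      by (simp add: W.mom_def weyl_dim_eq[OF k] Let_def)
  qed
  also have "\<dots> \<longleftrightarrow> S = W.mean B"
    using W.has_sum_mean[OF assms] has_sum_unique by blast
  finally show ?thesis .
qed

lemma q_param_eq:
  assumes "n \<ge> 1"
  shows "q_param r n = exp (- (1 / W.saddle n))"
  unfolding q_param_def
proof (rule the_equality)
  show "0 < exp (- (1 / W.saddle n)) \<and> exp (- (1 / W.saddle n)) < 1 \<and>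
    ((\<lambda>k. let d = weyl_dim r (\<lambda>i. real (k i)) in d * exp (- (1 / W.saddle n)) powr d / (1 - exp (- (1 / W.saddle n)) powr d))
       has_sum real n) (pos_vecs r)"
    using W.saddle[OF assms] by (simp add: q_equation_iff)
  fix q assume q: "0 < q \<and> q < 1 \<and> ((\<lambda>k. let d = weyl_dim r (\<lambda>i. real (k i)) in d * q powr d / (1 - q powr d)) has_sum real n) (pos_vecs r)"
  define B where "B = - (1 / ln q)"
  have B: "B > 0" "q = exp (- (1 / B))" using q by (auto simp: B_def)
  have "W.mean B = real n" using q q_equation_iff[OF B(1)] B(2) by simp
  hence "B = W.saddle n" using W.ex1_mean_eq[OF assms] W.saddle[OF assms] B(1) by auto
  thus "q = exp (- (1 / W.saddle n))" using B(2) by simp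
qed

lemma s_param:
  assumes "n \<ge> 1"
  shows "s_param r n > 0" "s_param r n powr (real (r * (r + 1)) / 2) = 1 / W.saddle n"
proof -
  define D where "D = real (r * (r + 1)) / 2"
  have "0 < r * (r + 1)" using r by simp
  hence D: "D > 0" unfolding D_def by (simp only: of_nat_0_less_iff zero_less_divide_iff) simp
  have B: "W.saddle n > 0" by (rule W.saddle(1)[OF assms])
  define s where "s = (1 / W.saddle n) powr (1 / D)"
  have s: "s > 0" "s powr D = 1 / W.saddle n" using B D by (auto simp: s_def powr_powr)
  have "s_param r n = s"
    unfolding s_param_def q_param_eq[OF assms] D_def[symmetric]
  proof (rule the_equality)
    fix s' assume s': "0 < s' \<and> exp (- (1 / W.saddle n)) = exp (- (s' powr D))"
    hence "s' powr D = s powr D" using s by simp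
    moreover have "z = (z powr D) powr (1 / D)" if "z > 0" for z
      using that D by (simp add: powr_powr)
    ultimately show "s' = s" using s' s(1) by metis
  qed (use s in auto)
  thus "s_param r n > 0" "s_param r n powr (real (r * (r + 1)) / 2) = 1 / W.saddle n"
    using s by (simp_all add: D_def)
qed

lemma scaled_dim_eq:
  assumes "n \<ge> 1" "k \<in> pos_vecs r"
  shows "scaled_dim r n k = real (wdim r k) / W.saddle n"
  unfolding scaled_dim_def weyl_dim_scale[OF s_param(1)[OF assms(1)]] s_param(2)[OF assms(1)]
  using weyl_dim_eq[OF assms(2)] by simp

lemma rep_prob_eq: "\<forall>\<^sub>F n in sequentially. \<forall>E. rep_prob r n E = W.prob n E"
  using W.num_parts_pos
proof eventually_elim
  case (elim n)
  let ?P = "parts (wdim r) (pos_vecs r) n"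
  have fin: "finite ?P" by (rule W.finite_parts_I)
  have ne: "?P \<noteq> {}" using elim by (auto simp: num_parts_def)
  show ?case
  proof
    fix E
    have "rep_prob r n E = real (card (?P \<inter> {X. E X})) / real (card ?P)"
      unfolding rep_prob_def reps_eq_parts by (rule measure_pmf_of_set[OF ne fin])
    thus "rep_prob r n E = W.prob n E" by (simp add: W.prob_def num_parts_def Int_def)
  qed
qed

lemma rep_single_limit:
  assumes "\<forall>n\<ge>1. k n \<in> pos_vecs r" "(\<lambda>n. scaled_dim r n (k n)) \<in> o(\<lambda>n. 1)" "x \<ge> 0"
  shows "(\<lambda>n. rep_prob r n (\<lambda>X. scaled_dim r n (k n) * real (X (k n)) \<le> x)) \<longlonglongrightarrow> 1 - exp (- x)"
proof -
  have "(\<lambda>n. scaled_dim r n (k n)) \<longlonglongrightarrow> 0" using smalloD_tendsto[OF assms(2)] by simp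
  hence "(\<lambda>n. real (wdim r (k n)) / W.saddle n) \<longlonglongrightarrow> 0"
    by (rule Lim_transform_eventually)
       (use eventually_ge_at_top[of 1] in eventually_elim, use assms(1) scaled_dim_eq in auto)
  hence "(\<lambda>n. W.prob n (\<lambda>X. real (wdim r (k n)) / W.saddle n * real (X (k n)) \<le> x)) \<longlonglongrightarrow> 1 - exp (- x)"
    using assms by (intro W.single_multiplicity_limit) auto
  thus ?thesis
    by (rule Lim_transform_eventually)
       (use rep_prob_eq eventually_ge_at_top[of 1] in eventually_elim, use assms(1) scaled_dim_eq in auto)
qed

lemma rep_joint_limit:
  assumes "\<And>n. n \<ge> 1 \<Longrightarrow> finite (F n)" "\<And>n. n \<ge> 1 \<Longrightarrow> F n \<subseteq> pos_vecs r"
    "\<And>m n. 1 \<le> m \<Longrightarrow> m \<le> n \<Longrightarrow> F m \<subseteq> F n" "\<And>n k. n \<ge> 1 \<Longrightarrow> k \<in> F n \<Longrightarrow> x k \<ge> 0"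
  shows "\<exists>L. (\<lambda>n. rep_prob r n (\<lambda>X. \<forall>k\<in>F n. scaled_dim r n k * real (X k) \<le> x k)) \<longlonglongrightarrow> L \<and>
             (\<lambda>n. \<Prod>k\<in>F n. 1 - exp (- x k)) \<longlonglongrightarrow> L"
proof -
  obtain L where L: "(\<lambda>n. W.prob n (\<lambda>X. \<forall>k\<in>F n. real (wdim r k) / W.saddle n * real (X k) \<le> x k)) \<longlonglongrightarrow> L"
     "(\<lambda>n. \<Prod>k\<in>F n. 1 - exp (- x k)) \<longlonglongrightarrow> L"
    using W.joint_multiplicity_limit[of F x] assms by blast
  have "(\<lambda>n. rep_prob r n (\<lambda>X. \<forall>k\<in>F n. scaled_dim r n k * real (X k) \<le> x k)) \<longlonglongrightarrow> L"
  proof (rule Lim_transform_eventually[OF L(1)])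
    show "\<forall>\<^sub>F n in sequentially. W.prob n (\<lambda>X. \<forall>k\<in>F n. real (wdim r k) / W.saddle n * real (X k) \<le> x k) =
       rep_prob r n (\<lambda>X. \<forall>k\<in>F n. scaled_dim r n k * real (X k) \<le> x k)"
      using rep_prob_eq eventually_ge_at_top[of 1]
    proof eventually_elim
      case (elim n)
      have "scaled_dim r n k = real (wdim r k) / W.saddle n" if "k \<in> F n" for k
        using scaled_dim_eq[OF elim(2)] assms(2)[OF elim(2)] that by auto
      hence "(\<forall>k\<in>F n. scaled_dim r n k * real (X k) \<le> x k) = (\<forall>k\<in>F n. real (wdim r k) / W.saddle n * real (X k) \<le> x k)"
        for X by (intro ball_cong) auto
      thus ?case using elim(1) by simp
    qed
  qed
  with L(2) show ?thesis by blast
qed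

end

theorem theorem5p1:
  fixes r :: nat
  assumes "r \<ge> 2"
  shows
    "(\<forall>k :: nat \<Rightarrow> nat \<Rightarrow> nat.
        (\<forall>n\<ge>1. k n \<in> pos_vecs r) \<longrightarrow>
        (\<lambda>n. scaled_dim r n (k n)) \<in> o(\<lambda>n. 1) \<longrightarrow>
        (\<forall>x::real. x \<ge> 0 \<longrightarrow>
           (\<lambda>n. rep_prob r n (\<lambda>X. scaled_dim r n (k n) * real (X (k n)) \<le> x))
             \<longlonglongrightarrow> 1 - exp (- x)))
     \<and>
     (\<forall>(\<kappa> :: nat \<Rightarrow> nat \<Rightarrow> nat) (x :: (nat \<Rightarrow> nat) \<Rightarrow> real).
        (\<forall>n\<ge>1. \<kappa> n \<in> pos_vecs r) \<longrightarrow>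
        (\<forall>j\<in>{1..r}. \<forall>m n. 1 \<le> m \<longrightarrow> m \<le> n \<longrightarrow> \<kappa> m j \<le> \<kappa> n j) \<longrightarrow>
        (\<lambda>n. scaled_dim r n (\<kappa> n))
          \<in> o(\<lambda>n. s_param r n powr (real (r * (r + 1)) / real (r + 3))) \<longrightarrow>
        (\<forall>k\<in>pos_vecs r.
           (\<forall>j\<in>{1..r}. enat (k j) \<le> (SUP n\<in>{1..}. enat (\<kappa> n j))) \<longrightarrow> x k \<ge> 0) \<longrightarrow>
        (\<exists>L::real.
           (\<lambda>n. rep_prob r n
                  (\<lambda>X. \<forall>k\<in>int_box r (\<kappa> n). scaled_dim r n k * real (X k) \<le> x k))
             \<longlonglongrightarrow> L \<and>
           (\<lambda>n. \<Prod>k\<in>int_box r (\<kappa> n). 1 - exp (- x k)) \<longlonglongrightarrow> L))"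
proof (intro conjI allI impI)
  have r: "r \<ge> 1" using assms by simp
  fix k :: "nat \<Rightarrow> nat \<Rightarrow> nat" and x :: real
  assume "\<forall>n\<ge>1. k n \<in> pos_vecs r" "(\<lambda>n. scaled_dim r n (k n)) \<in> o(\<lambda>n. 1)" "x \<ge> 0"
  thus "(\<lambda>n. rep_prob r n (\<lambda>X. scaled_dim r n (k n) * real (X (k n)) \<le> x)) \<longlonglongrightarrow> 1 - exp (- x)"
    by (rule rep_single_limit[OF r])
next
  have r: "r \<ge> 1" using assms by simp
  fix \<kappa> :: "nat \<Rightarrow> nat \<Rightarrow> nat" and x :: "(nat \<Rightarrow> nat) \<Rightarrow> real"
  assume mono: "\<forall>j\<in>{1..r}. \<forall>m n. 1 \<le> m \<longrightarrow> m \<le> n \<longrightarrow> \<kappa> m j \<le> \<kappa> n j"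
    and x: "\<forall>k\<in>pos_vecs r. (\<forall>j\<in>{1..r}. enat (k j) \<le> (SUP n\<in>{1..}. enat (\<kappa> n j))) \<longrightarrow> x k \<ge> 0"
  show "\<exists>L::real.
           (\<lambda>n. rep_prob r n
                  (\<lambda>X. \<forall>k\<in>int_box r (\<kappa> n). scaled_dim r n k * real (X k) \<le> x k))
             \<longlonglongrightarrow> L \<and>
           (\<lambda>n. \<Prod>k\<in>int_box r (\<kappa> n). 1 - exp (- x k)) \<longlonglongrightarrow> L"
  proof (rule rep_joint_limit[OF r])
    show "finite (int_box r (\<kappa> n))" for n unfolding int_box_def by (intro finite_PiE) auto
    show sub: "int_box r (\<kappa> n) \<subseteq> pos_vecs r" for n
      unfolding int_box_def pos_vecs_def by (intro PiE_mono) auto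
    show "int_box r (\<kappa> m) \<subseteq> int_box r (\<kappa> n)" if "1 \<le> m" "m \<le> n" for m n
      unfolding int_box_def using mono that by (intro PiE_mono) auto
    show "x k \<ge> 0" if n: "n \<ge> 1" and k: "k \<in> int_box r (\<kappa> n)" for n k
    proof -
      have "enat (k j) \<le> (SUP n\<in>{1..}. enat (\<kappa> n j))" if j: "j \<in> {1..r}" for j
      proof -
        have "k j \<le> \<kappa> n j" using k j by (auto simp: int_box_def)
        thus ?thesis using n by (intro SUP_upper2[of n]) auto
      qed
      thus ?thesis using x sub[of n] k by blast
    qed
  qed
qed

end
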